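(* Let $K$ be a field, let $q\geq 3$ be an integer, and let $G$ be a finite connected simple graph with non-edge blocks $B_1,\ldots,B_s$. Then the edge ring $K[G]$ has a $q$-linear resolution if and only if $G$ satisfies one of the following: (i) $s=1$ and $B_1$ is an even cycle of length $2q$. (ii) $s=1$ and $B_1$ is a non-bipartite graph obtained by adding a path to an even cycle of length $2q$. (iii) $s=2$ and $B_1$ is an even cycle of length $2q$, and $B_2$ is an odd cycle, or vice versa. (iv) $s=2$ and $B_1$ and $B_2$ are odd cycles having one common vertex; in addition, $r_1+r_2=2q$, where $r_i$ is the length of $B_i$. (v) $s=2$ and $B_1$ and $B_2$ are odd cycles without a common vertex; in addition, the length of the shortest path from a vertex of $B_1$ to a vertex of $B_2$ is $q-(r_1+r_2)/2$, where $r_i$ is the length of $B_i$.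
   Context: For a finite simple graph $G$ on the vertex set $\{1,\ldots,n\}$ with edges $e_1,\ldots,e_m$, the edge ring $K[G]$ is the $K$-subalgebra of $K[x_1,\ldots,x_n]$ generated by the monomials $x_ix_j$ with $\{i,j\}$ an edge of $G$. Let $S=K[y_1,\ldots,y_m]$ be the polynomial ring with $\deg y_k=1$, and let $I_G\subset S$ be the kernel of the surjection $S\to K[G]$ sending $y_k$ to $x_ix_j$ where $e_k=\{i,j\}$; $I_G$ is a homogeneous ideal and $K[G]\cong S/I_G$. For a homogeneous ideal $0\neq I\subset S$, with graded minimal free resolution $0 \to \bigoplus_{j} S(-j)^{\beta_{h,j}} \to \cdots \to \bigoplus_{j} S(-j)^{\beta_{1,j}} \to S \to S/I \to 0$, the ring $S/I$ has a $q$-linear resolution if $\beta_{i,j}=0$ for each $1\le i\le h$ and each $j\neq q+i-1$. The notion presupposes $I\neq 0$; "$K[G]$ has a $q$-linear resolution" means that $I_G\neq 0$ and $S/I_G$ has a $q$-linear resolution. A vertex $v$ of a connected graph is a cut vertex if removing $v$ leaves a disconnected graph. A block of $G$ is a maximal connected subgraph of $G$ with no cut vertices. A non-edge block is a block that is not a single edge; $B_1,\ldots,B_s$ is the list of all non-edge blocks of $G$. A graph obtained by adding a path to a cycle $C$ is a (simple) graph obtained from $C$ by joining two distinct vertices of $C$ by a path of length at least $1$ whose interior vertices (if any) are new and whose edges are not edges of $C$. *)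

theory Defs
  imports Complex_Main "HOL-Library.Poly_Mapping" "Jordan_Normal_Form.Matrix"
begin

section \<open>Polynomial rings\<close>

text \<open>A polynomial is a finitely supported map from exponent vectors to coefficients. The
  polynomial ring in a given set \<open>X\<close> of variables is the subring \<open>poly_ring X\<close>.\<close>

type_synonym ('x, 'k) mpoly = "('x \<Rightarrow>\<^sub>0 nat) \<Rightarrow>\<^sub>0 'k"

definition Const :: "'k::comm_ring_1 \<Rightarrow> ('x, 'k) mpoly" where
  "Const c = Poly_Mapping.single 0 c"

definition Var :: "'x \<Rightarrow> ('x, 'k::comm_ring_1) mpoly" where
  "Var x = Poly_Mapping.single (Poly_Mapping.single x 1) 1"

definition poly_ring :: "'x set \<Rightarrow> ('x, 'k::comm_ring_1) mpoly set" where
  "poly_ring X = {f. \<forall>t \<in> Poly_Mapping.keys f. Poly_Mapping.keys t \<subseteq> X}"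

definition mon_degree :: "('x \<Rightarrow>\<^sub>0 nat) \<Rightarrow> nat" where
  "mon_degree t = (\<Sum>x \<in> Poly_Mapping.keys t. Poly_Mapping.lookup t x)"

definition homogeneous :: "int \<Rightarrow> ('x, 'k::comm_ring_1) mpoly \<Rightarrow> bool" where
  "homogeneous d f \<longleftrightarrow> (\<forall>t \<in> Poly_Mapping.keys f. int (mon_degree t) = d)"

definition eval_mpoly ::
  "('x \<Rightarrow> ('y, 'k) mpoly) \<Rightarrow> ('x, 'k) mpoly \<Rightarrow> ('y, 'k::comm_ring_1) mpoly" where
  "eval_mpoly s f = (\<Sum>t \<in> Poly_Mapping.keys f.
     Const (Poly_Mapping.lookup f t) * (\<Prod>x \<in> Poly_Mapping.keys t. s x ^ Poly_Mapping.lookup t x))"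


section \<open>Graded minimal free resolutions\<close>

text \<open>A finite graded free module \<open>S(-j\<^sub>1) \<oplus> \<dots> \<oplus> S(-j\<^sub>b)\<close> over \<open>S = poly_ring X\<close> is given by the
  list \<open>[j\<^sub>1, \<dots>, j\<^sub>b]\<close> of its shifts; its elements are the vectors of length \<open>b\<close> with entries in \<open>S\<close>.\<close>

definition free_module :: "'x set \<Rightarrow> int list \<Rightarrow> ('x, 'k::comm_ring_1) mpoly vec set" where
  "free_module X js = {v \<in> carrier_vec (length js). \<forall>k < length js. v $ k \<in> poly_ring X}"

text \<open>Degree-preserving \<open>S\<close>-linear maps \<open>\<Oplus>\<^sub>l S(-js\<^sub>l) \<rightarrow> \<Oplus>\<^sub>k S(-is\<^sub>k)\<close>, as matrices. The basis vector
  number \<open>l\<close> of the source has degree \<open>js\<^sub>l\<close>, so the entry in row \<open>k\<close> has degree \<open>js\<^sub>l - is\<^sub>k\<close>.\<close>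

definition graded_hom :: "'x set \<Rightarrow> int list \<Rightarrow> int list \<Rightarrow> ('x, 'k::comm_ring_1) mpoly mat set" where
  "graded_hom X js is = {M \<in> carrier_mat (length is) (length js).
     \<forall>k < length is. \<forall>l < length js.
       M $$ (k, l) \<in> poly_ring X \<and> homogeneous (js ! l - is ! k) (M $$ (k, l))}"

definition hom_image :: "'x set \<Rightarrow> int list \<Rightarrow> ('x, 'k::comm_ring_1) mpoly mat \<Rightarrow> ('x, 'k) mpoly vec set" where
  "hom_image X js M = (\<lambda>v. M *\<^sub>v v) ` free_module X js"

definition hom_kernel :: "'x set \<Rightarrow> int list \<Rightarrow> ('x, 'k::comm_ring_1) mpoly mat \<Rightarrow> ('x, 'k) mpoly vec set" where
  "hom_kernel X js M = {v \<in> free_module X js. M *\<^sub>v v = 0\<^sub>v (dim_row M)}"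

text \<open>\<open>F i\<close> lists the shifts of the \<open>i\<close>-th module and \<open>M i\<close> is the differential from the \<open>i\<close>-th to
  the \<open>(i - 1)\<close>-st module. Since \<open>F (Suc h)\<close> is the zero module, exactness at \<open>i = h\<close> says that
  \<open>M h\<close> is injective. Minimality: all matrix entries lie in the ideal generated by the variables.\<close>

definition graded_minimal_free_resolution ::
  "'x set \<Rightarrow> ('x, 'k::field) mpoly set \<Rightarrow> nat \<Rightarrow> (nat \<Rightarrow> int list) \<Rightarrow>
     (nat \<Rightarrow> ('x, 'k) mpoly mat) \<Rightarrow> bool" where
  "graded_minimal_free_resolution X I h F M \<longleftrightarrow>
     F 0 = [0] \<and> (\<forall>i > h. F i = []) \<and>
     (\<forall>i \<ge> 1. M i \<in> graded_hom X (F i) (F (i - 1))) \<and>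
     (\<lambda>v. v $ 0) ` hom_image X (F 1) (M 1) = I \<and>
     (\<forall>i \<ge> 1. hom_kernel X (F i) (M i) = hom_image X (F (i + 1)) (M (i + 1))) \<and>
     (\<forall>i \<ge> 1. \<forall>k < length (F (i - 1)). \<forall>l < length (F i).
        Poly_Mapping.lookup (M i $$ (k, l)) 0 = 0)"

text \<open>For an ideal \<open>I\<close> of \<open>S = poly_ring X\<close>: the quotient \<open>S/I\<close> has a \<open>q\<close>-linear resolution.
  The graded Betti number in homological degree \<open>i\<close> and internal degree \<open>j\<close> is the number of
  occurrences of \<open>j\<close> in \<open>F i\<close>; the resolution is unique up to isomorphism.\<close>

definition has_linear_resolution :: "'x set \<Rightarrow> ('x, 'k::field) mpoly set \<Rightarrow> nat \<Rightarrow> bool" where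
  "has_linear_resolution X I q \<longleftrightarrow>
     I \<noteq> {0} \<and>
     (\<exists>h F M. graded_minimal_free_resolution X I h F M \<and>
        (\<forall>i \<in> {1..h}. \<forall>j. j \<noteq> int q + int i - 1 \<longrightarrow> count_list (F i) j = 0))"


section \<open>Graphs\<close>

type_synonym 'v graph = "'v set \<times> 'v set set"

abbreviation verts :: "'v graph \<Rightarrow> 'v set" where "verts \<equiv> fst"

abbreviation edges :: "'v graph \<Rightarrow> 'v set set" where "edges \<equiv> snd"

definition simple_graph :: "'v graph \<Rightarrow> bool" where
  "simple_graph G \<longleftrightarrow> (\<forall>e \<in> edges G. e \<subseteq> verts G \<and> card e = 2)"

definition subgraph :: "'v graph \<Rightarrow> 'v graph \<Rightarrow> bool" where
  "subgraph H G \<longleftrightarrow> simple_graph H \<and> verts H \<subseteq> verts G \<and> edges H \<subseteq> edges G"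

definition path_edges :: "'v list \<Rightarrow> 'v set set" where
  "path_edges p = {{p ! i, p ! (i + 1)} | i. i + 1 < length p}"

text \<open>A path with vertex list \<open>p\<close> has length \<open>length p - 1\<close>.\<close>

definition path_in :: "'v graph \<Rightarrow> 'v list \<Rightarrow> bool" where
  "path_in G p \<longleftrightarrow> p \<noteq> [] \<and> distinct p \<and> set p \<subseteq> verts G \<and> path_edges p \<subseteq> edges G"

definition disconnected :: "'v graph \<Rightarrow> bool" where
  "disconnected G \<longleftrightarrow> (\<exists>u \<in> verts G. \<exists>v \<in> verts G. \<not> (\<exists>p. path_in G p \<and> hd p = u \<and> last p = v))"

definition connected_graph :: "'v graph \<Rightarrow> bool" where
  "connected_graph G \<longleftrightarrow> verts G \<noteq> {} \<and> \<not> disconnected G"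

definition remove_vertex :: "'v graph \<Rightarrow> 'v \<Rightarrow> 'v graph" where
  "remove_vertex G v = (verts G - {v}, {e \<in> edges G. v \<notin> e})"

definition cut_vertex :: "'v graph \<Rightarrow> 'v \<Rightarrow> bool" where
  "cut_vertex G v \<longleftrightarrow> v \<in> verts G \<and> disconnected (remove_vertex G v)"

definition nonseparable_subgraph :: "'v graph \<Rightarrow> 'v graph \<Rightarrow> bool" where
  "nonseparable_subgraph H G \<longleftrightarrow> subgraph H G \<and> connected_graph H \<and> \<not> (\<exists>v. cut_vertex H v)"

definition block :: "'v graph \<Rightarrow> 'v graph \<Rightarrow> bool" where
  "block G B \<longleftrightarrow> nonseparable_subgraph B G \<and>
     (\<forall>H. nonseparable_subgraph H G \<and> subgraph B H \<longrightarrow> H = B)"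

definition non_edge_blocks :: "'v graph \<Rightarrow> 'v graph set" where
  "non_edge_blocks G = {B. block G B \<and> \<not> (\<exists>u v. u \<noteq> v \<and> B = ({u, v}, {{u, v}}))}"

definition bipartite :: "'v graph \<Rightarrow> bool" where
  "bipartite G \<longleftrightarrow> (\<exists>U W. U \<union> W = verts G \<and> U \<inter> W = {} \<and>
     (\<forall>e \<in> edges G. \<exists>u \<in> U. \<exists>w \<in> W. e = {u, w}))"

definition cycle_of_length :: "'v graph \<Rightarrow> nat \<Rightarrow> bool" where
  "cycle_of_length C r \<longleftrightarrow> r \<ge> 3 \<and> (\<exists>c. distinct c \<and> length c = r \<and>
     verts C = set c \<and> edges C = {{c ! i, c ! ((i + 1) mod r)} | i. i < r})"

definition odd_cycle :: "'v graph \<Rightarrow> bool" where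
  "odd_cycle C \<longleftrightarrow> (\<exists>r. odd r \<and> cycle_of_length C r)"

text \<open>\<open>H\<close> is obtained from the cycle \<open>C\<close> by adding the path with vertex list \<open>p\<close>, whose interior
  vertices are those of \<open>butlast (tl p)\<close>.\<close>

definition add_path_to_cycle :: "'v graph \<Rightarrow> 'v list \<Rightarrow> 'v graph \<Rightarrow> bool" where
  "add_path_to_cycle C p H \<longleftrightarrow>
     distinct p \<and> length p \<ge> 2 \<and> hd p \<in> verts C \<and> last p \<in> verts C \<and>
     set (butlast (tl p)) \<inter> verts C = {} \<and> path_edges p \<inter> edges C = {} \<and>
     H = (verts C \<union> set p, edges C \<union> path_edges p)"

definition distance_between :: "'v graph \<Rightarrow> 'v set \<Rightarrow> 'v set \<Rightarrow> nat" where
  "distance_between G U W =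
     (LEAST d. \<exists>p. path_in G p \<and> hd p \<in> U \<and> last p \<in> W \<and> length p = d + 1)"


section \<open>Edge rings\<close>

definition edge_monomial :: "'v set \<Rightarrow> ('v, 'k::field) mpoly" where
  "edge_monomial e = (\<Prod>v \<in> e. Var v)"

inductive_set edge_ring :: "'v graph \<Rightarrow> ('v, 'k::field) mpoly set" for G :: "'v graph" where
  scalar: "Const c \<in> edge_ring G"
| generator: "e \<in> edges G \<Longrightarrow> edge_monomial e \<in> edge_ring G"
| add: "f \<in> edge_ring G \<Longrightarrow> g \<in> edge_ring G \<Longrightarrow> f + g \<in> edge_ring G"
| mult: "f \<in> edge_ring G \<Longrightarrow> g \<in> edge_ring G \<Longrightarrow> f * g \<in> edge_ring G"

text \<open>The variables of \<open>S = poly_ring (edges G)\<close> are indexed by the edges themselves.\<close>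

definition edge_map :: "('v set, 'k) mpoly \<Rightarrow> ('v, 'k::field) mpoly" where
  "edge_map = eval_mpoly edge_monomial"

definition toric_ideal :: "'v graph \<Rightarrow> ('v set, 'k::field) mpoly set" where
  "toric_ideal G = {f \<in> poly_ring (edges G). edge_map f = 0}"

text \<open>\<open>K[G]\<close> has a \<open>q\<close>-linear resolution, where \<open>K[G]\<close> is identified with \<open>S/I\<^sub>G\<close> along \<open>edge_map\<close>
  (see \<open>edge_map_image\<close>, \<open>edge_map_add\<close> and \<open>edge_map_mult\<close> below).\<close>

definition edge_ring_has_linear_resolution :: "'k::field itself \<Rightarrow> 'v graph \<Rightarrow> nat \<Rightarrow> bool" where
  "edge_ring_has_linear_resolution _ G q \<longleftrightarrow>
     has_linear_resolution (edges G) (toric_ideal G :: ('v set, 'k) mpoly set) q"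

lemma eval_mpoly_superset:
  assumes "finite A" "Poly_Mapping.keys f \<subseteq> A"
  shows "eval_mpoly s f = (\<Sum>t \<in> A.
     Const (Poly_Mapping.lookup f t) * (\<Prod>x \<in> Poly_Mapping.keys t. s x ^ Poly_Mapping.lookup t x))"
  unfolding eval_mpoly_def using assms
  by (intro sum.mono_neutral_left) (auto simp: in_keys_iff Const_def)

lemma eval_mpoly_add: "eval_mpoly s (f + g) = eval_mpoly s f + eval_mpoly s g"
proof -
  let ?A = "Poly_Mapping.keys f \<union> Poly_Mapping.keys g"
  have "Poly_Mapping.keys (f + g) \<subseteq> ?A" by (rule Poly_Mapping.keys_add)
  then show ?thesis
    by (simp add: eval_mpoly_superset[where A = ?A] lookup_add Const_def single_add
        distrib_right sum.distrib)
qed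

lemma eval_mpoly_single:
  "eval_mpoly s (Poly_Mapping.single t c) =
     Const c * (\<Prod>x \<in> Poly_Mapping.keys t. s x ^ Poly_Mapping.lookup t x)"
  by (subst eval_mpoly_superset[where A = "{t}"]) auto

lemma eval_mpoly_sum: "eval_mpoly s (\<Sum>i\<in>A. f i) = (\<Sum>i\<in>A. eval_mpoly s (f i))"
  by (induction A rule: infinite_finite_induct) (simp_all add: eval_mpoly_add, simp_all add: eval_mpoly_def)

lemma sum_singles:
  "f = (\<Sum>t \<in> Poly_Mapping.keys f. Poly_Mapping.single t (Poly_Mapping.lookup f t))"
  by (rule poly_mapping_eqI) (simp add: lookup_sum lookup_single when_def in_keys_iff)

lemma prod_pow_add:
  fixes s :: "'x \<Rightarrow> 'a::comm_semiring_1"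
  shows "(\<Prod>x \<in> Poly_Mapping.keys (t + u). s x ^ Poly_Mapping.lookup (t + u) x) =
     (\<Prod>x \<in> Poly_Mapping.keys t. s x ^ Poly_Mapping.lookup t x) *
     (\<Prod>x \<in> Poly_Mapping.keys u. s x ^ Poly_Mapping.lookup u x)"
proof -
  let ?A = "Poly_Mapping.keys t \<union> Poly_Mapping.keys u"
  have *: "(\<Prod>x \<in> Poly_Mapping.keys v. s x ^ Poly_Mapping.lookup v x) =
      (\<Prod>x \<in> ?A. s x ^ Poly_Mapping.lookup v x)" if "Poly_Mapping.keys v \<subseteq> ?A" for v
    using that by (intro prod.mono_neutral_left) (auto simp: in_keys_iff)
  show ?thesis
    unfolding *[OF Poly_Mapping.keys_add] *[OF Un_upper1] *[OF Un_upper2]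
    by (simp add: lookup_add power_add prod.distrib)
qed

lemma eval_mpoly_mult:
  fixes s :: "'x \<Rightarrow> ('y, 'k::comm_ring_1) mpoly"
  shows "eval_mpoly s (f * g) = eval_mpoly s f * eval_mpoly s g"
proof -
  let ?m = "\<lambda>t. \<Prod>x \<in> Poly_Mapping.keys t. s x ^ Poly_Mapping.lookup t x"
  have "f * g = (\<Sum>t \<in> Poly_Mapping.keys f. \<Sum>u \<in> Poly_Mapping.keys g.
      Poly_Mapping.single (t + u) (Poly_Mapping.lookup f t * Poly_Mapping.lookup g u))"
    by (subst sum_singles[of f], subst sum_singles[of g]) (simp add: sum_product mult_single)
  then have "eval_mpoly s (f * g) = (\<Sum>t \<in> Poly_Mapping.keys f. \<Sum>u \<in> Poly_Mapping.keys g.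
      Const (Poly_Mapping.lookup f t * Poly_Mapping.lookup g u) * ?m (t + u))"
    by (simp add: eval_mpoly_sum eval_mpoly_single)
  also have "\<dots> = (\<Sum>t \<in> Poly_Mapping.keys f. \<Sum>u \<in> Poly_Mapping.keys g.
      (Const (Poly_Mapping.lookup f t) * ?m t) * (Const (Poly_Mapping.lookup g u) * ?m u))"
  proof (intro sum.cong refl)
    fix t u
    have "Const (Poly_Mapping.lookup f t * Poly_Mapping.lookup g u) =
        (Const (Poly_Mapping.lookup f t) * Const (Poly_Mapping.lookup g u) :: ('y, 'k) mpoly)"
      by (simp add: Const_def mult_single)
    then show "Const (Poly_Mapping.lookup f t * Poly_Mapping.lookup g u) * ?m (t + u) =
        (Const (Poly_Mapping.lookup f t) * ?m t) * (Const (Poly_Mapping.lookup g u) * ?m u)"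
      by (simp only: prod_pow_add mult_ac)
  qed
  also have "\<dots> = eval_mpoly s f * eval_mpoly s g"
    by (simp add: eval_mpoly_def sum_product)
  finally show ?thesis .
qed

lemma edge_map_add: "edge_map (f + g) = edge_map f + edge_map g"
  by (simp add: edge_map_def eval_mpoly_add)

lemma edge_map_mult: "edge_map (f * g) = edge_map f * edge_map g"
  by (simp add: edge_map_def eval_mpoly_mult)

lemma edge_map_Const: "edge_map (Const c) = Const c"
  unfolding edge_map_def by (subst Const_def) (simp add: eval_mpoly_single)

lemma edge_map_Var: "edge_map (Var e) = edge_monomial e"
  by (simp add: edge_map_def Var_def eval_mpoly_single) (simp add: Const_def)

lemma edge_map_image: "edge_map ` poly_ring (edges G) = edge_ring G"
proof (intro equalityI subsetI)
  fix g assume "g \<in> edge_map ` poly_ring (edges G)"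
  then obtain f where f: "f \<in> poly_ring (edges G)" "g = edge_map f" by blast
  have one: "1 \<in> edge_ring G"
    using edge_ring.scalar[of 1 G] by (simp add: Const_def)
  have pow: "p ^ n \<in> edge_ring G" if "p \<in> edge_ring G" for p n
    using that by (induction n) (auto intro: one edge_ring.mult)
  have prod: "(\<Prod>x\<in>A. p x) \<in> edge_ring G" if "\<And>x. x \<in> A \<Longrightarrow> p x \<in> edge_ring G" for A p
    using that by (induction A rule: infinite_finite_induct) (auto intro: one edge_ring.mult)
  have zero: "0 \<in> edge_ring G"
    using edge_ring.scalar[of 0 G] by (simp add: Const_def)
  have sum: "(\<Sum>x\<in>A. p x) \<in> edge_ring G" if "\<And>x. x \<in> A \<Longrightarrow> p x \<in> edge_ring G" for A p
    using that by (induction A rule: infinite_finite_induct) (auto intro: zero edge_ring.add)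
  show "g \<in> edge_ring G"
    unfolding f(2) edge_map_def eval_mpoly_def
    using f(1) by (auto simp: poly_ring_def
        intro!: sum prod pow edge_ring.mult edge_ring.scalar edge_ring.generator)
next
  fix g assume "g \<in> edge_ring G"
  then show "g \<in> edge_map ` poly_ring (edges G)"
  proof induction
    case (scalar c)
    show ?case
    proof (rule image_eqI)
      show "Const c = edge_map (Const c)" by (simp add: edge_map_Const)
      show "Const c \<in> poly_ring (edges G)"
        by (auto simp: poly_ring_def Const_def split: if_splits)
    qed
  next
    case (generator e)
    then show ?case
      by (intro image_eqI[where x = "Var e"])
        (simp add: edge_map_Var, simp add: poly_ring_def Var_def)
  next
    case (add f g)
    then obtain a b where "a \<in> poly_ring (edges G)" "b \<in> poly_ring (edges G)"
      "f = edge_map a" "g = edge_map b" by blast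
    moreover from this have "a + b \<in> poly_ring (edges G)"
      using Poly_Mapping.keys_add[of a b] by (auto simp: poly_ring_def)
    ultimately show ?case by (metis edge_map_add image_eqI)
  next
    case (mult f g)
    then obtain a b where ab: "a \<in> poly_ring (edges G)" "b \<in> poly_ring (edges G)"
      "f = edge_map a" "g = edge_map b" by blast
    have "a * b \<in> poly_ring (edges G)"
      unfolding poly_ring_def
    proof (intro CollectI ballI)
      fix t assume "t \<in> Poly_Mapping.keys (a * b)"
      then obtain u v where "t = u + v" "u \<in> Poly_Mapping.keys a" "v \<in> Poly_Mapping.keys b"
        using keys_mult[of a b] by blast
      then show "Poly_Mapping.keys t \<subseteq> edges G"
        using ab(1,2) Poly_Mapping.keys_add[of u v] by (fastforce simp: poly_ring_def)
    qed
    with ab show ?case by (metis edge_map_mult image_eqI)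
  qed
qed

end

theory Submission
  imports Defs
begin

text \<open>Let \<open>L\<close> be the lattice of integer edge weightings whose sum at every vertex is zero. The toric ideal
  is spanned by the differences of monomials that differ by an element of \<open>L\<close>. If the resolution is
  \<open>q\<close>-linear, every nonzero vector of \<open>L\<close> has 1-norm at least \<open>2q\<close>, and the ideal is generated by the
  binomials of vectors of norm exactly \<open>2q\<close>. If \<open>L\<close> had rank at least two, then, as there are no
  4-cycles, some induced subgraph would have rank exactly two; a lattice of rank two has at most three
  pairs of shortest vectors, and this is too few for the first syzygies to be linear when \<open>q > 2\<close>. Hence
  \<open>K[G]\<close> has a \<open>q\<close>-linear resolution iff \<open>L\<close> is generated by one vector of norm \<open>2q\<close>, in which case the
  ideal is principal. Even cycles, and pairs of odd cycles joined by a path, give vectors of \<open>L\<close> with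
  entries \<open>\<plusminus>1\<close>; adding ears inside blocks shows which graphs carry exactly one such vector up to sign.\<close>

text \<open>The bound q \<ge> 3 serves two purposes: a 4-cycle would carry a lattice vector of norm
  4 < 2q, and the 2x2 minors of a matrix of linear forms have degree 2 < q, so those that lie in the
  toric ideal vanish. For q = 2 the claim about the rank is false: complete bipartite graphs with
  parts of sizes 2 and n have 2-linear resolutions although \<open>L\<close> has rank n - 1. In
  higher rank the shortest vectors can be numerous, so syzygies are analysed only in rank two.
  Passing to an induced subgraph is compatible with them: setting the variables of the other edges
  to zero maps the toric ideal into that of the subgraph, fixes the latter, and keeps syzygies
  linear. Hence whole vertices have to be deleted, and one deletion can lower the rank by more than
  one; excluding 4-cycles keeps rank two from being skipped. The characteristic of K is arbitrary.
  Logarithmic derivatives of a syzygy turn the entries of lattice vectors into coefficients in K,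
  where independence survives because the lattice is saturated.\<close>

section \<open>The lattice of an edge set\<close>

definition edge_lattice :: "'v set set \<Rightarrow> ('v set \<Rightarrow> int) set" where
  "edge_lattice E = {z. (\<forall>e. e \<notin> E \<longrightarrow> z e = 0) \<and> (\<forall>v. (\<Sum>e | e \<in> E \<and> v \<in> e. z e) = 0)}"

text \<open>A nonzero 2x2 minor expresses rank at least two without leaving the integers.\<close>

definition independent_pair :: "'v set set \<Rightarrow> bool" where
  "independent_pair E \<longleftrightarrow>
     (\<exists>z \<in> edge_lattice E. \<exists>y \<in> edge_lattice E. \<exists>e e'. z e * y e' \<noteq> z e' * y e)"

text \<open>Integral relations suffice to express the rank, since denominators in a rational
  relation can be cleared.\<close>

definition rank_le_two :: "'v set set \<Rightarrow> bool" where
  "rank_le_two E \<longleftrightarrow> (\<forall>z :: nat \<Rightarrow> 'v set \<Rightarrow> int. (\<forall>i<3. z i \<in> edge_lattice E) \<longrightarrow>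
     (\<exists>c :: nat \<Rightarrow> int. (\<exists>i<3. c i \<noteq> 0) \<and> (\<forall>e. (\<Sum>i<3. c i * z i e) = 0)))"

lemma edge_lattice_zero [simp]: "(\<lambda>e. 0) \<in> edge_lattice E"
  by (simp add: edge_lattice_def)

lemma edge_lattice_outside: "z \<in> edge_lattice E \<Longrightarrow> e \<notin> E \<Longrightarrow> z e = 0"
  by (simp add: edge_lattice_def)

lemma edge_lattice_boundary: "z \<in> edge_lattice E \<Longrightarrow> (\<Sum>e | e \<in> E \<and> v \<in> e. z e) = 0"
  by (simp add: edge_lattice_def)

lemma edge_lattice_add:
  "z \<in> edge_lattice E \<Longrightarrow> y \<in> edge_lattice E \<Longrightarrow> (\<lambda>e. z e + y e) \<in> edge_lattice E"
  by (simp add: edge_lattice_def sum.distrib)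

lemma edge_lattice_scale:
  "z \<in> edge_lattice E \<Longrightarrow> (\<lambda>e. c * z e) \<in> edge_lattice E"
  by (simp add: edge_lattice_def flip: sum_distrib_left)

lemma edge_lattice_uminus:
  "z \<in> edge_lattice E \<Longrightarrow> (\<lambda>e. - z e) \<in> edge_lattice E"
  using edge_lattice_scale[of z E "-1"] by simp

lemma edge_lattice_lincomb:
  "z \<in> edge_lattice E \<Longrightarrow> y \<in> edge_lattice E \<Longrightarrow> (\<lambda>e. a * z e + b * y e) \<in> edge_lattice E"
  by (intro edge_lattice_add edge_lattice_scale)

lemma edge_lattice_sum:
  "(\<And>i. i \<in> A \<Longrightarrow> z i \<in> edge_lattice E) \<Longrightarrow> (\<lambda>e. \<Sum>i\<in>A. c i * z i e) \<in> edge_lattice E"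
  by (induction A rule: infinite_finite_induct) (auto intro!: edge_lattice_add edge_lattice_scale)

text \<open>The defining equations are linear and homogeneous, so a common factor can be cancelled.
  This makes shortest vectors primitive and controls independence modulo a prime.\<close>

lemma edge_lattice_saturated:
  assumes "(\<lambda>e. c * z e) \<in> edge_lattice E" "c \<noteq> 0"
  shows "z \<in> edge_lattice E"
  using assms by (auto simp: edge_lattice_def simp flip: sum_distrib_left)

lemma edge_lattice_mono:
  assumes "finite E'" "E \<subseteq> E'" "z \<in> edge_lattice E"
  shows "z \<in> edge_lattice E'"
proof -
  have "(\<Sum>e | e \<in> E' \<and> v \<in> e. z e) = (\<Sum>e | e \<in> E \<and> v \<in> e. z e)" for v
    using assms by (intro sum.mono_neutral_right) (auto simp: edge_lattice_def)
  then show ?thesis using assms by (auto simp: edge_lattice_def)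
qed

lemma edge_lattice_restrict:
  assumes "finite E'" "E \<subseteq> E'" "z \<in> edge_lattice E'" "\<And>e. e \<in> E' - E \<Longrightarrow> z e = 0"
  shows "z \<in> edge_lattice E"
proof -
  have "(\<Sum>e | e \<in> E' \<and> v \<in> e. z e) = (\<Sum>e | e \<in> E \<and> v \<in> e. z e)" for v
    using assms by (intro sum.mono_neutral_right) (auto)
  then show ?thesis using assms by (auto simp: edge_lattice_def)
qed

lemma edge_other_end:
  assumes "card e = 2" "v \<in> e"
  obtains u where "u \<noteq> v" "e = {v, u}"
proof -
  obtain a b where "e = {a, b}" "a \<noteq> b" using assms(1) by (auto simp: card_2_iff)
  then show ?thesis using that[of a] that[of b] assms(2) by (auto simp: insert_commute)
qed

text \<open>Each edge is counted at its two ends. Lattice vectors and the constant weight 1 (the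
  handshake formula) are the two uses.\<close>

lemma sum_incident_edges:
  fixes z :: "'v set \<Rightarrow> 'a::comm_semiring_1"
  assumes "finite E" "\<forall>e\<in>E. card e = 2" "finite V" "\<Union>E \<subseteq> V"
  shows "(\<Sum>v\<in>V. \<Sum>e | e \<in> E \<and> v \<in> e. z e) = 2 * (\<Sum>e\<in>E. z e)"
proof -
  have "(\<Sum>v\<in>V. \<Sum>e | e \<in> E \<and> v \<in> e. z e) = (\<Sum>e\<in>E. \<Sum>v | v \<in> V \<and> v \<in> e. z e)"
    by (rule sum.swap_restrict) (use assms in auto)
  also have "\<dots> = (\<Sum>e\<in>E. 2 * z e)"
  proof (intro sum.cong refl)
    fix e assume e: "e \<in> E"
    then have "{v. v \<in> V \<and> v \<in> e} = e" using assms by auto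
    then show "(\<Sum>v | v \<in> V \<and> v \<in> e. z e) = 2 * z e" using e assms by simp
  qed
  finally show ?thesis by (simp add: sum_distrib_left)
qed

text \<open>Summing the boundary conditions over all vertices counts every edge twice. This is what
  makes the binomials of lattice vectors homogeneous.\<close>

lemma edge_lattice_sum_eq_0:
  assumes "finite E" "\<forall>e\<in>E. card e = 2" "z \<in> edge_lattice E"
  shows "(\<Sum>e\<in>E. z e) = 0"
proof -
  have "finite (\<Union>E)" using assms by (intro finite_Union) (auto intro: card_ge_0_finite)
  then have "2 * (\<Sum>e\<in>E. z e) = (\<Sum>v\<in>\<Union>E. \<Sum>e | e \<in> E \<and> v \<in> e. z e)"
    using assms by (subst sum_incident_edges) auto
  also have "\<dots> = 0" using assms(3) by (simp add: edge_lattice_def)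
  finally show ?thesis by simp
qed

section \<open>Rank estimates by counting equations and unknowns\<close>

lemma underdetermined_system:
  fixes A :: "'i \<Rightarrow> 'e \<Rightarrow> 'a::idom"
  assumes "finite V" "finite E" "card V < card E"
  shows "\<exists>z. (\<exists>e\<in>E. z e \<noteq> 0) \<and> (\<forall>i\<in>V. (\<Sum>e\<in>E. A i e * z e) = 0)"
  using assms
proof (induction V arbitrary: E A rule: finite_induct)
  case empty
  then have "E \<noteq> {}" by auto
  then show ?case by (intro exI[of _ "\<lambda>_. 1"]) auto
next
  case (insert i V)
  show ?case
  proof (cases "\<exists>e0\<in>E. A i e0 \<noteq> 0")
    case False
    obtain z where z: "\<exists>e\<in>E. z e \<noteq> 0" "\<forall>j\<in>V. (\<Sum>e\<in>E. A j e * z e) = 0"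
      using insert.IH[of E A] insert.prems insert.hyps by auto
    then show ?thesis using False by (intro exI[of _ z]) auto
  next
    case True
    then obtain e0 where e0: "e0 \<in> E" "A i e0 \<noteq> 0" by blast
    let ?E = "E - {e0}"
    define A' where "A' j e = A i e0 * A j e - A j e0 * A i e" for j e
    have "card V < card ?E" using insert.prems insert.hyps e0 by simp
    then obtain z where z: "\<exists>e\<in>?E. z e \<noteq> 0" "\<forall>j\<in>V. (\<Sum>e\<in>?E. A' j e * z e) = 0"
      using insert.IH[of ?E A'] insert.prems by auto
    \<comment> \<open>Scaling the other unknowns by the pivot allows equation \<open>i\<close> to be
      solved for \<open>e0\<close> without a quotient.\<close>
    define y where "y e = (if e = e0 then - (\<Sum>e\<in>?E. A i e * z e) else A i e0 * z e)" for e
    have y: "(\<Sum>e\<in>E. A j e * y e) = (\<Sum>e\<in>?E. A' j e * z e)" for j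
    proof -
      have "(\<Sum>e\<in>E. A j e * y e) = A j e0 * y e0 + (\<Sum>e\<in>?E. A j e * y e)"
        using e0 insert.prems by (simp add: sum.remove)
      also have "(\<Sum>e\<in>?E. A j e * y e) = (\<Sum>e\<in>?E. A i e0 * A j e * z e)"
        by (intro sum.cong) (auto simp: y_def)
      also have "A j e0 * y e0 + \<dots> = (\<Sum>e\<in>?E. A' j e * z e)"
        by (simp add: y_def A'_def left_diff_distrib sum_subtractf sum_distrib_left mult.assoc)
      finally show ?thesis .
    qed
    have "(\<Sum>e\<in>E. A i e * y e) = 0" unfolding y by (simp add: A'_def mult.commute)
    moreover have "\<exists>e\<in>E. y e \<noteq> 0" using z(1) e0 by (auto simp: y_def)
    ultimately show ?thesis using z(2) y by (intro exI[of _ y]) auto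
  qed
qed

lemma edge_lattice_nontrivial:
  assumes "finite E" "finite V" "\<Union>E \<subseteq> V" "card V < card E"
  shows "\<exists>z\<in>edge_lattice E. \<exists>e\<in>E. z e \<noteq> 0"
proof -
  obtain z where z: "\<exists>e\<in>E. z e \<noteq> (0::int)" "\<forall>v\<in>V. (\<Sum>e\<in>E. of_bool (v \<in> e) * z e) = 0"
    using underdetermined_system[OF assms(2,1,4), of "\<lambda>v e. of_bool (v \<in> e)"] by blast
  define y where "y e = (if e \<in> E then z e else 0)" for e
  have "(\<Sum>e | e \<in> E \<and> v \<in> e. y e) = 0" for v
  proof (cases "v \<in> V")
    case True
    have "(\<Sum>e | e \<in> E \<and> v \<in> e. y e) = (\<Sum>e\<in>E. of_bool (v \<in> e) * z e)"
      using assms(1) by (intro sum.mono_neutral_cong_left) (auto simp: y_def)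
    then show ?thesis using z True by simp
  next
    case False
    then have "{e. e \<in> E \<and> v \<in> e} = {}" using assms(3) by auto
    then show ?thesis by (simp only: sum.empty)
  qed
  then have "y \<in> edge_lattice E" by (auto simp: edge_lattice_def y_def)
  then show ?thesis using z(1) by (intro bexI[of _ y]) (auto simp: y_def)
qed

text \<open>After deleting an edge \<open>e\<close> where a first vector is nonzero there are still
  more edges than vertices. A second vector on the remaining edges vanishes at \<open>e\<close>,
  which makes a minor through \<open>e\<close> nonzero.\<close>

lemma independent_pair_if_many_edges:
  assumes "finite E" "finite V" "\<Union>E \<subseteq> V" "card V + 2 \<le> card E"
  shows "independent_pair E"
proof -
  obtain z e where z: "z \<in> edge_lattice E" "e \<in> E" "z e \<noteq> 0"
    using edge_lattice_nontrivial[OF assms(1-3)] assms(4) by auto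
  have "\<exists>y\<in>edge_lattice (E - {e}). \<exists>e'\<in>E - {e}. y e' \<noteq> 0"
    using assms z(2) by (intro edge_lattice_nontrivial[of _ V]) auto
  then obtain y e' where y: "y \<in> edge_lattice (E - {e})" "y e' \<noteq> 0" by blast
  then have "y \<in> edge_lattice E" using edge_lattice_mono[of E "E - {e}"] assms(1) by auto
  moreover have "y e = 0" using y(1) by (simp add: edge_lattice_def)
  ultimately show ?thesis
    unfolding independent_pair_def using z y
    by (intro bexI[of _ z] bexI[of _ y] exI[of _ e] exI[of _ e']) auto
qed

text \<open>Vanishing at \<open>d\<close> is one linear condition on the combinations of three
  independent vectors, so a space of dimension at least two is left.\<close>

lemma not_rank_le_two_vanishing_pair:
  assumes "\<not> rank_le_two E"
  shows "\<exists>z\<in>edge_lattice E. \<exists>y\<in>edge_lattice E. (\<exists>e e'. z e * y e' \<noteq> z e' * y e) \<and> z d = 0 \<and> y d = 0"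
proof -
  obtain z :: "nat \<Rightarrow> 'a set \<Rightarrow> int" where z: "\<And>i. i < 3 \<Longrightarrow> z i \<in> edge_lattice E"
    and indep: "\<And>c i e. i < 3 \<Longrightarrow> (\<And>e. (\<Sum>i<3. c i * z i e) = 0) \<Longrightarrow> c i = 0"
    using assms unfolding rank_le_two_def by blast
  define comb where "comb c e = (\<Sum>i<3. c i * z i e)" for c e
  have comb: "comb c \<in> edge_lattice E" for c
    unfolding comb_def using z by (intro edge_lattice_sum) auto
  obtain c where c: "\<exists>i\<in>{..<3::nat}. c i \<noteq> 0" "(\<Sum>i<3. z i d * c i) = 0"
    using underdetermined_system[of "{0::nat}" "{..<3::nat}" "\<lambda>_ i. z i d"] by auto
  then obtain j where j: "j < 3" "c j \<noteq> 0" by auto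
  \<comment> \<open>The second condition makes coefficient \<open>j\<close> of \<open>c'\<close>
    zero while that of \<open>c\<close> is not, so \<open>c\<close> and \<open>c'\<close> are not
    proportional.\<close>
  obtain c' where c': "\<exists>i\<in>{..<3::nat}. c' i \<noteq> 0" "(\<Sum>i<3. z i d * c' i) = 0"
      "(\<Sum>i<3. of_bool (i = j) * c' i) = 0"
    using underdetermined_system[of "{0::nat,1}" "{..<3::nat}"
        "\<lambda>k i. if k = 0 then z i d else of_bool (i = j)"] by auto
  then obtain j' where j': "j' < 3" "c' j' \<noteq> 0" by auto
  have "(\<Sum>i<3. of_bool (i = j) * c' i) = (\<Sum>i<3. if i = j then c' i else 0)"
    by (intro sum.cong) auto
  then have c'j: "c' j = 0" using c'(3) j(1) by simp
  have "\<exists>e e'. comb c e * comb c' e' \<noteq> comb c e' * comb c' e"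
  proof (rule ccontr)
    assume "\<not> ?thesis"
    then have prp: "comb c e * comb c' e' = comb c e' * comb c' e" for e e' by blast
    obtain e where e: "comb c e \<noteq> 0" using indep[OF j(1)] j(2) unfolding comb_def by blast
    \<comment> \<open>Proportionality of the two combinations is a relation among the three given
      vectors. Its coefficient at \<open>j\<close> shows \<open>comb c' e = 0\<close>, and then its
      coefficient at \<open>j'\<close> is the nonzero product
      \<open>comb c e * c' j'\<close>.\<close>
    have "(\<Sum>i<3. (comb c e * c' i - comb c' e * c i) * z i e') = 0" for e'
    proof -
      have "(\<Sum>i<3. (comb c e * c' i - comb c' e * c i) * z i e')
          = comb c e * comb c' e' - comb c' e * comb c e'"
        by (simp add: comb_def[of _ e'] left_diff_distrib sum_subtractf sum_distrib_left mult.assoc)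
      then show ?thesis using prp[of e e'] by (simp add: mult.commute)
    qed
    from indep[OF j(1) this] have "comb c' e = 0" using j(2) c'j by simp
    with indep[OF j'(1) \<open>\<And>e'. (\<Sum>i<3. (comb c e * c' i - comb c' e * c i) * z i e') = 0\<close>]
    show False using e j'(2) by simp
  qed
  moreover have "comb c d = 0" "comb c' d = 0"
    using c(2) c'(2) by (simp_all add: comb_def mult.commute)
  ultimately show ?thesis using comb by blast
qed

section \<open>Induced subgraphs of rank two\<close>

definition edges_within :: "'v set set \<Rightarrow> 'v set \<Rightarrow> 'v set set" where
  "edges_within E W = {e \<in> E. e \<subseteq> W}"

text \<open>At a vertex of degree at most two the boundary condition makes a vector vanish on all
  incident edges as soon as it vanishes on a suitable one. Deleting the vertex therefore costs a
  single linear condition.\<close>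

lemma vertex_deletion_independent:
  assumes E: "finite E" "\<forall>e\<in>E. card e = 2"
    and rk: "\<not> rank_le_two (edges_within E W)"
    and deg: "card {e \<in> edges_within E W. v \<in> e} \<le> 2"
  shows "independent_pair (edges_within E (W - {v}))"
proof -
  let ?F = "edges_within E W"
  define N where "N = {e \<in> edges_within E W. v \<in> e}"
  have fin: "finite ?F" using E(1) by (simp add: edges_within_def)
  have bd: "(\<Sum>e\<in>N. z e) = 0" if "z \<in> edge_lattice ?F" for z :: "'a set \<Rightarrow> int"
    using edge_lattice_boundary[OF that, of v] by (simp add: N_def)
  have "finite N" "card N \<le> 2" using fin deg by (simp_all add: N_def)
  then have "card N = 0 \<or> card N = Suc 0 \<or> card N = 2" by linarith
  then have "N = {} \<or> (\<exists>d. N = {d}) \<or> (\<exists>d d'. N = {d, d'} \<and> d \<noteq> d')"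
    using \<open>finite N\<close> by (auto simp: card_1_singleton_iff card_2_iff)
  then have "\<exists>d. \<forall>z\<in>edge_lattice ?F. z d = 0 \<longrightarrow> (\<forall>e\<in>N. z e = 0)"
  proof (elim disjE exE conjE)
    fix d d' assume dd: "N = {d, d'}" "d \<noteq> d'"
    have "z d' = 0" if "z \<in> edge_lattice ?F" "z d = 0" for z
      using bd[OF that(1)] that(2) dd by simp
    then show ?thesis using dd(1) by (intro exI[of _ d]) simp
  qed auto
  then obtain d where d: "\<And>z e. z \<in> edge_lattice ?F \<Longrightarrow> z d = 0 \<Longrightarrow> e \<in> N \<Longrightarrow> z e = 0"
    by blast
  obtain z y where zy: "z \<in> edge_lattice ?F" "y \<in> edge_lattice ?F"
    "\<exists>e e'. z e * y e' \<noteq> z e' * y e" "z d = 0" "y d = 0"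
    using not_rank_le_two_vanishing_pair[OF rk, of d] by blast
  have "x \<in> edge_lattice (edges_within E (W - {v}))" if "x \<in> edge_lattice ?F" "x d = 0" for x
    by (rule edge_lattice_restrict[OF fin _ that(1)])
      (use d[OF that] in \<open>auto simp: edges_within_def N_def\<close>)
  then show ?thesis unfolding independent_pair_def using zy by blast
qed

text \<open>A smallest vertex set that spans an independent pair works. Otherwise all its degrees are at
  least 3, and removing a vertex \<open>v\<close> leaves a graph with at most one more edge than vertices, so at most
  two vertices off the neighbourhood of \<open>v\<close>. Every other vertex has at most one neighbour in common
  with \<open>v\<close>, which leaves no room for its remaining edges.\<close>

lemma induced_rank_two:
  assumes E: "finite E" "\<forall>e\<in>E. card e = 2"
    and no_C4: "\<And>a b c d. distinct [a, b, c, d] \<Longrightarrow>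
      {{a, b}, {b, c}, {c, d}, {d, a}} \<subseteq> E \<Longrightarrow> False"
    and ind: "independent_pair E"
  shows "\<exists>W. independent_pair (edges_within E W) \<and> rank_le_two (edges_within E W)"
proof -
  have "edges_within E (\<Union>E) = E" by (auto simp: edges_within_def)
  moreover have "finite (\<Union>E)" using E by (intro finite_Union) (auto intro: card_ge_0_finite)
  ultimately have "\<exists>W. finite W \<and> independent_pair (edges_within E W)" using ind by auto
  then obtain W where W: "finite W" "independent_pair (edges_within E W)"
    and min: "\<And>W'. finite W' \<Longrightarrow> independent_pair (edges_within E W') \<Longrightarrow> card W \<le> card W'"
    using ex_has_least_nat[of "\<lambda>W. finite W \<and> independent_pair (edges_within E W)" _ card] by metis
  have "rank_le_two (edges_within E W)"
  proof (rule ccontr)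
    assume rk: "\<not> rank_le_two (edges_within E W)"
    let ?F = "edges_within E W"
    have smaller: "\<not> independent_pair (edges_within E (W - {v}))" if "v \<in> W" for v
      using min[of "W - {v}"] W(1) that card_Diff1_less[of W v] by auto
    \<comment> \<open>A vertex of degree at most two could be deleted, against the minimality of
      \<open>W\<close>.\<close>
    have deg: "card {e \<in> ?F. v \<in> e} \<ge> 3" if "v \<in> W" for v
      using vertex_deletion_independent[OF E rk, of v] smaller[OF that] by force
    obtain v where v: "v \<in> W"
    proof -
      obtain z e where "z \<in> edge_lattice ?F" "z e \<noteq> 0"
        using W(2) unfolding independent_pair_def by fastforce
      then have e: "e \<in> ?F" by (auto simp: edge_lattice_def)
      then have "e \<noteq> {}" using E by (auto simp: edges_within_def)
      then show ?thesis using that e by (auto simp: edges_within_def)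
    qed
    define W' where "W' = W - {v}"
    define F where "F = edges_within E W'"
    define N where "N = {w \<in> W'. {v, w} \<in> E}"
    define X where "X = W' - N"
    have F: "finite F" "\<forall>e\<in>F. card e = 2" "\<Union>F \<subseteq> W'" "finite W'"
      using E W(1) by (auto simp: F_def edges_within_def W'_def)
    define d where "d w = card {e \<in> F. w \<in> e}" for w
    have mono: "{e \<in> ?F. w \<in> e} \<subseteq> insert {v, w} {e \<in> F. w \<in> e}" if "w \<in> W'" for w
    proof
      fix e assume e: "e \<in> {e \<in> ?F. w \<in> e}"
      show "e \<in> insert {v, w} {e \<in> F. w \<in> e}"
      proof (cases "v \<in> e")
        case True
        have "card e = 2" using e E by (auto simp: edges_within_def)
        then obtain u where "e = {v, u}" using True edge_other_end by metis
        then have "e = {v, w}" using e that by (auto simp: W'_def)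
        then show ?thesis by simp
      next
        case False
        then show ?thesis using e by (auto simp: F_def W'_def edges_within_def)
      qed
    qed
    have d2: "d w \<ge> 2" if "w \<in> W'" for w
    proof -
      have "3 \<le> card {e \<in> ?F. w \<in> e}" using deg that by (auto simp: W'_def)
      also have "\<dots> \<le> card (insert {v, w} {e \<in> F. w \<in> e})"
        using F(1) by (intro card_mono mono[OF that]) auto
      also have "\<dots> \<le> Suc (d w)" unfolding d_def using F(1) by (simp add: card_insert_if)
      finally show ?thesis by simp
    qed
    have d3: "d w \<ge> 3" if "w \<in> X" for w
    proof -
      have w: "w \<in> W'" "{v, w} \<notin> E" using that by (auto simp: X_def N_def)
      have "{e \<in> ?F. w \<in> e} \<subseteq> {e \<in> F. w \<in> e}"
        using mono[OF w(1)] w(2) by (auto simp: edges_within_def)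
      then have "card {e \<in> ?F. w \<in> e} \<le> d w" unfolding d_def using F(1) by (intro card_mono) auto
      then show ?thesis using deg[of w] w(1) by (auto simp: W'_def)
    qed
    have cardF: "card F \<le> card W' + 1"
    proof (rule ccontr)
      assume "\<not> ?thesis"
      then have "independent_pair F"
        using F by (intro independent_pair_if_many_edges[of _ W']) auto
      then show False using smaller[OF v] by (simp add: F_def W'_def)
    qed
    have handshake: "(\<Sum>w\<in>W'. d w) = 2 * card F"
      using sum_incident_edges[OF F(1,2,4,3), of "\<lambda>_. 1::nat"] by (simp add: d_def)
    \<comment> \<open>The degree sum is at least \<open>2 * card W' + card X\<close>; by the
      handshake formula and \<open>cardF\<close> it is at most
      \<open>2 * card W' + 2\<close>.\<close>
    have "card X \<le> 2"
    proof -
      have "X \<subseteq> W'" by (auto simp: X_def)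
      have "of_bool (w \<in> X) + 2 \<le> d w" if "w \<in> W'" for w
        using d2[OF that] d3[of w] by (cases "w \<in> X") auto
      then have "(\<Sum>w\<in>W'. of_bool (w \<in> X) + 2) \<le> (\<Sum>w\<in>W'. d w)"
        by (rule sum_mono)
      moreover have "(\<Sum>w\<in>W'. of_bool (w \<in> X) + 2) = card X + 2 * card W'"
      proof -
        have "(\<Sum>w\<in>W'. of_bool (w \<in> X) :: nat) = card (W' \<inter> X)"
          using F(4) by (simp add: sum_of_bool_eq)
        then show ?thesis using \<open>X \<subseteq> W'\<close> by (simp only: sum.distrib) (simp add: Int_absorb1)
      qed
      ultimately show ?thesis using handshake cardF by linarith
    qed
    have nbrs: "d w \<le> 1 + card (X - {w})" if w: "w \<in> W'" for w
    proof -
      define M where "M = {u \<in> W'. {w, u} \<in> F \<and> u \<noteq> w}"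
      have M: "finite M" using F by (auto simp: M_def)
      have "{e \<in> F. w \<in> e} \<subseteq> (\<lambda>u. {w, u}) ` M"
      proof
        fix e assume e: "e \<in> {e \<in> F. w \<in> e}"
        then obtain u where "e = {w, u}" "u \<noteq> w" using F(2) edge_other_end[of e w] by blast
        then show "e \<in> (\<lambda>u. {w, u}) ` M" using e F(3) by (auto simp: M_def)
      qed
      then have "d w \<le> card M" unfolding d_def using M by (meson surj_card_le)
      moreover have "card (M \<inter> N) \<le> 1"
      proof (rule ccontr)
        assume "\<not> ?thesis"
        then have "\<exists>a b. a \<in> M \<inter> N \<and> b \<in> M \<inter> N \<and> a \<noteq> b"
          using M card_le_Suc0_iff_eq[of "M \<inter> N"] by auto
        then obtain a b where ab: "a \<in> M" "b \<in> M" "a \<in> N" "b \<in> N" "a \<noteq> b" by blast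
        show False
        proof (rule no_C4[of v a w b])
          show "distinct [v, a, w, b]" using ab w by (auto simp: M_def W'_def)
          show "{{v, a}, {a, w}, {w, b}, {b, v}} \<subseteq> E"
            using ab by (auto simp: M_def N_def F_def edges_within_def insert_commute)
        qed
      qed
      moreover have "card M \<le> card (M \<inter> N) + card (X - {w})"
      proof -
        have "M \<subseteq> (M \<inter> N) \<union> (X - {w})" by (auto simp: M_def X_def)
        then have "card M \<le> card ((M \<inter> N) \<union> (X - {w}))"
          using M F by (intro card_mono) (auto simp: X_def)
        also have "\<dots> \<le> card (M \<inter> N) + card (X - {w})" by (rule card_Un_le)
        finally show ?thesis .
      qed
      ultimately show ?thesis by linarith
    qed
    \<comment> \<open>A vertex of \<open>X\<close> has at least three neighbours in
      \<open>W'\<close>, but at most one in \<open>N\<close> and at most one other vertex in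
      \<open>X\<close>.\<close>
    have "X = {}"
    proof (rule ccontr)
      assume "X \<noteq> {}"
      then obtain w where w: "w \<in> X" by blast
      then have "card (X - {w}) \<le> 1" using \<open>card X \<le> 2\<close> F by (simp add: X_def card_Diff_singleton)
      then show False using nbrs[of w] d3[OF w] w by (auto simp: X_def)
    qed
    moreover obtain w where "w \<in> W'"
    proof -
      have "{e \<in> ?F. v \<in> e} \<noteq> {}" using deg[OF v] by (metis card.empty not_numeral_le_zero)
      then obtain e where "e \<in> ?F" "v \<in> e" by blast
      moreover from this have "card e = 2" using E by (auto simp: edges_within_def)
      ultimately obtain w where "w \<in> e" "w \<noteq> v" using edge_other_end by (metis insertCI)
      then show ?thesis using that \<open>e \<in> ?F\<close> by (auto simp: W'_def edges_within_def)
    qed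
    \<comment> \<open>With \<open>X\<close> empty, \<open>w\<close> has at most one edge in
      \<open>F\<close>, yet at least two.\<close>
    ultimately show False using nbrs[of w] d2[of w] by simp
  qed
  then show ?thesis using W by blast
qed

subsection \<open>Shortest vectors\<close>

definition norm1 :: "'v set set \<Rightarrow> ('v set \<Rightarrow> int) \<Rightarrow> int" where
  "norm1 E z = (\<Sum>e\<in>E. \<bar>z e\<bar>)"

text \<open>The value \<open>m\<close> is a lower bound that need not be attained; it holds
  vacuously for the zero lattice.\<close>

definition min_norm :: "'v set set \<Rightarrow> int \<Rightarrow> bool" where
  "min_norm E m \<longleftrightarrow> m > 0 \<and> (\<forall>z \<in> edge_lattice E. (\<exists>e. z e \<noteq> 0) \<longrightarrow> m \<le> norm1 E z)"

lemma min_normD: "min_norm E m \<Longrightarrow> z \<in> edge_lattice E \<Longrightarrow> z e \<noteq> 0 \<Longrightarrow> m \<le> norm1 E z"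
  by (auto simp: min_norm_def)

lemma min_norm_pos: "min_norm E m \<Longrightarrow> m > 0"
  by (auto simp: min_norm_def)

lemma norm1_scale: "norm1 E (\<lambda>e. c * z e) = \<bar>c\<bar> * norm1 E z"
  by (simp add: norm1_def abs_mult sum_distrib_left)

lemma norm1_uminus: "norm1 E (\<lambda>e. - z e) = norm1 E z"
  by (simp add: norm1_def)

lemma norm1_lincomb_le:
  "norm1 E (\<lambda>e. b * z e + c * y e) \<le> \<bar>b\<bar> * norm1 E z + \<bar>c\<bar> * norm1 E y"
proof -
  have "norm1 E (\<lambda>e. b * z e + c * y e) \<le> (\<Sum>e\<in>E. \<bar>b\<bar> * \<bar>z e\<bar> + \<bar>c\<bar> * \<bar>y e\<bar>)"
    unfolding norm1_def by (intro sum_mono) (metis abs_mult abs_triangle_ineq)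
  then show ?thesis by (simp add: norm1_def sum.distrib sum_distrib_left)
qed

text \<open>The lattice is saturated, so a shortest vector is not twice another one.\<close>

lemma shortest_not_double:
  assumes m: "min_norm E m" and z: "z \<in> edge_lattice E" "norm1 E z \<le> m" "z d \<noteq> 0"
    and w: "\<And>e. z e = 2 * w e"
  shows False
proof -
  have "(\<lambda>e. 2 * w e) \<in> edge_lattice E" using z(1) by (simp add: w[symmetric])
  then have "w \<in> edge_lattice E" using edge_lattice_saturated[of 2 w] by simp
  then have "m \<le> norm1 E w" using min_normD[OF m, of w d] z(3) w by auto
  moreover have "norm1 E z = 2 * norm1 E w"
    using norm1_scale[of E 2 w] by (simp add: w[symmetric])
  ultimately show False using z(2) min_norm_pos[OF m] by linarith
qed

lemma nearest_integer:
  fixes a b :: int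
  assumes "a > 0"
  shows "\<exists>k. 2 * \<bar>b - k * a\<bar> \<le> a"
proof -
  \<comment> \<open>This is the floor of b/a + 1/2, that is, b/a rounded to a nearest
    integer.\<close>
  define k where "k = (2 * b + a) div (2 * a)"
  have "2 * b + a = 2 * a * k + (2 * b + a) mod (2 * a)" by (simp add: k_def)
  moreover have "0 \<le> (2 * b + a) mod (2 * a)" "(2 * b + a) mod (2 * a) < 2 * a"
    using assms by simp_all
  ultimately have "- a \<le> 2 * b - 2 * (a * k)" "2 * b - 2 * (a * k) \<le> a"
    by (simp_all add: mult.assoc)
  then show ?thesis by (intro exI[of _ k]) (simp add: mult.commute abs_if)
qed

definition nonproportional :: "('e \<Rightarrow> int) \<Rightarrow> ('e \<Rightarrow> int) \<Rightarrow> bool" where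
  "nonproportional z y \<longleftrightarrow> (\<exists>e e'. z e * y e' \<noteq> z e' * y e)"

lemma nonproportional_sym: "nonproportional z y \<Longrightarrow> nonproportional y z"
  unfolding nonproportional_def by (metis mult.commute)

lemma nonproportionalD:
  assumes "nonproportional z y" "\<And>e. b * z e + c * y e = 0"
  shows "b = 0" "c = 0"
proof -
  obtain e e' where ne: "z e * y e' - z e' * y e \<noteq> 0"
    using assms(1) by (auto simp: nonproportional_def)
  have "b * (z e * y e' - z e' * y e)
      = (b * z e + c * y e) * y e' - (b * z e' + c * y e') * y e" by (simp add: algebra_simps)
  then show "b = 0" using assms(2) ne by simp
  have "c * (z e * y e' - z e' * y e)
      = (b * z e' + c * y e') * z e - (b * z e + c * y e) * z e'" by (simp add: algebra_simps)
  then show "c = 0" using assms(2) ne by simp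
qed

text \<open>If all minors vanish, then \<open>y e'\<close> and \<open>- z e'\<close> are the
  coefficients of a relation for each \<open>e'\<close>. The assumption makes them zero, and then
  every pair of coefficients is a relation.\<close>

lemma nonproportional_if:
  assumes "\<And>b c. (\<And>e. b * z e + c * y e = 0) \<Longrightarrow> b = 0 \<and> c = 0"
  shows "nonproportional z y"
proof (rule ccontr)
  assume "\<not> ?thesis"
  then have eq: "z e * y e' = z e' * y e" for e e' by (auto simp: nonproportional_def)
  have "y e' = 0 \<and> z e' = 0" for e'
    using assms[of "y e'" "- z e'"] eq[of _ e'] by (simp add: mult.commute)
  then show False using assms[of 1 1] by simp
qed

text \<open>Reduce modulo \<open>\<int>z1 + \<int>z2\<close> to coordinates of absolute value at most one half. The remainder is
  then zero, unless it is half of a shortest sum \<open>\<plusminus>z1 \<plusminus> z2\<close>; in that case the difference is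
  as long as the sum, the supports are disjoint, and \<open>z1\<close> is divisible by two.\<close>

lemma shortest_pair_spans:
  assumes E: "finite E" and rk: "rank_le_two E" and m: "min_norm E m"
    and z1: "z1 \<in> edge_lattice E" "norm1 E z1 = m"
    and z2: "z2 \<in> edge_lattice E" "norm1 E z2 = m"
    and np: "nonproportional z1 z2" and z: "z \<in> edge_lattice E"
  shows "\<exists>a b. \<forall>e. z e = a * z1 e + b * z2 e"
proof -
  note m0 = min_norm_pos[OF m]
  define zs where "zs i = (if i = 0 then z else if i = 1 then z1 else z2)" for i :: nat
  have "\<forall>i<3. zs i \<in> edge_lattice E" using z z1 z2 by (simp add: zs_def)
  then obtain c where c: "\<exists>i<3. c i \<noteq> 0" "\<And>e. (\<Sum>i<3. c i * zs i e) = 0"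
    using rk unfolding rank_le_two_def by metis
  have c: "c 0 \<noteq> 0 \<or> c 1 \<noteq> 0 \<or> c 2 \<noteq> 0" "\<And>e. c 0 * z e + c 1 * z1 e + c 2 * z2 e = 0"
    using c by (auto simp: zs_def eval_nat_numeral less_Suc_eq)
  have c0: "c 0 \<noteq> 0"
  proof
    assume "c 0 = 0"
    then have "c 1 = 0" "c 2 = 0" using nonproportionalD[OF np, of "c 1" "c 2"] c(2) by simp_all
    then show False using c(1) \<open>c 0 = 0\<close> by simp
  qed
  \<comment> \<open>Changing signs if necessary makes the coefficient of \<open>z\<close> positive,
    as rounding modulo \<open>a\<close> requires.\<close>
  obtain a b' c' :: int where abc: "a > 0" "\<And>e. a * z e = b' * z1 e + c' * z2 e"
  proof (cases "c 0 > 0")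
    case True
    have "c 0 * z e = (- c 1) * z1 e + (- c 2) * z2 e" for e using c(2)[of e] by simp
    then show ?thesis using that True by blast
  next
    case False
    have "(- c 0) * z e = c 1 * z1 e + c 2 * z2 e" for e using c(2)[of e] by simp
    then show ?thesis using that[of "- c 0"] False c0 by auto
  qed
  obtain k where k: "2 * \<bar>b' - k * a\<bar> \<le> a" using nearest_integer[OF abc(1)] by blast
  obtain l where l: "2 * \<bar>c' - l * a\<bar> \<le> a" using nearest_integer[OF abc(1)] by blast
  define \<beta> \<gamma> where "\<beta> = b' - k * a" and "\<gamma> = c' - l * a"
  define y where "y e = z e - k * z1 e - l * z2 e" for e
  have ay: "a * y e = \<beta> * z1 e + \<gamma> * z2 e" for e
    using abc(2)[of e] by (simp add: y_def \<beta>_def \<gamma>_def algebra_simps)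
  have yL: "y \<in> edge_lattice E"
    using edge_lattice_add[OF z edge_lattice_lincomb[OF z1(1) z2(1), of "- k" "- l"]]
    by (simp add: y_def[abs_def] algebra_simps)
  have y0: "y e = 0" for e
  proof (rule ccontr)
    assume ye: "y e \<noteq> 0"
    \<comment> \<open>The chain gives a \<le> \<bar>\<beta>\<bar> + \<bar>\<gamma>\<bar>, while
      rounding made each summand at most a/2. So both equal a/2 and \<open>y\<close> is half of a
      signed sum of \<open>z1\<close> and \<open>z2\<close>.\<close>
    have "a * m \<le> a * norm1 E y" using min_normD[OF m yL ye] abc(1) by simp
    also have a_norm: "a * norm1 E y = norm1 E (\<lambda>e. \<beta> * z1 e + \<gamma> * z2 e)"
      using norm1_scale[of E a y] abc(1) by (simp add: ay)
    also have le: "\<dots> \<le> (\<bar>\<beta>\<bar> + \<bar>\<gamma>\<bar>) * m"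
      using norm1_lincomb_le[of E \<beta> z1 \<gamma> z2] z1 z2 by (simp add: distrib_right)
    finally have "a \<le> \<bar>\<beta>\<bar> + \<bar>\<gamma>\<bar>" using m0 by simp
    with k l have half: "2 * \<bar>\<beta>\<bar> = a" "2 * \<bar>\<gamma>\<bar> = a" by (simp_all add: \<beta>_def \<gamma>_def)
    have "a * norm1 E y \<le> a * m"
    proof -
      have "\<bar>\<beta>\<bar> + \<bar>\<gamma>\<bar> = a" using half by simp
      then show ?thesis using a_norm le by simp
    qed
    then have y_norm: "norm1 E y \<le> m" using abc(1) by simp
    define \<sigma> \<tau> where "\<sigma> = sgn \<beta>" and "\<tau> = sgn \<gamma>"
    have \<sigma>: "\<sigma> = 1 \<or> \<sigma> = -1" "2 * \<beta> = \<sigma> * a" "\<tau> = 1 \<or> \<tau> = -1" "2 * \<gamma> = \<tau> * a"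
      using half abc(1) by (auto simp: \<sigma>_def \<tau>_def sgn_if)
    have y2: "2 * y e = \<sigma> * z1 e + \<tau> * z2 e" for e
    proof -
      have "a * (2 * y e) = (2 * \<beta>) * z1 e + (2 * \<gamma>) * z2 e" using ay[of e] by (simp add: algebra_simps)
      also have "\<dots> = a * (\<sigma> * z1 e + \<tau> * z2 e)" unfolding \<sigma> by (simp add: algebra_simps)
      finally show ?thesis using abc(1) by simp
    qed
    \<comment> \<open>The companion of \<open>y\<close>: half of the signed difference.\<close>
    define x where "x e = y e - \<tau> * z2 e" for e
    have x2: "2 * x e = \<sigma> * z1 e - \<tau> * z2 e" for e using y2[of e] by (simp add: x_def)
    have xL: "x \<in> edge_lattice E"
      using edge_lattice_lincomb[OF yL z2(1), of 1 "- \<tau>"] by (simp add: x_def[abs_def])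
    have "\<exists>e. x e \<noteq> 0"
    proof (rule ccontr)
      assume "\<nexists>e. x e \<noteq> 0"
      then have "\<sigma> * z1 e + (- \<tau>) * z2 e = 0" for e using x2[of e] by simp
      then show False using nonproportionalD(1)[OF np] \<sigma> by fastforce
    qed
    then have "m \<le> norm1 E x" using min_normD[OF m xL] by blast
    moreover have "m \<le> norm1 E y" using min_normD[OF m yL ye] .
    \<comment> \<open>Since \<open>x\<close> and \<open>y\<close> have norm at least
      \<open>m\<close>, the left sides add up to at least 4m, and the right sides add up to exactly
      4m. Hence equality holds at every edge.\<close>
    moreover have pw: "\<bar>2 * y e\<bar> + \<bar>2 * x e\<bar> \<le> 2 * \<bar>z1 e\<bar> + 2 * \<bar>z2 e\<bar>" for e
      unfolding x2 y2 using \<sigma>(1,3) by auto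
    moreover have sums: "(\<Sum>e\<in>E. \<bar>2 * y e\<bar> + \<bar>2 * x e\<bar>) = 2 * norm1 E y + 2 * norm1 E x"
      "(\<Sum>e\<in>E. 2 * \<bar>z1 e\<bar> + 2 * \<bar>z2 e\<bar>) = 4 * m"
      using z1(2) z2(2)
      by (simp_all add: norm1_def sum.distrib abs_mult flip: sum_distrib_left)
    moreover have "(\<Sum>e\<in>E. \<bar>2 * y e\<bar> + \<bar>2 * x e\<bar>) \<le> (\<Sum>e\<in>E. 2 * \<bar>z1 e\<bar> + 2 * \<bar>z2 e\<bar>)"
      by (intro sum_mono pw)
    ultimately have "(\<Sum>e\<in>E. \<bar>2 * y e\<bar> + \<bar>2 * x e\<bar>) = (\<Sum>e\<in>E. 2 * \<bar>z1 e\<bar> + 2 * \<bar>z2 e\<bar>)"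
      by linarith
    from sum_mono_inv[OF this pw _ E]
    have eqE: "\<bar>2 * y e\<bar> + \<bar>2 * x e\<bar> = 2 * \<bar>z1 e\<bar> + 2 * \<bar>z2 e\<bar>" if "e \<in> E" for e
      using that by blast
    \<comment> \<open>The identity \<bar>a + b\<bar> + \<bar>a - b\<bar> = 2 max(\<bar>a\<bar>,
      \<bar>b\<bar>) turns the equality into min(\<bar>a\<bar>, \<bar>b\<bar>) = 0.\<close>
    have disj: "z1 e = 0 \<or> z2 e = 0" for e
    proof (cases "e \<in> E")
      case True
      from eqE[OF this] show ?thesis unfolding x2 y2 using \<sigma>(1,3) by (auto simp: abs_if split: if_splits)
    next
      case False
      then show ?thesis using edge_lattice_outside[OF z1(1)] by simp
    qed
    \<comment> \<open>Where \<open>z1\<close> is nonzero, \<open>z2\<close> vanishes and 2y =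
      \<sigma> z1; so \<open>w\<close> is half of \<open>z1\<close>.\<close>
    define w where "w e = (if z1 e = 0 then 0 else \<sigma> * y e)" for e
    have w: "z1 e = 2 * w e" for e
      using disj[of e] y2[of e] \<sigma>(1) by (auto simp: w_def)
    obtain d where "z1 d \<noteq> 0"
    proof -
      obtain e e' where "z1 e * z2 e' \<noteq> z1 e' * z2 e" using np by (auto simp: nonproportional_def)
      then have "z1 e \<noteq> 0 \<or> z1 e' \<noteq> 0" by auto
      then show ?thesis using that by blast
    qed
    then show False using shortest_not_double[OF m z1(1) _ _ w] z1(2) by simp
  qed
  have "z e = k * z1 e + l * z2 e" for e using y0[of e] unfolding y_def by linarith
  then show ?thesis by blast
qed

text \<open>If \<open>a\<close> is nonzero, then \<open>z\<close> and \<open>z2\<close> are again a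
  pair of independent shortest vectors, so they span the lattice too. The change of basis has
  determinant \<open>a\<close>, which therefore divides 1.\<close>

lemma shortest_coordinate_le_1:
  assumes E: "finite E" and rk: "rank_le_two E" and m: "min_norm E m"
    and z1: "z1 \<in> edge_lattice E" "norm1 E z1 = m"
    and z2: "z2 \<in> edge_lattice E" "norm1 E z2 = m"
    and np: "nonproportional z1 z2" and z: "z \<in> edge_lattice E" "norm1 E z = m"
    and eq: "\<And>e. z e = a * z1 e + b * z2 e"
  shows "\<bar>a\<bar> \<le> 1"
proof (cases "a = 0")
  case False
  have "nonproportional z z2"
  proof (rule nonproportional_if)
    fix x y assume "\<And>e. x * z e + y * z2 e = 0"
    then have "(x * a) * z1 e + (x * b + y) * z2 e = 0" for e
      by (simp add: eq algebra_simps)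
    from nonproportionalD[OF np this] show "x = 0 \<and> y = 0" using False by simp
  qed
  then obtain c d where "\<And>e. z1 e = c * z e + d * z2 e"
    using shortest_pair_spans[OF E rk m z z2 _ z1(1)] by blast
  then have "(c * a - 1) * z1 e + (c * b + d) * z2 e = 0" for e
    unfolding eq by (simp add: algebra_simps)
  from nonproportionalD(1)[OF np this] have "c * a = 1" by simp
  then have "a dvd 1" by (metis dvd_triv_right)
  then show ?thesis by simp
qed simp

text \<open>All coordinates of shortest vectors lie in {-1, 0, 1}, which leaves four pairs. The sum
  and the difference of the basis vectors are not both shortest, and the sign of the second basis
  vector is chosen so that the difference is excluded.\<close>

lemma shortest_vectors_rank_two:
  assumes E: "finite E" and rk: "rank_le_two E" and m: "min_norm E m"
    and x1: "x1 \<in> edge_lattice E" "norm1 E x1 = m"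
    and x2: "x2 \<in> edge_lattice E" "norm1 E x2 = m"
    and np: "nonproportional x1 x2"
  obtains z1 z2 where "z1 \<in> edge_lattice E" "norm1 E z1 = m" "z2 \<in> edge_lattice E" "norm1 E z2 = m"
    "nonproportional z1 z2"
    "\<And>z. z \<in> edge_lattice E \<Longrightarrow> \<exists>a b. \<forall>e. z e = a * z1 e + b * z2 e"
    "\<And>z. z \<in> edge_lattice E \<Longrightarrow> norm1 E z = m \<Longrightarrow> \<exists>\<sigma>. (\<sigma> = 1 \<or> \<sigma> = -1) \<and>
       ((\<forall>e. z e = \<sigma> * z1 e) \<or> (\<forall>e. z e = \<sigma> * z2 e) \<or> (\<forall>e. z e = \<sigma> * (z1 e + z2 e)))"
proof -
  note result = that
  have diff: thesis
    if z: "z1 \<in> edge_lattice E" "norm1 E z1 = m" "z2 \<in> edge_lattice E" "norm1 E z2 = m"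
      "nonproportional z1 z2" and ne: "norm1 E (\<lambda>e. z1 e - z2 e) \<noteq> m" for z1 z2
  proof (rule result[OF z])
    show span: "\<exists>a b. \<forall>e. z e = a * z1 e + b * z2 e" if "z \<in> edge_lattice E" for z
      using shortest_pair_spans[OF E rk m z that] .
    fix y assume y: "y \<in> edge_lattice E" "norm1 E y = m"
    then obtain a b where ab: "\<And>e. y e = a * z1 e + b * z2 e" using span by blast
    have "\<bar>a\<bar> \<le> 1" using shortest_coordinate_le_1[OF E rk m z y ab] .
    moreover have "\<bar>b\<bar> \<le> 1"
      using shortest_coordinate_le_1[OF E rk m z(3,4,1,2) nonproportional_sym[OF z(5)] y, of b a] ab
      by (simp add: add.commute)
    ultimately have "(a = 0 \<or> a = 1 \<or> a = -1) \<and> (b = 0 \<or> b = 1 \<or> b = -1)" by auto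
    moreover have "\<not> (a = 0 \<and> b = 0)"
      using y(2) min_norm_pos[OF m] by (auto simp: norm1_def ab)
    moreover have "\<not> (a = 1 \<and> b = -1)"
      using y(2) ne by (auto simp: norm1_def ab)
    moreover have "\<not> (a = -1 \<and> b = 1)"
    proof
      assume "a = -1 \<and> b = 1"
      then have "y e = - (z1 e - z2 e)" for e by (simp add: ab)
      then show False using y(2) ne norm1_uminus[of E "\<lambda>e. z1 e - z2 e"] by (simp add: norm1_def)
    qed
    ultimately consider "a = 0" "b = 1 \<or> b = -1" | "b = 0" "a = 1 \<or> a = -1"
      | "a = b" "a = 1 \<or> a = -1" by blast
    then show "\<exists>\<sigma>. (\<sigma> = 1 \<or> \<sigma> = -1) \<and>
       ((\<forall>e. y e = \<sigma> * z1 e) \<or> (\<forall>e. y e = \<sigma> * z2 e) \<or> (\<forall>e. y e = \<sigma> * (z1 e + z2 e)))"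
    proof cases
      case 1 then show ?thesis by (intro exI[of _ b]) (simp add: ab)
    next
      case 2 then show ?thesis by (intro exI[of _ a]) (simp add: ab)
    next
      case 3 then show ?thesis by (intro exI[of _ a]) (simp add: ab distrib_left)
    qed
  qed
  show thesis
  proof (cases "norm1 E (\<lambda>e. x1 e - x2 e) = m")
    case False
    then show ?thesis using diff[OF x1 x2 np] by blast
  next
    case True
    \<comment> \<open>If sum and difference were both shortest, the norms would force \<bar>x1
      e\<bar> = \<bar>x2 e\<bar> at every edge, so the sum would be twice an integral
      vector.\<close>
    have ne: "norm1 E (\<lambda>e. x1 e + x2 e) \<noteq> m"
    proof
      assume s: "norm1 E (\<lambda>e. x1 e + x2 e) = m"
      have pw: "\<bar>x1 e\<bar> + \<bar>x2 e\<bar> \<le> \<bar>x1 e + x2 e\<bar> + \<bar>x1 e - x2 e\<bar>" for e by linarith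
      have "(\<Sum>e\<in>E. \<bar>x1 e\<bar> + \<bar>x2 e\<bar>) = (\<Sum>e\<in>E. \<bar>x1 e + x2 e\<bar> + \<bar>x1 e - x2 e\<bar>)"
        using s True x1(2) x2(2) by (simp add: norm1_def sum.distrib)
      from sum_mono_inv[OF this pw _ E]
      have "\<bar>x1 e\<bar> + \<bar>x2 e\<bar> = \<bar>x1 e + x2 e\<bar> + \<bar>x1 e - x2 e\<bar>" if "e \<in> E" for e
        using that by blast
      then have "\<bar>x1 e\<bar> = \<bar>x2 e\<bar>" if "e \<in> E" for e
        using that by fastforce
      then have eq: "\<bar>x1 e\<bar> = \<bar>x2 e\<bar>" for e
        using edge_lattice_outside[OF x1(1)] edge_lattice_outside[OF x2(1)] by (cases "e \<in> E") auto
      have L: "(\<lambda>e. x1 e + x2 e) \<in> edge_lattice E" by (rule edge_lattice_add[OF x1(1) x2(1)])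
      have "\<exists>d. x1 d + x2 d \<noteq> 0"
      proof (rule ccontr)
        assume "\<nexists>d. x1 d + x2 d \<noteq> 0"
        then show False using nonproportionalD(1)[OF np, of 1 1] by simp
      qed
      then obtain d where "x1 d + x2 d \<noteq> 0" by blast
      moreover have "x1 e + x2 e = 2 * (if x1 e = x2 e then x1 e else 0)" for e
        using eq[of e] by auto
      moreover have "norm1 E (\<lambda>e. x1 e + x2 e) \<le> m" using s by simp
      ultimately show False using shortest_not_double[OF m L, of d "\<lambda>e. if x1 e = x2 e then x1 e else 0"] by blast
    qed
    have np': "nonproportional x1 (\<lambda>e. - x2 e)"
    proof (rule nonproportional_if)
      fix b c assume "\<And>e. b * x1 e + c * - x2 e = 0"
      then show "b = 0 \<and> c = 0" using nonproportionalD[OF np, of b "- c"] by simp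
    qed
    show ?thesis
      using diff[OF x1 edge_lattice_uminus[OF x2(1)] _ np'] x2(2) ne by (simp add: norm1_uminus)
  qed
qed

section \<open>Toric ideals\<close>

abbreviation keys where "keys \<equiv> Poly_Mapping.keys"
abbreviation lookup where "lookup \<equiv> Poly_Mapping.lookup"
abbreviation single where "single \<equiv> Poly_Mapping.single"

text \<open>The exponent of the image of a monomial under \<open>edge_map\<close>, see
  \<open>edge_map_single\<close>. Its fibres carry the multigrading of the toric ideal.\<close>

definition vertex_degree :: "('v set \<Rightarrow>\<^sub>0 nat) \<Rightarrow> ('v \<Rightarrow>\<^sub>0 nat)" where
  "vertex_degree t = (\<Sum>e\<in>keys t. \<Sum>v\<in>e. single v (lookup t e))"

lemma vertex_degree_superset:
  assumes "finite A" "keys t \<subseteq> A"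
  shows "vertex_degree t = (\<Sum>e\<in>A. \<Sum>v\<in>e. single v (lookup t e))"
  unfolding vertex_degree_def using assms
  by (intro sum.mono_neutral_left) (auto simp: in_keys_iff)

lemma vertex_degree_add: "vertex_degree (t + u) = vertex_degree t + vertex_degree u"
proof -
  let ?A = "keys t \<union> keys u"
  have "keys (t + u) \<subseteq> ?A" by (rule Poly_Mapping.keys_add)
  then show ?thesis
    by (simp add: vertex_degree_superset[where A = ?A] lookup_add single_add sum.distrib)
qed

lemma lookup_vertex_degree:
  assumes "finite E" "\<forall>e\<in>E. card e = 2" "keys t \<subseteq> E"
  shows "lookup (vertex_degree t) v = (\<Sum>e | e \<in> E \<and> v \<in> e. lookup t e)"
proof -
  have "lookup (vertex_degree t) v = (\<Sum>e\<in>E. \<Sum>w\<in>e. lookup t e when w = v)"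
    by (simp add: vertex_degree_superset[OF assms(1,3)] lookup_sum lookup_single)
  also have "\<dots> = (\<Sum>e\<in>E. if v \<in> e then lookup t e else 0)"
  proof (intro sum.cong refl)
    fix e assume "e \<in> E"
    then have "finite e" using assms(2) by (auto intro: card_ge_0_finite)
    then show "(\<Sum>w\<in>e. lookup t e when w = v) = (if v \<in> e then lookup t e else 0)"
      by (simp add: when_def sum.delta)
  qed
  also have "\<dots> = (\<Sum>e | e \<in> E \<and> v \<in> e. lookup t e)"
    using assms(1) by (simp add: sum.inter_filter)
  finally show ?thesis .
qed

lemma single_power:
  "(single t 1 :: ('x, 'k::comm_ring_1) mpoly) ^ n = single (\<Sum>i<n. t) 1"
  by (induction n) (simp_all add: mult_single add.commute)

lemma prod_single:
  "(\<Prod>i\<in>A. single (t i) 1 :: ('x, 'k::comm_ring_1) mpoly) = single (\<Sum>i\<in>A. t i) 1"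
  by (induction A rule: infinite_finite_induct) (simp_all add: mult_single)

lemma edge_map_single: "edge_map (single t c) = single (vertex_degree t) c"
proof -
  have "sum (\<lambda>_. single v (Suc 0)) {..<n} = single v n" for v :: 'a and n :: nat
    by (induction n) (simp_all add: single_add[symmetric] add.commute)
  then have "(\<Prod>e\<in>keys t. (edge_monomial e :: ('a, 'b) mpoly) ^ lookup t e)
      = single (\<Sum>e\<in>keys t. \<Sum>v\<in>e. single v (lookup t e)) 1"
    unfolding edge_monomial_def Var_def prod_single single_power
    by (subst sum.swap) simp
  then show ?thesis
    by (simp add: edge_map_def eval_mpoly_single vertex_degree_def Const_def mult_single)
qed

lemma edge_map_eq: "edge_map f = (\<Sum>t\<in>keys f. single (vertex_degree t) (lookup f t))"
  by (subst sum_singles) (simp add: edge_map_def eval_mpoly_sum flip: edge_map_single)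

lemma lookup_edge_map:
  "lookup (edge_map f) a = (\<Sum>t | t \<in> keys f \<and> vertex_degree t = a. lookup f t)"
  by (simp add: edge_map_eq lookup_sum lookup_single when_def sum.inter_filter)

lemma mon_degree_superset:
  assumes "finite A" "keys t \<subseteq> A"
  shows "mon_degree t = (\<Sum>e\<in>A. lookup t e)"
  unfolding mon_degree_def using assms by (intro sum.mono_neutral_left) (auto simp: in_keys_iff)

lemma mon_degree_add: "mon_degree (t + u) = mon_degree t + mon_degree u"
proof -
  let ?A = "keys t \<union> keys u"
  have "keys (t + u) \<subseteq> ?A" by (rule Poly_Mapping.keys_add)
  then show ?thesis by (simp add: mon_degree_superset[where A = ?A] lookup_add sum.distrib)
qed

definition mon_diff :: "('x \<Rightarrow>\<^sub>0 nat) \<Rightarrow> ('x \<Rightarrow>\<^sub>0 nat) \<Rightarrow> 'x \<Rightarrow> int" where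
  "mon_diff t u e = int (lookup t e) - int (lookup u e)"

text \<open>\<open>Abs_poly_mapping\<close> is meaningful only for finite support, so
  \<open>lookup_pos_part\<close> evaluates this for lattice vectors on a finite edge set.\<close>

definition pos_part :: "('x \<Rightarrow> int) \<Rightarrow> ('x \<Rightarrow>\<^sub>0 nat)" where
  "pos_part z = Abs_poly_mapping (\<lambda>e. nat (z e))"

definition neg_part :: "('x \<Rightarrow> int) \<Rightarrow> ('x \<Rightarrow>\<^sub>0 nat)" where
  "neg_part z = pos_part (\<lambda>e. - z e)"

definition lattice_binomial :: "('x \<Rightarrow> int) \<Rightarrow> ('x, 'k::comm_ring_1) mpoly" where
  "lattice_binomial z = single (pos_part z) 1 - single (neg_part z) 1"

text \<open>The link between algebra and lattice: monomials have the same image exactly when their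
  weighted degrees agree at every vertex, and this is the boundary condition for the exponent
  difference.\<close>

lemma vertex_degree_eq_iff:
  assumes "finite E" "\<forall>e\<in>E. card e = 2" "keys t \<subseteq> E" "keys u \<subseteq> E"
  shows "vertex_degree t = vertex_degree u \<longleftrightarrow> mon_diff t u \<in> edge_lattice E"
proof -
  have out: "mon_diff t u e = 0" if "e \<notin> E" for e
    using that assms(3,4) not_in_keys_iff_lookup_eq_zero[of e t] not_in_keys_iff_lookup_eq_zero[of e u]
    by (auto simp: mon_diff_def)
  have "vertex_degree t = vertex_degree u \<longleftrightarrow>
      (\<forall>v. lookup (vertex_degree t) v = lookup (vertex_degree u) v)"
    by (auto intro: poly_mapping_eqI)
  also have "\<dots> \<longleftrightarrow> (\<forall>v. int (\<Sum>e | e \<in> E \<and> v \<in> e. lookup t e) - int (\<Sum>e | e \<in> E \<and> v \<in> e. lookup u e) = 0)"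
    unfolding lookup_vertex_degree[OF assms(1,2,3)] lookup_vertex_degree[OF assms(1,2,4)]
    by (simp del: of_nat_sum)
  also have "\<dots> \<longleftrightarrow> (\<forall>v. (\<Sum>e | e \<in> E \<and> v \<in> e. mon_diff t u e) = 0)"
    by (simp add: mon_diff_def sum_subtractf)
  finally show ?thesis using out by (auto simp: edge_lattice_def)
qed

lemma lookup_pos_part:
  assumes "finite E" "z \<in> edge_lattice E"
  shows "lookup (pos_part z) e = nat (z e)" "lookup (neg_part z) e = nat (- z e)"
proof -
  have "finite {e. z e \<noteq> 0}"
    using assms by (auto simp: edge_lattice_def intro: rev_finite_subset)
  then have "finite {e. nat (z e) \<noteq> 0}" "finite {e. nat (- z e) \<noteq> 0}"
    by (auto elim: rev_finite_subset)
  then show "lookup (pos_part z) e = nat (z e)" "lookup (neg_part z) e = nat (- z e)"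
    by (simp_all add: pos_part_def neg_part_def Abs_poly_mapping_inverse)
qed

lemma keys_pos_part:
  assumes "finite E" "z \<in> edge_lattice E"
  shows "keys (pos_part z) \<subseteq> E" "keys (neg_part z) \<subseteq> E"
  using assms edge_lattice_outside[OF assms(2)] by (fastforce simp: in_keys_iff lookup_pos_part)+

lemma mon_diff_parts:
  assumes "finite E" "z \<in> edge_lattice E"
  shows "mon_diff (pos_part z) (neg_part z) = z"
  using assms by (auto simp: mon_diff_def lookup_pos_part)

lemma mon_diff_self_eq_0_iff: "(\<forall>e. mon_diff t u e = 0) \<longleftrightarrow> t = u"
  by (auto simp: mon_diff_def intro: poly_mapping_eqI)

lemma pos_part_ne_neg_part:
  assumes "finite E" "z \<in> edge_lattice E" "z e \<noteq> 0"
  shows "pos_part z \<noteq> neg_part z"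
  using mon_diff_self_eq_0_iff[of "pos_part z" "neg_part z"] assms by (auto simp: mon_diff_parts)

text \<open>Twice the positive part of an integer is its absolute value plus itself, and the entries
  of a lattice vector add up to zero.\<close>

lemma mon_degree_parts:
  assumes E: "finite E" "\<forall>e\<in>E. card e = 2" and z: "z \<in> edge_lattice E"
  shows "2 * int (mon_degree (pos_part z)) = norm1 E z"
    "2 * int (mon_degree (neg_part z)) = norm1 E z"
proof -
  have "2 * int (mon_degree (pos_part z)) = (\<Sum>e\<in>E. 2 * int (nat (z e)))"
    using E z by (simp add: mon_degree_superset[OF E(1) keys_pos_part(1)] lookup_pos_part sum_distrib_left)
  also have "\<dots> = (\<Sum>e\<in>E. \<bar>z e\<bar> + z e)" by (intro sum.cong) auto
  also have "\<dots> = norm1 E z"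
    using edge_lattice_sum_eq_0[OF E z] by (simp add: sum.distrib norm1_def)
  finally show "2 * int (mon_degree (pos_part z)) = norm1 E z" .
  have "2 * int (mon_degree (neg_part z)) = (\<Sum>e\<in>E. 2 * int (nat (- z e)))"
    using E z by (simp add: mon_degree_superset[OF E(1) keys_pos_part(2)] lookup_pos_part sum_distrib_left)
  also have "\<dots> = (\<Sum>e\<in>E. \<bar>z e\<bar> - z e)" by (intro sum.cong) auto
  also have "\<dots> = norm1 E z"
    using edge_lattice_sum_eq_0[OF E z] by (simp add: sum_subtractf norm1_def)
  finally show "2 * int (mon_degree (neg_part z)) = norm1 E z" .
qed

text \<open>The norm of the difference falls short of the total degree of \<open>t\<close> and
  \<open>u\<close> by what cancels. In the extreme case they have no common variable, so they are
  recovered from the difference.\<close>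

lemma mon_diff_norm_le:
  assumes E: "finite E" "\<forall>e\<in>E. card e = 2" and tu: "keys t \<subseteq> E" "keys u \<subseteq> E"
    "mon_diff t u \<in> edge_lattice E"
  shows "mon_degree t = mon_degree u" "norm1 E (mon_diff t u) \<le> 2 * int (mon_degree t)"
    "norm1 E (mon_diff t u) = 2 * int (mon_degree t) \<Longrightarrow>
       t = pos_part (mon_diff t u) \<and> u = neg_part (mon_diff t u)"
proof -
  have deg: "int (mon_degree t) = (\<Sum>e\<in>E. int (lookup t e))"
    "int (mon_degree u) = (\<Sum>e\<in>E. int (lookup u e))"
    using E(1) tu(1,2) by (simp_all add: mon_degree_superset)
  have "int (mon_degree t) - int (mon_degree u) = 0"
    using edge_lattice_sum_eq_0[OF E tu(3)] by (simp add: mon_diff_def deg sum_subtractf)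
  then show eq: "mon_degree t = mon_degree u" by simp
  have pw: "\<bar>mon_diff t u e\<bar> \<le> int (lookup t e) + int (lookup u e)" for e
    by (simp add: mon_diff_def)
  have s: "(\<Sum>e\<in>E. int (lookup t e) + int (lookup u e)) = 2 * int (mon_degree t)"
    using deg eq by (simp add: sum.distrib)
  show "norm1 E (mon_diff t u) \<le> 2 * int (mon_degree t)"
    unfolding norm1_def s[symmetric] by (intro sum_mono pw)
  assume "norm1 E (mon_diff t u) = 2 * int (mon_degree t)"
  then have eq: "(\<Sum>e\<in>E. \<bar>mon_diff t u e\<bar>) = (\<Sum>e\<in>E. int (lookup t e) + int (lookup u e))"
    using s by (simp add: norm1_def)
  have disj: "lookup t e = 0 \<or> lookup u e = 0" for e
  proof (cases "e \<in> E")
    case True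
    have "\<bar>int (lookup t e) - int (lookup u e)\<bar> = int (lookup t e) + int (lookup u e)"
      using sum_mono_inv[OF eq pw True E(1)] by (simp only: mon_diff_def)
    then show ?thesis by linarith
  next
    case False
    then have "e \<notin> keys t" using tu(1) by (rule contra_subsetD[rotated])
    then show ?thesis by (simp add: in_keys_iff)
  qed
  have "lookup t e = nat (mon_diff t u e)" "lookup u e = nat (- mon_diff t u e)" for e
    using disj[of e] by (elim disjE; simp add: mon_diff_def)+
  then show "t = pos_part (mon_diff t u) \<and> u = neg_part (mon_diff t u)"
    by (auto intro!: poly_mapping_eqI simp: lookup_pos_part[OF E(1) tu(3)])
qed

section \<open>The toric ideal of an edge set\<close>

definition toric :: "'v set set \<Rightarrow> ('v set, 'k::field) mpoly set" where
  "toric E = {f \<in> poly_ring E. edge_map f = 0}"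

lemma toric_ideal_eq: "toric_ideal G = toric (edges G)"
  by (simp add: toric_ideal_def toric_def)

lemma poly_ring_simps:
  "0 \<in> poly_ring X" "f \<in> poly_ring X \<Longrightarrow> g \<in> poly_ring X \<Longrightarrow> f + g \<in> poly_ring X"
  "f \<in> poly_ring X \<Longrightarrow> g \<in> poly_ring X \<Longrightarrow> f - g \<in> poly_ring X"
  "f \<in> poly_ring X \<Longrightarrow> g \<in> poly_ring X \<Longrightarrow> f * g \<in> poly_ring X"
  "f \<in> poly_ring X \<Longrightarrow> - f \<in> poly_ring X"
  "keys t \<subseteq> X \<Longrightarrow> single t c \<in> poly_ring X"
proof -
  show "f + g \<in> poly_ring X" if "f \<in> poly_ring X" "g \<in> poly_ring X"
    using that Poly_Mapping.keys_add[of f g] by (auto simp: poly_ring_def)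
  show "f - g \<in> poly_ring X" if "f \<in> poly_ring X" "g \<in> poly_ring X"
    using that keys_diff[of f g] by (auto simp: poly_ring_def)
  show "f * g \<in> poly_ring X" if "f \<in> poly_ring X" "g \<in> poly_ring X"
    unfolding poly_ring_def
  proof (intro CollectI ballI)
    fix t assume "t \<in> keys (f * g)"
    then obtain u v where "t = u + v" "u \<in> keys f" "v \<in> keys g"
      using keys_mult[of f g] by blast
    then show "keys t \<subseteq> X"
      using that Poly_Mapping.keys_add[of u v] by (fastforce simp: poly_ring_def)
  qed
qed (auto simp: poly_ring_def)

lemma poly_ring_sum: "(\<And>i. i \<in> A \<Longrightarrow> f i \<in> poly_ring X) \<Longrightarrow> sum f A \<in> poly_ring X"
  by (induction A rule: infinite_finite_induct) (auto intro: poly_ring_simps)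

lemma edge_map_diff: "edge_map (f - g) = edge_map f - edge_map g"
  using edge_map_add[of "f - g" g] by (simp add: algebra_simps)

lemma single_minus_single_in_toric:
  assumes "keys t \<subseteq> E" "keys u \<subseteq> E" "vertex_degree t = vertex_degree u"
  shows "single t c - single u c \<in> toric E"
  using assms by (auto simp: toric_def edge_map_diff edge_map_single intro!: poly_ring_simps)

lemma lattice_binomial_in_toric:
  assumes "finite E" "\<forall>e\<in>E. card e = 2" "z \<in> edge_lattice E"
  shows "lattice_binomial z \<in> toric E"
  unfolding lattice_binomial_def using assms
  by (intro single_minus_single_in_toric keys_pos_part)
    (auto simp: vertex_degree_eq_iff[OF assms(1,2)] keys_pos_part mon_diff_parts)

text \<open>The coefficients of \<open>f\<close> add up to zero over each fibre of
  \<open>vertex_degree\<close>, so a nonzero term cannot be alone in its fibre.\<close>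

lemma toric_other_monomial:
  assumes "f \<in> toric E" "t \<in> keys f"
  obtains u where "u \<in> keys f" "u \<noteq> t" "vertex_degree u = vertex_degree t"
proof (rule ccontr)
  assume "\<not> thesis"
  then have "{u. u \<in> keys f \<and> vertex_degree u = vertex_degree t} = {t}" using that assms(2) by blast
  then have "lookup (edge_map f) (vertex_degree t) = lookup f t" by (simp add: lookup_edge_map)
  then show False using assms by (simp add: toric_def in_keys_iff)
qed

section \<open>Homogeneous polynomials and products with monomials\<close>

lemma homogeneous_simps:
  "homogeneous d 0"
  "homogeneous d f \<Longrightarrow> homogeneous d g \<Longrightarrow> homogeneous d (f + g)"
  "homogeneous d f \<Longrightarrow> homogeneous d g \<Longrightarrow> homogeneous d (f - g)"
  "int (mon_degree t) = d \<Longrightarrow> homogeneous d (single t c)"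
proof -
  show "homogeneous d (f + g)" if "homogeneous d f" "homogeneous d g"
    using that Poly_Mapping.keys_add[of f g] by (auto simp: homogeneous_def)
  show "homogeneous d (f - g)" if "homogeneous d f" "homogeneous d g"
    using that keys_diff[of f g] by (auto simp: homogeneous_def)
qed (auto simp: homogeneous_def)

lemma homogeneous_sum:
  "(\<And>i. i \<in> A \<Longrightarrow> homogeneous d (f i)) \<Longrightarrow> homogeneous d (sum f A)"
  by (induction A rule: infinite_finite_induct) (auto intro: homogeneous_simps)

lemma homogeneous_mult:
  assumes "homogeneous c f" "homogeneous d g"
  shows "homogeneous (c + d) (f * g)"
  unfolding homogeneous_def
proof
  fix t assume "t \<in> keys (f * g)"
  then obtain u v where "t = u + v" "u \<in> keys f" "v \<in> keys g" using keys_mult[of f g] by blast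
  then show "int (mon_degree t) = c + d"
    using assms by (simp add: homogeneous_def mon_degree_add)
qed

lemma mon_degree_zero_iff: "mon_degree t = 0 \<longleftrightarrow> t = 0"
proof
  assume "mon_degree t = 0"
  then have "lookup t x = 0" for x by (cases "x \<in> keys t") (auto simp: mon_degree_def in_keys_iff)
  then show "t = 0" by (intro poly_mapping_eqI) simp
qed (simp add: mon_degree_def)

lemma Const_simps:
  "Const 0 = 0" "Const 1 = 1" "Const (a + b) = Const a + Const b" "Const (- a) = - Const a"
  "Const (a - b) = Const a - Const b" "Const (a * b) = Const a * Const b"
  by (simp_all add: Const_def single_add single_uminus single_diff mult_single)

lemma Const_sum: "Const (sum f A) = (\<Sum>i\<in>A. Const (f i))"
  by (induction A rule: infinite_finite_induct) (simp_all add: Const_simps)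

lemma Const_in_poly_ring: "Const c \<in> poly_ring X"
  by (auto simp: Const_def poly_ring_def)

lemma homogeneous_Const: "homogeneous 0 (Const c)"
  by (auto simp: Const_def homogeneous_def mon_degree_zero_iff split: if_splits)

lemma single_mult_eq: "single u c * g = (\<Sum>t\<in>keys g. single (u + t) (c * lookup g t))"
proof -
  have "single u c * g = single u c * (\<Sum>t\<in>keys g. single t (lookup g t))"
    by (subst sum_singles[of g]) simp
  then show ?thesis by (simp add: sum_distrib_left mult_single)
qed

lemma lookup_single_mult:
  fixes g :: "('x, 'k::comm_ring_1) mpoly"
  shows "lookup (single u c * g) (u + t) = c * lookup g t"
proof -
  have "lookup (single u c * g) (u + t) = (\<Sum>s\<in>keys g. if s = t then c * lookup g s else 0)"
    by (simp add: single_mult_eq lookup_sum lookup_single when_def eq_commute)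
  then show ?thesis by (simp add: in_keys_iff)
qed

lemma lookup_Const_mult: "lookup (Const c * g) t = c * lookup g t"
  using lookup_single_mult[of 0 c g t] by (simp add: Const_def)

lemma single_mult_eq_0:
  fixes g :: "('x, 'k::comm_ring_1) mpoly"
  assumes "single u 1 * g = 0"
  shows "g = 0"
  using lookup_single_mult[of u 1 g] assms by (intro poly_mapping_eqI) simp

text \<open>Binomials are nonzerodivisors: in a variable with different exponents in
  \<open>t\<close> and \<open>u\<close>, the products of \<open>g\<close> with the two monomials
  have different largest exponents unless \<open>g\<close> is zero.\<close>

lemma mult_binomial_eq_0:
  fixes g :: "('x, 'k::comm_ring_1) mpoly"
  assumes "g * (single t 1 - single u 1) = 0" "t \<noteq> u"
  shows "g = 0"
proof -
  have main: "g = 0" if eq: "single t 1 * g = single u 1 * g" and less: "lookup u e < lookup t e"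
    for t u :: "'x \<Rightarrow>\<^sub>0 nat" and e
  proof (rule ccontr)
    assume "g \<noteq> 0"
    then have ne: "(\<lambda>s. lookup s e) ` keys g \<noteq> {}" by simp
    define n where "n = Max ((\<lambda>s. lookup s e) ` keys g)"
    obtain s where s: "s \<in> keys g" "lookup s e = n"
      using Max_in[OF _ ne] by (auto simp: n_def)
    have "lookup (single t 1 * g) (t + s) \<noteq> 0"
      using s(1) by (simp add: lookup_single_mult in_keys_iff)
    then have "t + s \<in> keys (single u 1 * g)" unfolding eq by (simp add: in_keys_iff)
    then obtain r where r: "t + s = u + r" "r \<in> keys g"
      using keys_mult[of "single u 1" g] by (auto split: if_splits)
    then have "lookup t e + lookup s e = lookup u e + lookup r e" by (metis lookup_add)
    then have "lookup r e > n" using less s by simp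
    moreover have "lookup r e \<le> n" using r(2) by (simp add: n_def)
    ultimately show False by simp
  qed
  have eq: "single t 1 * g = single u 1 * g" using assms(1) by (simp add: algebra_simps)
  obtain e where "lookup t e \<noteq> lookup u e" using assms(2) by (metis poly_mapping_eqI)
  then show ?thesis using main[OF eq, of e] main[OF eq[symmetric], of e] by linarith
qed

lemma mult_eq_sum_singles:
  "f * g = (\<Sum>t\<in>keys f. \<Sum>u\<in>keys g. single (t + u) (lookup f t * lookup g u))"
  by (subst sum_singles[of f], subst sum_singles[of g]) (simp add: sum_product mult_single)

subsection \<open>Setting variables to zero\<close>

definition restrict_vars :: "'x set \<Rightarrow> ('x, 'k::comm_ring_1) mpoly \<Rightarrow> ('x, 'k) mpoly" where
  "restrict_vars X = eval_mpoly (\<lambda>x. if x \<in> X then Var x else 0)"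

lemma restrict_vars_single:
  "restrict_vars X (single t c) = (if keys t \<subseteq> X then single t c else 0)"
proof (cases "keys t \<subseteq> X")
  case True
  have "sum (\<lambda>_. single x (Suc 0)) {..<n} = single x n" for x :: 'a and n :: nat
    by (induction n) (simp_all add: single_add[symmetric] add.commute)
  moreover have "(\<Prod>x\<in>keys t. (if x \<in> X then Var x else 0 :: ('a, 'b) mpoly) ^ lookup t x)
      = (\<Prod>x\<in>keys t. (Var x :: ('a, 'b) mpoly) ^ lookup t x)"
    using True by (intro prod.cong) auto
  ultimately have "(\<Prod>x\<in>keys t. (if x \<in> X then Var x else 0 :: ('a, 'b) mpoly) ^ lookup t x)
      = single (\<Sum>x\<in>keys t. single x (lookup t x)) 1"
    by (simp add: Var_def single_power prod_single)
  then show ?thesis using True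
    by (simp add: restrict_vars_def eval_mpoly_single Const_def mult_single flip: sum_singles)
next
  case False
  then obtain x where "x \<in> keys t" "x \<notin> X" by blast
  then have "(\<Prod>x\<in>keys t. (if x \<in> X then Var x else 0 :: ('a, 'b) mpoly) ^ lookup t x) = 0"
    by (intro prod_zero) (auto simp: in_keys_iff zero_power intro!: bexI[of _ x])
  then show ?thesis using False by (simp add: restrict_vars_def eval_mpoly_single)
qed

lemma restrict_vars_mult: "restrict_vars X (f * g) = restrict_vars X f * restrict_vars X g"
  by (simp add: restrict_vars_def eval_mpoly_mult)

lemma restrict_vars_sum: "restrict_vars X (sum f A) = (\<Sum>i\<in>A. restrict_vars X (f i))"
  by (simp add: restrict_vars_def eval_mpoly_sum)

lemma lookup_restrict_vars:
  "lookup (restrict_vars X f) t = (if keys t \<subseteq> X then lookup f t else 0)"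
proof -
  have "restrict_vars X f = (\<Sum>s\<in>keys f. if keys s \<subseteq> X then single s (lookup f s) else 0)"
    by (subst sum_singles) (simp add: restrict_vars_sum restrict_vars_single)
  then have "lookup (restrict_vars X f) t
      = (\<Sum>s\<in>keys f. lookup (if keys s \<subseteq> X then single s (lookup f s) else 0) t)"
    by (simp only: lookup_sum)
  also have "\<dots> = (\<Sum>s\<in>keys f. if s = t then (if keys s \<subseteq> X then lookup f s else 0) else 0)"
    by (intro sum.cong refl) (simp add: lookup_single when_def)
  finally show ?thesis by (simp add: in_keys_iff)
qed

lemma keys_restrict_vars: "keys (restrict_vars X f) = {t \<in> keys f. keys t \<subseteq> X}"
proof (rule Set.set_eqI)
  fix t show "t \<in> keys (restrict_vars X f) \<longleftrightarrow> t \<in> {t \<in> keys f. keys t \<subseteq> X}"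
    by (simp add: in_keys_iff[of t] lookup_restrict_vars)
qed

lemma restrict_vars_in_poly_ring: "restrict_vars X f \<in> poly_ring X"
  by (auto simp: poly_ring_def keys_restrict_vars)

lemma restrict_vars_id: "f \<in> poly_ring X \<Longrightarrow> restrict_vars X f = f"
  by (intro poly_mapping_eqI) (auto simp: lookup_restrict_vars poly_ring_def in_keys_iff)

lemma homogeneous_restrict_vars: "homogeneous d f \<Longrightarrow> homogeneous d (restrict_vars X f)"
  by (auto simp: homogeneous_def keys_restrict_vars)

text \<open>Whether all edges of a monomial lie inside \<open>W\<close> can be read off its vertex
  degree. Restriction therefore keeps or kills each fibre as a whole, and the sums over fibres stay
  zero; this is where the subgraph must be induced.\<close>

lemma restrict_vars_toric:
  assumes E: "finite E" "\<forall>e\<in>E. card e = 2" and f: "f \<in> toric E"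
  shows "restrict_vars (edges_within E W) f \<in> toric (edges_within E W)"
proof -
  let ?F = "edges_within E W"
  have sub: "?F \<subseteq> E" "finite ?F" using E(1) by (auto simp: edges_within_def)
  have within: "keys t \<subseteq> ?F \<longleftrightarrow> keys (vertex_degree t) \<subseteq> W" if t: "t \<in> keys f" for t
  proof -
    have tE: "keys t \<subseteq> E" using f t by (auto simp: toric_def poly_ring_def)
    have "v \<in> keys (vertex_degree t) \<longleftrightarrow> (\<exists>e\<in>keys t. v \<in> e)" for v
      using E(1) tE by (auto simp: in_keys_iff lookup_vertex_degree[OF E tE])
    then show ?thesis using tE by (auto simp: edges_within_def)
  qed
  have "lookup (edge_map (restrict_vars ?F f)) a = 0" for a
  proof (cases "keys a \<subseteq> W")
    case True
    then have "{t. t \<in> keys (restrict_vars ?F f) \<and> vertex_degree t = a}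
        = {t. t \<in> keys f \<and> vertex_degree t = a}"
      using within by (auto simp: keys_restrict_vars)
    then have "lookup (edge_map (restrict_vars ?F f)) a = lookup (edge_map f) a"
      unfolding lookup_edge_map by (intro sum.cong) (auto simp: lookup_restrict_vars within True)
    then show ?thesis using f by (simp add: toric_def)
  next
    case False
    then have "{t. t \<in> keys (restrict_vars ?F f) \<and> vertex_degree t = a} = {}"
      using within by (auto simp: keys_restrict_vars)
    then show ?thesis unfolding lookup_edge_map by (simp only: sum.empty)
  qed
  then have "edge_map (restrict_vars ?F f) = 0" by (intro poly_mapping_eqI) simp
  then show ?thesis by (simp add: toric_def restrict_vars_in_poly_ring)
qed

subsection \<open>Logarithmic derivatives\<close>

text \<open>The image under \<open>edge_map\<close> of the Euler operator of the variable
  \<open>e\<close>, which multiplies each monomial by its exponent at \<open>e\<close>.\<close>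

definition log_deriv :: "'v set \<Rightarrow> ('v set, 'k::field) mpoly \<Rightarrow> ('v, 'k) mpoly" where
  "log_deriv e f = (\<Sum>t\<in>keys f. single (vertex_degree t) (of_nat (lookup t e) * lookup f t))"

lemma log_deriv_superset:
  assumes "finite A" "keys f \<subseteq> A"
  shows "log_deriv e f = (\<Sum>t\<in>A. single (vertex_degree t) (of_nat (lookup t e) * lookup f t))"
  unfolding log_deriv_def using assms
  by (intro sum.mono_neutral_left) (auto simp: in_keys_iff)

lemma log_deriv_add: "log_deriv e (f + g) = log_deriv e f + log_deriv e g"
proof -
  let ?A = "keys f \<union> keys g"
  have "keys (f + g) \<subseteq> ?A" by (rule Poly_Mapping.keys_add)
  then show ?thesis
    by (simp add: log_deriv_superset[where A = ?A] lookup_add single_add sum.distrib distrib_left)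
qed

lemma log_deriv_zero: "log_deriv e 0 = 0"
  by (simp add: log_deriv_def)

lemma log_deriv_sum: "log_deriv e (sum f A) = (\<Sum>i\<in>A. log_deriv e (f i))"
  by (induction A rule: infinite_finite_induct) (simp_all add: log_deriv_add log_deriv_zero)

lemma log_deriv_single:
  "log_deriv e (single t c) = single (vertex_degree t) (of_nat (lookup t e) * c)"
  by (subst log_deriv_superset[where A = "{t}"]) auto

text \<open>The Leibniz rule over \<open>edge_map\<close>. When \<open>g\<close> is in the toric
  ideal the first summand vanishes, so only the image of the cofactor \<open>f\<close>
  matters.\<close>

lemma log_deriv_mult:
  "log_deriv e (f * g) = log_deriv e f * edge_map g + edge_map f * log_deriv e g"
proof -
  have "log_deriv e (f * g) = (\<Sum>t\<in>keys f. \<Sum>u\<in>keys g.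
      single (vertex_degree t + vertex_degree u)
        (of_nat (lookup t e + lookup u e) * (lookup f t * lookup g u)))"
    by (simp only: mult_eq_sum_singles log_deriv_sum log_deriv_single vertex_degree_add lookup_add)
  also have "\<dots> = (\<Sum>t\<in>keys f. \<Sum>u\<in>keys g.
      single (vertex_degree t) (of_nat (lookup t e) * lookup f t) * single (vertex_degree u) (lookup g u)
      + single (vertex_degree t) (lookup f t) * single (vertex_degree u) (of_nat (lookup u e) * lookup g u))"
    by (intro sum.cong refl) (simp add: mult_single single_add[symmetric] algebra_simps)
  also have "\<dots> = log_deriv e f * edge_map g + edge_map f * log_deriv e g"
    by (simp add: log_deriv_def edge_map_eq sum_product sum.distrib)
  finally show ?thesis .
qed

lemma log_deriv_lattice_binomial:
  assumes E: "finite E" "\<forall>e\<in>E. card e = 2" and z: "z \<in> edge_lattice E"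
  shows "log_deriv e (lattice_binomial z :: ('v set, 'k::field) mpoly)
    = Const (of_int (z e)) * single (vertex_degree (pos_part z)) 1"
proof -
  have "vertex_degree (pos_part z) = vertex_degree (neg_part z)"
    using vertex_degree_eq_iff[OF E keys_pos_part[OF E(1) z]] z by (simp add: mon_diff_parts[OF E(1)])
  moreover have "log_deriv e (lattice_binomial z + single (neg_part z) 1 :: ('v set, 'k) mpoly)
      = log_deriv e (single (pos_part z) 1)"
    by (simp add: lattice_binomial_def)
  ultimately have "log_deriv e (lattice_binomial z :: ('v set, 'k) mpoly)
      = single (vertex_degree (pos_part z)) (of_nat (nat (z e)) - of_nat (nat (- z e)))"
    by (simp add: log_deriv_add log_deriv_single lookup_pos_part[OF E(1) z] single_diff eq_diff_eq)
  also have "(of_nat (nat (z e)) - of_nat (nat (- z e)) :: 'k) = of_int (z e)"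
    by (cases "z e \<ge> 0") (simp_all add: of_nat_nat)
  finally show ?thesis by (simp only: Const_def mult_single) simp
qed

subsection \<open>Binomials of minimal degree\<close>

lemma mon_diff_uminus: "mon_diff u t e = - mon_diff t u e"
  by (simp add: mon_diff_def)

lemma lattice_binomial_uminus: "lattice_binomial (\<lambda>e. - z e) = - lattice_binomial z"
  by (simp add: lattice_binomial_def neg_part_def)

lemma homogeneous_lattice_binomial:
  assumes "finite E" "\<forall>e\<in>E. card e = 2" "z \<in> edge_lattice E" "norm1 E z = 2 * int q"
  shows "homogeneous (int q) (lattice_binomial z)"
  unfolding lattice_binomial_def using mon_degree_parts[OF assms(1-3)] assms(4)
  by (intro homogeneous_simps) simp_all

text \<open>Two terms in one fibre differ by a nonzero lattice vector of norm at most twice the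
  degree.\<close>

lemma toric_low_degree:
  assumes E: "finite E" "\<forall>e\<in>E. card e = 2" and m: "min_norm E (2 * int q)"
    and f: "f \<in> toric E" "homogeneous d f" "d < int q"
  shows "f = 0"
proof (rule ccontr)
  assume "f \<noteq> 0"
  then obtain t where t: "t \<in> keys f" by (metis keys_eq_empty ex_in_conv)
  obtain u where u: "u \<in> keys f" "u \<noteq> t" "vertex_degree u = vertex_degree t"
    by (rule toric_other_monomial[OF f(1) t])
  have tu: "keys t \<subseteq> E" "keys u \<subseteq> E" using f(1) t u(1) by (auto simp: toric_def poly_ring_def)
  then have L: "mon_diff t u \<in> edge_lattice E"
    using u(3) vertex_degree_eq_iff[OF E, of t u] by simp
  obtain e where "mon_diff t u e \<noteq> 0" using u(2) mon_diff_self_eq_0_iff[of t u] by blast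
  from min_normD[OF m L this] mon_diff_norm_le(2)[OF E tu L]
  show False using f(2,3) t by (auto simp: homogeneous_def)
qed

text \<open>Two terms of degree \<open>q\<close> in one fibre differ by a vector of norm exactly 2q,
  hence are the two monomials of its binomial. Subtracting a multiple of it shortens
  \<open>f\<close>.\<close>

lemma toric_degree_span:
  fixes f :: "('v set, 'k::field) mpoly"
  assumes E: "finite E" "\<forall>e\<in>E. card e = 2" and m: "min_norm E (2 * int q)"
    and Z: "finite Z" "\<And>z. z \<in> edge_lattice E \<Longrightarrow> norm1 E z = 2 * int q \<Longrightarrow> z \<in> Z \<or> (\<lambda>e. - z e) \<in> Z"
    and f: "f \<in> toric E" "homogeneous (int q) f"
  shows "\<exists>p. f = (\<Sum>z\<in>Z. Const (p z) * lattice_binomial z)"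
  using f
proof (induction "card (keys f)" arbitrary: f rule: less_induct)
  case less
  show ?case
  proof (cases "f = 0")
    case True
    then show ?thesis by (intro exI[of _ "\<lambda>_. 0"]) (simp add: Const_simps)
  next
    case False
    then obtain t where t: "t \<in> keys f" by (metis keys_eq_empty ex_in_conv)
    obtain u where u: "u \<in> keys f" "u \<noteq> t" "vertex_degree u = vertex_degree t"
      by (rule toric_other_monomial[OF less.prems(1) t])
    have tu: "keys t \<subseteq> E" "keys u \<subseteq> E"
      using less.prems(1) t u(1) by (auto simp: toric_def poly_ring_def)
    define z where "z = mon_diff t u"
    have L: "z \<in> edge_lattice E"
      using u(3) vertex_degree_eq_iff[OF E, of t u] tu by (simp add: z_def)
    obtain e where "z e \<noteq> 0" using u(2) mon_diff_self_eq_0_iff[of t u] by (auto simp: z_def)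
    have "int (mon_degree t) = int q" using less.prems(2) t by (simp add: homogeneous_def)
    then have norm: "norm1 E z = 2 * int (mon_degree t)" "norm1 E z = 2 * int q"
      using min_normD[OF m L \<open>z e \<noteq> 0\<close>] mon_diff_norm_le(2)[OF E tu] L by (auto simp: z_def)
    have parts: "t = pos_part z" "u = neg_part z"
      using mon_diff_norm_le(3)[OF E tu] L norm(1) by (auto simp: z_def)
    define c where "c = lookup f t"
    define g where "g = f - Const c * lattice_binomial z"
    have b: "Const c * lattice_binomial z = single t c - single u c"
      by (simp add: lattice_binomial_def parts[symmetric] right_diff_distrib Const_def mult_single)
    have "keys g \<subseteq> keys f - {t}"
    proof
      fix s assume "s \<in> keys g"
      then have "lookup f s - (lookup (single t c) s - lookup (single u c) s) \<noteq> 0"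
        by (simp add: g_def b in_keys_iff lookup_minus)
      then show "s \<in> keys f - {t}"
        using t u by (auto simp: lookup_single when_def c_def in_keys_iff split: if_splits)
    qed
    then have "card (keys g) < card (keys f)"
      using t by (metis card_Diff1_less card_mono finite_Diff finite_keys le_less_trans)
    moreover have "g \<in> toric E"
    proof -
      have "Const c * lattice_binomial z \<in> toric E"
        unfolding b using tu u(3) by (intro single_minus_single_in_toric) auto
      then show ?thesis using less.prems(1)
        by (auto simp: g_def toric_def edge_map_diff intro: poly_ring_simps)
    qed
    moreover have "homogeneous (int q) g"
      using homogeneous_mult[OF homogeneous_Const homogeneous_lattice_binomial[OF E L norm(2)], of c]
        less.prems(2) by (auto simp: g_def intro: homogeneous_simps)
    ultimately obtain p where p: "g = (\<Sum>z\<in>Z. Const (p z) * lattice_binomial z)"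
      using less.hyps by blast
    \<comment> \<open>\<open>Z\<close> holds one vector of each pair \<plusminus>z, so the sign of
      the vector may have to move into the coefficient.\<close>
    obtain y d where y: "y \<in> Z" "Const c * lattice_binomial z = Const d * lattice_binomial y"
    proof (cases "z \<in> Z")
      case True then show ?thesis using that by blast
    next
      case False
      then have "(\<lambda>e. - z e) \<in> Z" using Z(2)[OF L norm(2)] by blast
      moreover have "Const c * lattice_binomial z = Const (- c) * lattice_binomial (\<lambda>e. - z e)"
        by (simp add: lattice_binomial_uminus Const_simps)
      ultimately show ?thesis using that by blast
    qed
    have "f = g + Const d * lattice_binomial y" using y(2) by (simp add: g_def)
    also have "Const d * lattice_binomial y
        = (\<Sum>z\<in>Z. if z = y then Const d * lattice_binomial z else 0)" using Z(1) y(1) by simp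
    also have "g + \<dots> = (\<Sum>z\<in>Z. Const (if z = y then p z + d else p z) * lattice_binomial z)"
      unfolding p sum.distrib[symmetric]
      by (intro sum.cong refl) (simp add: Const_simps distrib_right)
    finally show ?thesis by (rule exI[of _ "\<lambda>z. if z = y then p z + d else p z"])
  qed
qed

text \<open>A multiple of \<open>lattice_binomial y\<close> has coefficient sum zero over each class of monomials modulo
  \<open>\<int>y\<close>.\<close>

lemma multiple_of_lattice_binomial:
  fixes g :: "('v set, 'k::field) mpoly"
  assumes E: "finite E" "\<forall>e\<in>E. card e = 2"
    and y: "y \<in> edge_lattice E" and z: "z \<in> edge_lattice E"
    and eq: "lattice_binomial z = g * lattice_binomial y"
  shows "\<exists>k. \<forall>e. z e = k * y e"
proof (rule ccontr)
  assume no: "\<not> ?thesis"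
  \<comment> \<open>The class of the positive monomial of \<open>z\<close>; \<open>S\<close> adds up
    the coefficients over this class.\<close>
  define C where "C = {t. \<exists>k::int. \<forall>e. mon_diff t (pos_part z) e = k * y e}"
  define S where "S f = (\<Sum>t\<in>keys f. if t \<in> C then lookup f t else 0)" for f :: "('v set, 'k) mpoly"
  have S_superset: "S f = (\<Sum>t\<in>A. if t \<in> C then lookup f t else 0)" if "finite A" "keys f \<subseteq> A" for f A
    unfolding S_def using that by (intro sum.mono_neutral_left) (auto simp: in_keys_iff)
  have S_add: "S (f + g) = S f + S g" for f g
  proof -
    let ?A = "keys f \<union> keys g"
    have "keys (f + g) \<subseteq> ?A" by (rule Poly_Mapping.keys_add)
    then have "S (f + g) = (\<Sum>t\<in>?A. (if t \<in> C then lookup f t else 0) + (if t \<in> C then lookup g t else 0))"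
      by (subst S_superset[where A = ?A]) (auto simp: lookup_add intro!: sum.cong)
    also have "\<dots> = S f + S g" by (simp add: sum.distrib S_superset[where A = ?A])
    finally show ?thesis .
  qed
  have S_sum: "S (sum h A) = (\<Sum>i\<in>A. S (h i))" for h :: "_ \<Rightarrow> ('v set, 'k) mpoly" and A
    by (induction A rule: infinite_finite_induct) (simp_all add: S_add, simp_all add: S_def)
  have S_single: "S (single t c) = (if t \<in> C then c else 0)" for t c
    by (subst S_superset[where A = "{t}"]) auto
  have S_diff: "S (single t c - single u c) = S (single t c) - S (single u c)" for t u c
    using S_add[of "single t c - single u c" "single u c"] by (simp add: algebra_simps)
  have "S (g * lattice_binomial y) = 0"
  proof -
    \<comment> \<open>The two monomials of a shifted binomial of \<open>y\<close> differ by
      \<open>y\<close>, so they are in the class together or not at all.\<close>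
    have cls: "t + pos_part y \<in> C \<longleftrightarrow> t + neg_part y \<in> C" for t
    proof -
      have *: "mon_diff (t + pos_part y) (pos_part z) e
          = mon_diff (t + neg_part y) (pos_part z) e + y e" for e
        using y by (simp add: mon_diff_def lookup_add lookup_pos_part[OF E(1)])
      show ?thesis
      proof
        assume "t + pos_part y \<in> C"
        then obtain k where "\<And>e. mon_diff (t + pos_part y) (pos_part z) e = k * y e"
          by (auto simp: C_def)
        then have "mon_diff (t + neg_part y) (pos_part z) e = (k - 1) * y e" for e
          using *[of e] by (simp add: left_diff_distrib)
        then show "t + neg_part y \<in> C" by (auto simp: C_def)
      next
        assume "t + neg_part y \<in> C"
        then obtain k where "\<And>e. mon_diff (t + neg_part y) (pos_part z) e = k * y e"
          by (auto simp: C_def)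
        then have "mon_diff (t + pos_part y) (pos_part z) e = (k + 1) * y e" for e
          using *[of e] by (simp add: distrib_right)
        then show "t + pos_part y \<in> C" by (auto simp: C_def)
      qed
    qed
    have "g * lattice_binomial y = (\<Sum>t\<in>keys g. single t (lookup g t) * lattice_binomial y)"
      by (subst sum_singles[of g]) (simp add: sum_distrib_right)
    also have "\<dots> = (\<Sum>t\<in>keys g. single (t + pos_part y) (lookup g t) - single (t + neg_part y) (lookup g t))"
      by (simp add: lattice_binomial_def right_diff_distrib mult_single)
    finally show ?thesis by (simp add: S_sum S_diff S_single cls)
  qed
  \<comment> \<open>As \<open>z\<close> is no multiple of \<open>y\<close>, only the first of its
    two monomials lies in the class.\<close>
  moreover have "S (lattice_binomial z) = 1"
  proof -
    have "pos_part z \<in> C" by (auto simp: C_def mon_diff_def intro: exI[of _ 0])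
    moreover have "neg_part z \<notin> C"
    proof
      assume "neg_part z \<in> C"
      then obtain k where k: "\<And>e. mon_diff (neg_part z) (pos_part z) e = k * y e" by (auto simp: C_def)
      have "z e = (- k) * y e" for e
        using k[of e] mon_diff_uminus[of "neg_part z" "pos_part z" e] by (simp add: mon_diff_parts[OF E(1) z])
      then show False using no by blast
    qed
    ultimately show ?thesis by (simp add: lattice_binomial_def S_diff S_single)
  qed
  ultimately show False using eq by simp
qed

subsection \<open>Linear presentations\<close>

text \<open>The first two steps of a linear resolution: \<open>F\<close> lists the generators, and
  \<open>N k\<close> is the \<open>k\<close>-th syzygy, that is, column \<open>k\<close> of the
  second differential.\<close>

definition linear_presentation :: "'x set \<Rightarrow> ('x, 'k::field) mpoly set \<Rightarrow> nat \<Rightarrow> nat \<Rightarrow> nat \<Rightarrow>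
    (nat \<Rightarrow> ('x, 'k) mpoly) \<Rightarrow> (nat \<Rightarrow> nat \<Rightarrow> ('x, 'k) mpoly) \<Rightarrow> bool" where
  "linear_presentation X I q b c F N \<longleftrightarrow>
     (\<forall>j<b. F j \<in> poly_ring X) \<and> (\<forall>j<b. homogeneous (int q) (F j)) \<and>
     I = {\<Sum>j<b. s j * F j | s. \<forall>j<b. s j \<in> poly_ring X} \<and>
     (\<forall>k<c. \<forall>j<b. N k j \<in> poly_ring X) \<and> (\<forall>k<c. \<forall>j<b. homogeneous 1 (N k j)) \<and>
     (\<forall>k<c. (\<Sum>j<b. N k j * F j) = 0) \<and>
     (\<forall>s. (\<forall>j<b. s j \<in> poly_ring X) \<longrightarrow> (\<Sum>j<b. s j * F j) = 0 \<longrightarrow>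
        (\<exists>w. \<forall>j<b. s j = (\<Sum>k<c. w k * N k j)))"

lemma linear_resolution_presentation:
  fixes I :: "('x, 'k::field) mpoly set"
  assumes "has_linear_resolution X I q"
  shows "\<exists>b c F N. linear_presentation X I q b c F N"
proof -
  obtain h Fs M where res: "graded_minimal_free_resolution X I h Fs M"
    and lin: "\<And>i j. i \<in> {1..h} \<Longrightarrow> j \<noteq> int q + int i - 1 \<Longrightarrow> count_list (Fs i) j = 0"
    using assms unfolding has_linear_resolution_def by blast
  have F0: "Fs 0 = [0]" and Fbig: "\<And>i. i > h \<Longrightarrow> Fs i = []"
    and M: "\<And>i. i \<ge> 1 \<Longrightarrow> M i \<in> graded_hom X (Fs i) (Fs (i - 1))"
    and I: "(\<lambda>v. v $ 0) ` hom_image X (Fs 1) (M 1) = I"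
    and ker: "\<And>i. i \<ge> 1 \<Longrightarrow> hom_kernel X (Fs i) (M i) = hom_image X (Fs (i + 1)) (M (i + 1))"
    using res by (auto simp: graded_minimal_free_resolution_def)
  \<comment> \<open>All shifts in step \<open>i\<close> equal q + i - 1, so the entries of the first
    differential have degree \<open>q\<close> and those of the second have degree 1.\<close>
  have shift: "Fs i ! j = int q + int i - 1" if "i \<ge> 1" "j < length (Fs i)" for i j
  proof -
    have "i \<le> h" using Fbig[of i] that by (cases "i > h") auto
    then show ?thesis using lin[of i "Fs i ! j"] that by (auto simp: count_list_0_iff)
  qed
  define b c where "b = length (Fs 1)" and "c = length (Fs 2)"
  define F where "F j = M 1 $$ (0, j)" for j
  define N where "N k j = M 2 $$ (j, k)" for k j
  have M1: "M 1 \<in> carrier_mat 1 b" and M2: "M 2 \<in> carrier_mat b c"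
    using M[of 1] M[of 2] F0 by (auto simp: graded_hom_def b_def c_def)
  have Fr: "F j \<in> poly_ring X" "homogeneous (int q) (F j)" if "j < b" for j
    using M[of 1] F0 that shift[of 1 j] by (auto simp: graded_hom_def b_def F_def)
  have Nr: "N k j \<in> poly_ring X" "homogeneous 1 (N k j)" if "k < c" "j < b" for k j
  proof -
    have "N k j \<in> poly_ring X \<and> homogeneous (Fs 2 ! k - Fs 1 ! j) (N k j)"
      using M[of 2] that by (auto simp: graded_hom_def b_def c_def N_def)
    moreover have "Fs 2 ! k - Fs 1 ! j = 1"
      using that shift[of 2 k] shift[of 1 j] by (simp add: b_def c_def)
    ultimately show "N k j \<in> poly_ring X" "homogeneous 1 (N k j)" by simp_all
  qed
  have M1v: "M 1 *\<^sub>v v = vec 1 (\<lambda>_. \<Sum>j<b. v $ j * F j)" if "dim_vec v = b" for v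
    using M1 that by (intro eq_vecI) (auto simp: scalar_prod_def F_def lessThan_atLeast0 mult.commute)
  have M2v: "M 2 *\<^sub>v v = vec b (\<lambda>j. \<Sum>k<c. v $ k * N k j)" if "dim_vec v = c" for v
    using M2 that by (intro eq_vecI) (auto simp: scalar_prod_def N_def lessThan_atLeast0 mult.commute)
  have "linear_presentation X I q b c F N"
    unfolding linear_presentation_def
  proof (intro conjI allI impI)
    show "I = {\<Sum>j<b. s j * F j | s. \<forall>j<b. s j \<in> poly_ring X}"
    proof (intro equalityI subsetI)
      fix f assume "f \<in> I"
      then obtain v where v: "v \<in> free_module X (Fs 1)" "f = (M 1 *\<^sub>v v) $ 0"
        unfolding I[symmetric] hom_image_def by auto
      then have "dim_vec v = b" "\<forall>j<b. v $ j \<in> poly_ring X" by (auto simp: free_module_def b_def)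
      then show "f \<in> {\<Sum>j<b. s j * F j | s. \<forall>j<b. s j \<in> poly_ring X}"
        using v(2) M1v[of v] by (intro CollectI exI[of _ "\<lambda>j. v $ j"]) auto
    next
      fix f assume "f \<in> {\<Sum>j<b. s j * F j | s. \<forall>j<b. s j \<in> poly_ring X}"
      then obtain s where s: "f = (\<Sum>j<b. s j * F j)" "\<forall>j<b. s j \<in> poly_ring X" by auto
      have "vec b s \<in> free_module X (Fs 1)" using s(2) by (auto simp: free_module_def b_def)
      moreover have "f = (M 1 *\<^sub>v vec b s) $ 0" using s(1) by (simp add: M1v[unfolded One_nat_def])
      ultimately show "f \<in> I" unfolding I[symmetric] hom_image_def by blast
    qed
    show "(\<Sum>j<b. N k j * F j) = 0" if k: "k < c" for k
    proof -
      \<comment> \<open>Exactness applied to a unit vector says that column \<open>k\<close> of the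
        second differential is a syzygy.\<close>
      have "unit_vec c k \<in> free_module X (Fs 2)"
        by (auto simp: free_module_def c_def unit_vec_def poly_ring_simps(1))
          (auto simp: poly_ring_def)
      then have "M 2 *\<^sub>v unit_vec c k \<in> hom_kernel X (Fs 1) (M 1)"
        using ker[of 1] by (auto simp: hom_image_def numeral_2_eq_2)
      then have "M 1 *\<^sub>v (M 2 *\<^sub>v unit_vec c k) = 0\<^sub>v 1" using M1 by (simp add: hom_kernel_def)
      moreover have "M 2 *\<^sub>v unit_vec c k = vec b (N k)"
      proof -
        have "(\<Sum>k'<c. unit_vec c k $ k' * N k' j) = (\<Sum>k'<c. if k' = k then N k' j else 0)" for j
          by (intro sum.cong refl) (simp add: unit_vec_def)
        then show ?thesis using k by (simp add: M2v)
      qed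
      ultimately have "vec 1 (\<lambda>_. \<Sum>j<b. N k j * F j) = 0\<^sub>v 1" by (simp add: M1v[unfolded One_nat_def])
      then have "vec 1 (\<lambda>_. \<Sum>j<b. N k j * F j) $ 0 = 0\<^sub>v 1 $ 0" by simp
      then show ?thesis by simp
    qed
    fix s assume s: "\<forall>j<b. s j \<in> poly_ring X" "(\<Sum>j<b. s j * F j) = 0"
    have "vec b s \<in> hom_kernel X (Fs 1) (M 1)"
    proof -
      have "M 1 *\<^sub>v vec b s = 0\<^sub>v 1" using s(2) by (simp add: M1v[unfolded One_nat_def] zero_vec_def)
      then show ?thesis using s(1) M1 by (simp add: hom_kernel_def free_module_def b_def)
    qed
    then obtain v where v: "v \<in> free_module X (Fs 2)" "vec b s = M 2 *\<^sub>v v"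
      using ker[of 1] by (auto simp: hom_image_def numeral_2_eq_2)
    then have "dim_vec v = c" by (auto simp: free_module_def c_def)
    with v(2) have eq: "vec b s = vec b (\<lambda>j. \<Sum>k<c. v $ k * N k j)" by (simp add: M2v)
    have "s j = (\<Sum>k<c. v $ k * N k j)" if "j < b" for j
      using arg_cong[OF eq, of "\<lambda>x. x $ j"] that by simp
    then show "\<exists>w. \<forall>j<b. s j = (\<Sum>k<c. w k * N k j)" by blast
  qed (use Fr Nr in auto)
  then show ?thesis by blast
qed

lemma linear_presentation_generator:
  fixes F :: "nat \<Rightarrow> ('x, 'k::field) mpoly"
  assumes "linear_presentation X I q b c F N" "j < b"
  shows "F j \<in> I"
proof -
  have gen: "I = {\<Sum>j<b. s j * F j | s. \<forall>j<b. s j \<in> poly_ring X}"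
    using assms(1) unfolding linear_presentation_def by blast
  have "F j = (\<Sum>i<b. (if i = j then 1 else 0) * F i)"
    using assms(2) by (simp add: if_distrib[of "\<lambda>x. x * _"] cong: if_cong)
  moreover have "(if i = j then 1 else 0 :: ('x, 'k) mpoly) \<in> poly_ring X" for i
    by (simp add: poly_ring_def)
  ultimately show ?thesis unfolding gen
    by (intro CollectI exI[of _ "\<lambda>i. if i = j then 1 else 0"]) blast
qed

lemma homogeneous_mult_low_degree:
  assumes "homogeneous (int q) F" "t \<in> keys (s * F)"
  shows "mon_degree t \<ge> q"
proof -
  obtain u v where "t = u + v" "v \<in> keys F" using keys_mult[of s F] assms(2) by blast
  then show ?thesis using assms(1) by (auto simp: homogeneous_def mon_degree_add)
qed

text \<open>Every term of \<open>s\<close> of positive degree pushes the product above degree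
  \<open>q\<close>.\<close>

lemma lookup_mult_homogeneous:
  assumes F: "homogeneous (int q) F" and t: "mon_degree t = q"
  shows "lookup (s * F) t = lookup s 0 * lookup F t"
proof -
  define r where "r = s - Const (lookup s 0)"
  have r0: "lookup r 0 = 0" by (simp add: r_def lookup_minus Const_def)
  have "t \<notin> keys (r * F)"
  proof
    assume "t \<in> keys (r * F)"
    then obtain u v where uv: "t = u + v" "u \<in> keys r" "v \<in> keys F" using keys_mult[of r F] by blast
    then have "mon_degree u = 0" using F t by (auto simp: homogeneous_def mon_degree_add)
    then show False using uv(2) r0 by (simp add: mon_degree_zero_iff in_keys_iff)
  qed
  then have "lookup (r * F) t = 0" by (simp add: in_keys_iff)
  moreover have "s * F = r * F + Const (lookup s 0) * F" by (simp add: r_def algebra_simps)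
  ultimately show ?thesis by (simp add: lookup_add lookup_Const_mult)
qed

lemma homogeneous_combination_constant:
  assumes F: "\<And>j. j < b \<Longrightarrow> homogeneous (int q) (F j)"
    and f: "homogeneous (int q) f" "f = (\<Sum>j<b. s j * F j)"
  shows "f = (\<Sum>j<b. Const (lookup (s j) 0) * F j)" (is "_ = ?g")
proof (rule poly_mapping_eqI)
  fix t
  have g: "homogeneous (int q) ?g"
    using homogeneous_mult[OF homogeneous_Const F] by (intro homogeneous_sum) auto
  show "lookup f t = lookup ?g t"
  proof (cases "mon_degree t = q")
    case True
    have "lookup f t = (\<Sum>j<b. lookup (s j * F j) t)" by (simp add: f(2) lookup_sum)
    also have "\<dots> = lookup ?g t"
      using lookup_mult_homogeneous[OF F True] by (simp add: lookup_sum lookup_Const_mult)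
    finally show ?thesis .
  next
    case False
    then have "t \<notin> keys f" "t \<notin> keys ?g" using f(1) g by (auto simp: homogeneous_def)
    then show ?thesis by (simp add: in_keys_iff)
  qed
qed

text \<open>Each monomial in the ideal has degree at least \<open>q\<close>, in particular those of
  the binomial of \<open>z\<close>, whose degree is half the norm of \<open>z\<close>.\<close>

lemma min_norm_if_generated:
  fixes F :: "nat \<Rightarrow> ('v set, 'k::field) mpoly"
  assumes E: "finite E" "\<forall>e\<in>E. card e = 2" and q: "q > 0"
    and F: "\<And>j. j < b \<Longrightarrow> homogeneous (int q) (F j)"
    and gen: "\<And>f. f \<in> toric E \<Longrightarrow> \<exists>s. f = (\<Sum>j<b. s j * F j)"
  shows "min_norm E (2 * int q)"
  unfolding min_norm_def
proof (intro conjI ballI impI)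
  show "2 * int q > 0" using q by simp
  fix z :: "'v set \<Rightarrow> int" assume z: "z \<in> edge_lattice E" "\<exists>e. z e \<noteq> 0"
  obtain s where s: "(lattice_binomial z :: ('v set, 'k) mpoly) = (\<Sum>j<b. s j * F j)"
    using gen[OF lattice_binomial_in_toric[OF E z(1)]] by blast
  have "pos_part z \<noteq> neg_part z" using pos_part_ne_neg_part[OF E(1) z(1)] z(2) by blast
  then have "lookup (lattice_binomial z :: ('v set, 'k) mpoly) (pos_part z) = 1"
    by (simp add: lattice_binomial_def lookup_minus lookup_single when_def)
  then have "(\<Sum>j<b. lookup (s j * F j) (pos_part z)) \<noteq> 0" unfolding s by (simp add: lookup_sum)
  then obtain j where "j < b" "lookup (s j * F j) (pos_part z) \<noteq> 0"
    by (metis (no_types, lifting) lessThan_iff sum.neutral)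
  then have "mon_degree (pos_part z) \<ge> q"
    using homogeneous_mult_low_degree[OF F] by (simp add: in_keys_iff)
  then show "2 * int q \<le> norm1 E z" using mon_degree_parts(1)[OF E z(1)] by linarith
qed

text \<open>A lattice is saturated, so its basis vectors stay independent in every characteristic.\<close>

lemma nonproportional_mod_char:
  assumes E: "finite E" and m: "min_norm E m"
    and z1: "z1 \<in> edge_lattice E" "norm1 E z1 = m" and z2: "z2 \<in> edge_lattice E"
    and np: "nonproportional z1 z2"
    and span: "\<And>z. z \<in> edge_lattice E \<Longrightarrow> \<exists>a b. \<forall>e. z e = a * z1 e + b * z2 e"
  shows "\<exists>e e'. of_int (z1 e * z2 e' - z1 e' * z2 e) \<noteq> (0::'k::field)"
proof (rule ccontr)
  define p where "p = int CHAR('k)"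
  assume "\<not> ?thesis"
  then have "of_int (z1 e * z2 e' - z1 e' * z2 e) = (0::'k)" for e e' by (simp only: not_ex not_not)
  then have dvd: "p dvd z1 e * z2 e' - z1 e' * z2 e" for e e'
    unfolding p_def by (rule iffD1[OF of_int_eq_0_iff_char_dvd])
  have p0: "p \<noteq> 0"
  proof
    assume "p = 0"
    then show False using np dvd by (auto simp: nonproportional_def)
  qed
  have p1: "p \<ge> 2"
  proof -
    have "CHAR('k) \<noteq> 1" using of_nat_CHAR[where 'a = 'k] by (intro notI) simp
    then show ?thesis using p0 unfolding p_def by linarith
  qed
  \<comment> \<open>If \<open>p\<close> divided all entries, z1/p would be a lattice vector shorter
    than the bound.\<close>
  obtain d where d: "\<not> p dvd z1 d"
  proof (rule ccontr)
    assume "\<not> thesis"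
    then have "p dvd z1 e" for e using that by blast
    then have eq: "z1 e = p * (z1 e div p)" for e by simp
    define y where "y e = z1 e div p" for e
    have "(\<lambda>e. p * y e) \<in> edge_lattice E" using z1(1) eq by (simp add: y_def)
    then have y: "y \<in> edge_lattice E" using edge_lattice_saturated p0 by blast
    have n: "norm1 E z1 = p * norm1 E y"
      using norm1_scale[of E p y] eq p1 by (simp add: y_def)
    have "\<exists>e. y e \<noteq> 0"
    proof (rule ccontr)
      assume "\<nexists>e. y e \<noteq> 0"
      then have "norm1 E y = 0" by (simp add: norm1_def)
      then show False using n z1(2) min_norm_pos[OF m] by simp
    qed
    then have "m \<le> norm1 E y" using min_normD[OF m y] by blast
    moreover have "p * norm1 E y \<ge> 2 * norm1 E y"
      using p1 \<open>m \<le> norm1 E y\<close> min_norm_pos[OF m] by (intro mult_right_mono) auto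
    ultimately show False using n z1(2) min_norm_pos[OF m] by linarith
  qed
  \<comment> \<open>Since \<open>p\<close> divides all minors, this quotient is integral and lies in
    the lattice. Its coordinate at \<open>z2\<close> would be z1 d / p, which is not an
    integer.\<close>
  define y where "y e = (z1 d * z2 e - z2 d * z1 e) div p" for e
  have y: "p * y e = z1 d * z2 e - z2 d * z1 e" for e
    using dvd[of d e] by (simp add: y_def mult.commute)
  have "(\<lambda>e. p * y e) \<in> edge_lattice E"
    using edge_lattice_lincomb[OF z2 z1(1), of "z1 d" "- z2 d"] by (simp add: y)
  then have "y \<in> edge_lattice E" using edge_lattice_saturated p0 by blast
  then obtain a b where ab: "\<And>e. y e = a * z1 e + b * z2 e" using span by blast
  have "(p * a + z2 d) * z1 e + (p * b - z1 d) * z2 e = 0" for e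
    using y[of e] by (simp add: ab algebra_simps)
  from nonproportionalD(2)[OF np this] have "z1 d = p * b" by simp
  then show False using d by simp
qed

text \<open>All generators are scalar multiples of the binomial of \<open>y\<close>, so the
  binomials of all lattice vectors are multiples of it. The vector \<open>y\<close> may be zero when
  no vector has norm 2q.\<close>

lemma toric_principal_cyclic:
  fixes F :: "nat \<Rightarrow> ('v set, 'k::field) mpoly"
  assumes E: "finite E" "\<forall>e\<in>E. card e = 2" and m: "min_norm E (2 * int q)"
    and F: "\<And>j. j < b \<Longrightarrow> F j \<in> toric E" "\<And>j. j < b \<Longrightarrow> homogeneous (int q) (F j)"
    and gen: "\<And>f. f \<in> toric E \<Longrightarrow> \<exists>s. f = (\<Sum>j<b. s j * F j)"
    and y: "y \<in> edge_lattice E"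
    and short: "\<And>z. z \<in> edge_lattice E \<Longrightarrow> norm1 E z = 2 * int q \<Longrightarrow> z = y \<or> (\<lambda>e. - z e) = y"
    and z: "z \<in> edge_lattice E"
  shows "\<exists>k. \<forall>e. z e = k * y e"
proof -
  have "\<exists>p. F j = Const p * lattice_binomial y" if "j < b" for j
    using toric_degree_span[OF E m, of "{y}" "F j"] short F that by auto
  then obtain p where p: "\<And>j. j < b \<Longrightarrow> F j = Const (p j) * lattice_binomial y" by metis
  obtain s where "(lattice_binomial z :: ('v set, 'k) mpoly) = (\<Sum>j<b. s j * F j)"
    using gen[OF lattice_binomial_in_toric[OF E z]] by blast
  also have "\<dots> = (\<Sum>j<b. s j * Const (p j)) * lattice_binomial y"
    by (simp add: p sum_distrib_right mult.assoc)
  finally show ?thesis using multiple_of_lattice_binomial[OF E y z] by blast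
qed

text \<open>Logarithmic derivatives kill the cofactors' own contributions and leave, for each edge,
  a linear relation with the entries of \<open>z1\<close>, \<open>z2\<close>, \<open>z3\<close> as
  coefficients.\<close>

lemma linear_syzygy_on_triangle:
  fixes l1 l2 l3 :: "('v set, 'k::field) mpoly"
  assumes E: "finite E" "\<forall>e\<in>E. card e = 2" and m: "min_norm E m"
    and z1: "z1 \<in> edge_lattice E" "norm1 E z1 = m" and z2: "z2 \<in> edge_lattice E"
    and np: "nonproportional z1 z2"
    and span: "\<And>z. z \<in> edge_lattice E \<Longrightarrow> \<exists>a b. \<forall>e. z e = a * z1 e + b * z2 e"
    and z3: "z3 = (\<lambda>e. - (z1 e + z2 e))"
    and syz: "l1 * lattice_binomial z1 + l2 * lattice_binomial z2 + l3 * lattice_binomial z3 = 0"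
  shows "edge_map (l1 * single (pos_part z1) 1) = edge_map (l3 * single (pos_part z3) 1)"
proof -
  have z3L: "z3 \<in> edge_lattice E"
    unfolding z3 by (rule edge_lattice_uminus[OF edge_lattice_add[OF z1(1) z2]])
  define c where "c l z = edge_map (l * single (pos_part z) 1)" for l :: "('v set, 'k) mpoly" and z
  have D: "log_deriv e (l * lattice_binomial z) = Const (of_int (z e)) * c l z"
    if "z \<in> edge_lattice E" for l :: "('v set, 'k) mpoly" and z e
    using that lattice_binomial_in_toric[OF E that, where 'b = 'k]
    by (simp add: log_deriv_mult log_deriv_lattice_binomial[OF E] toric_def c_def edge_map_mult
        edge_map_single mult_ac)
  \<comment> \<open>The vectors add up to zero, so the relation involves only these two differences.
    A 2x2 minor that is nonzero in the field then forces \<open>x = 0\<close>.\<close>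
  define x y where "x = c l1 z1 - c l3 z3" and "y = c l2 z2 - c l3 z3"
  have rel: "Const (of_int (z1 e)) * x + Const (of_int (z2 e)) * y = 0" for e
  proof -
    have "Const (of_int (z1 e)) * c l1 z1 + Const (of_int (z2 e)) * c l2 z2
        + Const (of_int (z3 e)) * c l3 z3 = 0"
      using arg_cong[OF syz, of "log_deriv e"] z1 z2 z3L by (simp add: log_deriv_add log_deriv_zero D)
    then show ?thesis by (simp add: x_def y_def z3 Const_simps algebra_simps)
  qed
  have "\<exists>e e'. of_int (z1 e * z2 e' - z1 e' * z2 e) \<noteq> (0::'k)"
    by (rule nonproportional_mod_char[OF E(1) m z1 z2 np]) (rule span)
  then obtain e e' where ne: "of_int (z1 e * z2 e' - z1 e' * z2 e) \<noteq> (0::'k)"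
    by (elim exE)
  have rel': "of_int (z1 e) * lookup x a + of_int (z2 e) * lookup y a = 0" for e a
    using arg_cong[OF rel[of e], of "\<lambda>f. lookup f a"] by (simp add: lookup_add lookup_Const_mult)
  have "lookup x a = 0" for a
  proof -
    have "of_int (z1 e * z2 e' - z1 e' * z2 e) * lookup x a
        = (of_int (z1 e) * lookup x a + of_int (z2 e) * lookup y a) * of_int (z2 e')
        - (of_int (z1 e') * lookup x a + of_int (z2 e') * lookup y a) * of_int (z2 e)"
      by (simp add: algebra_simps)
    then show ?thesis unfolding rel' using ne by simp
  qed
  then have "x = 0" by (auto intro: poly_mapping_eqI)
  then show ?thesis by (simp add: x_def c_def)
qed

lemma edge_map_mult_single_eq_0:
  "edge_map (l * single t 1) = 0 \<Longrightarrow> edge_map l = 0"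
  using single_mult_eq_0[of "vertex_degree t" "edge_map l"]
  by (simp add: edge_map_mult edge_map_single mult.commute)

text \<open>In a relation each of the two monomials of one binomial must be cancelled by the other.
  The pair of monomials determines the vector up to sign.\<close>

lemma lattice_binomials_independent:
  assumes E: "finite E" and z1: "z1 \<in> edge_lattice E" "z1 d \<noteq> 0" and z2: "z2 \<in> edge_lattice E" "z2 d' \<noteq> 0"
    and ne: "z1 \<noteq> z2" "z1 \<noteq> (\<lambda>e. - z2 e)"
    and eq: "Const a * lattice_binomial z1 + Const b * lattice_binomial z2 = (0 :: ('v set, 'k::field) mpoly)"
  shows "a = 0" "b = 0"
proof -
  have main: "a = 0" if z1: "z1 \<in> edge_lattice E" "z1 d \<noteq> 0" and z2: "z2 \<in> edge_lattice E"
    and ne: "z1 \<noteq> z2" "z1 \<noteq> (\<lambda>e. - z2 e)"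
    and eq: "Const a * lattice_binomial z1 + Const b * lattice_binomial z2 = (0 :: ('v set, 'k) mpoly)"
    for z1 z2 d and a b :: 'k
  proof (rule ccontr)
    assume "a \<noteq> 0"
    have n1: "pos_part z1 \<noteq> neg_part z1" using pos_part_ne_neg_part[OF E z1] .
    have inj: "z1 = z" if "pos_part z1 = pos_part z" "neg_part z1 = neg_part z" "z \<in> edge_lattice E" for z
      using that mon_diff_parts[OF E z1(1)] mon_diff_parts[OF E that(3)] by metis
    have neg: "pos_part (\<lambda>e. - z2 e) = neg_part z2" "neg_part (\<lambda>e. - z2 e) = pos_part z2"
      by (simp_all add: neg_part_def)
    have *: "lookup (Const a * lattice_binomial z1 + Const b * lattice_binomial z2) t
        = a * ((1 when pos_part z1 = t) - (1 when neg_part z1 = t))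
        + b * ((1 when pos_part z2 = t) - (1 when neg_part z2 = t))" for t
      by (simp add: lookup_add lookup_Const_mult lattice_binomial_def lookup_minus lookup_single)
    have p: "pos_part z1 = pos_part z2 \<or> pos_part z1 = neg_part z2"
      using *[of "pos_part z1"] n1 \<open>a \<noteq> 0\<close> by (auto simp: eq when_def split: if_splits)
    have n: "neg_part z1 = pos_part z2 \<or> neg_part z1 = neg_part z2"
      using *[of "neg_part z1"] n1 \<open>a \<noteq> 0\<close> by (auto simp: eq when_def split: if_splits)
    have "z1 = z2 \<or> z1 = (\<lambda>e. - z2 e)"
      using p n n1 inj[OF _ _ z2] inj[OF _ _ edge_lattice_uminus[OF z2]] neg by metis
    then show False using ne by blast
  qed
  show "a = 0" by (rule main[OF z1 z2(1) ne eq])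
  show "b = 0"
  proof (rule main[OF z2 z1(1)])
    show "z2 \<noteq> z1" using ne(1) by simp
    show "z2 \<noteq> (\<lambda>e. - z1 e)" using ne(2) by auto
    show "Const b * lattice_binomial z2 + Const a * lattice_binomial z1 = 0"
      using eq by (simp add: add.commute)
  qed
qed

lemma proportional_same_norm:
  assumes "\<not> nonproportional y z" "norm1 E z = norm1 E y" "norm1 E y > 0"
  shows "z = y \<or> (\<lambda>e. - z e) = y"
proof -
  have prp: "y e * z e' = y e' * z e" for e e' using assms(1) by (auto simp: nonproportional_def)
  obtain d where d: "y d \<noteq> 0"
  proof (rule ccontr)
    assume "\<not> thesis"
    then have "y d = 0" for d using that by blast
    then have "norm1 E y = 0" by (simp add: norm1_def)
    then show False using assms(3) by simp
  qed
  have "(\<lambda>e. y d * z e) = (\<lambda>e. z d * y e)" using prp[of d] by (auto simp: mult.commute)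
  then have "\<bar>y d\<bar> * norm1 E z = \<bar>z d\<bar> * norm1 E y" using norm1_scale[of E] by metis
  then have "\<bar>y d\<bar> = \<bar>z d\<bar>" using assms(2,3) by simp
  then consider "z d = y d" | "z d = - y d" by (auto simp: abs_if split: if_splits)
  then show ?thesis
  proof cases
    case 1
    then have "z e = y e" for e using prp[of d e] d by simp
    then show ?thesis by blast
  next
    case 2
    then have "y d * (- z e) = y d * y e" for e using prp[of d e] by simp
    then have "- z e = y e" for e using d by (metis mult_left_cancel)
    then show ?thesis by blast
  qed
qed

text \<open>On a subgraph of rank exactly two, at most three binomials of degree \<open>q\<close> matter, and they belong
  to vectors with sum zero. By \<open>linear_syzygy_on_triangle\<close> the columns of linear syzygies are
  proportional modulo the toric ideal, hence proportional since \<open>q > 2\<close>. The Koszul syzygy of two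
  binomials has a zero third entry, so all columns have one; then they vanish altogether.\<close>

lemma linear_resolution_not_independent:
  assumes E: "finite E" "\<forall>e\<in>E. card e = 2" and q: "q \<ge> 3"
    and lin: "has_linear_resolution E (toric E :: ('v set, 'k::field) mpoly set) q"
    and no_C4: "\<And>a b c d. min_norm E (2 * int q) \<Longrightarrow> distinct [a, b, c, d] \<Longrightarrow>
      {{a, b}, {b, c}, {c, d}, {d, a}} \<subseteq> E \<Longrightarrow> False"
  shows "\<not> independent_pair E"
proof
  assume ind: "independent_pair E"
  obtain b c F N where pres: "linear_presentation E (toric E :: ('v set, 'k) mpoly set) q b c F N"
    using linear_resolution_presentation[OF lin] by blast
  have F: "\<And>j. j < b \<Longrightarrow> F j \<in> poly_ring E" "\<And>j. j < b \<Longrightarrow> homogeneous (int q) (F j)"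
    and gen: "toric E = {\<Sum>j<b. s j * F j | s. \<forall>j<b. s j \<in> poly_ring E}"
    and N: "\<And>k j. k < c \<Longrightarrow> j < b \<Longrightarrow> homogeneous 1 (N k j)"
      "\<And>k. k < c \<Longrightarrow> (\<Sum>j<b. N k j * F j) = 0"
    and syz: "\<And>s. \<forall>j<b. s j \<in> poly_ring E \<Longrightarrow> (\<Sum>j<b. s j * F j) = 0 \<Longrightarrow>
       \<exists>w. \<forall>j<b. s j = (\<Sum>k<c. w k * N k j)"
    using pres unfolding linear_presentation_def by simp_all
  have FE: "F j \<in> toric E" if "j < b" for j
    by (rule linear_presentation_generator[OF pres that])
  \<comment> \<open>Generation in degree \<open>q\<close> bounds all norms below by 2q; this bound
    is what rules out 4-cycles.\<close>
  have mE: "min_norm E (2 * int q)"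
    using gen q by (intro min_norm_if_generated[OF E _ F(2)]) auto
  obtain W where W: "independent_pair (edges_within E W)" "rank_le_two (edges_within E W)"
    using induced_rank_two[OF E _ ind] no_C4[OF mE] by metis
  define E' where "E' = edges_within E W"
  have sub: "E' \<subseteq> E" by (auto simp: E'_def edges_within_def)
  have E': "finite E'" "\<forall>e\<in>E'. card e = 2" using sub E by (auto intro: finite_subset)
  have m: "min_norm E' (2 * int q)"
    unfolding min_norm_def
  proof (intro conjI ballI impI)
    fix z assume z: "z \<in> edge_lattice E'" "\<exists>e. z e \<noteq> 0"
    have "2 * int q \<le> norm1 E z"
      using min_normD[OF mE edge_lattice_mono[OF E(1) sub z(1)]] z(2) by blast
    also have "norm1 E z = norm1 E' z" unfolding norm1_def
      using E(1) sub edge_lattice_outside[OF z(1)] by (intro sum.mono_neutral_right) auto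
    finally show "2 * int q \<le> norm1 E' z" .
  qed (use q in simp)
  \<comment> \<open>\<open>R\<close> transports generators and syzygies to the subgraph, while it
    fixes the toric ideal there.\<close>
  define R where "R = (restrict_vars E' :: ('v set, 'k) mpoly \<Rightarrow> _)"
  have R: "R (f * g) = R f * R g" "R (sum h A) = (\<Sum>i\<in>A. R (h i))" for f g h and A :: "nat set"
    by (simp_all add: R_def restrict_vars_mult restrict_vars_sum)
  have R_id: "R f = f" if "f \<in> toric E'" for f
    using that by (simp add: R_def toric_def restrict_vars_id)
  have RF: "R (F j) \<in> toric E'" "homogeneous (int q) (R (F j))" if "j < b" for j
    using restrict_vars_toric[OF E FE[OF that]] homogeneous_restrict_vars[OF F(2)[OF that]]
    by (simp_all add: R_def E'_def)
  have toric_sub: "toric E' \<subseteq> (toric E :: ('v set, 'k) mpoly set)"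
    using sub by (auto simp: toric_def poly_ring_def)
  have gen': "\<exists>s. f = (\<Sum>j<b. s j * R (F j))" if f: "f \<in> toric E'" for f
  proof -
    obtain s where "f = (\<Sum>j<b. s j * F j)" using f toric_sub gen by blast
    then have "R f = (\<Sum>j<b. R (s j) * R (F j))" by (simp add: R)
    then show ?thesis using R_id[OF f] by (intro exI[of _ "\<lambda>j. R (s j)"]) simp
  qed
  have not_cyclic: "\<not> (\<exists>y\<in>edge_lattice E'. \<forall>z\<in>edge_lattice E'. \<exists>k. \<forall>e. z e = k * y e)"
  proof
    assume "\<exists>y\<in>edge_lattice E'. \<forall>z\<in>edge_lattice E'. \<exists>k. \<forall>e. z e = k * y e"
    then obtain y where y: "\<And>z. z \<in> edge_lattice E' \<Longrightarrow> \<exists>k. \<forall>e. z e = k * y e" by blast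
    obtain z x e e' where "z \<in> edge_lattice E'" "x \<in> edge_lattice E'" "z e * x e' \<noteq> z e' * x e"
      using W(1) unfolding independent_pair_def E'_def by blast
    moreover obtain k l where "\<forall>e. z e = k * y e" "\<forall>e. x e = l * y e"
      using y calculation by metis
    ultimately show False by (simp add: mult_ac)
  qed
  \<comment> \<open>With at most one pair of shortest vectors the ideal would be principal and the
    lattice cyclic.\<close>
  have "\<exists>x1\<in>edge_lattice E'. \<exists>x2\<in>edge_lattice E'.
      norm1 E' x1 = 2 * int q \<and> norm1 E' x2 = 2 * int q \<and> nonproportional x1 x2"
  proof (rule ccontr)
    assume none: "\<not> ?thesis"
    \<comment> \<open>The default value zero covers the case without any vector of norm 2q.\<close>
    define y where "y = (if \<exists>z\<in>edge_lattice E'. norm1 E' z = 2 * int q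
      then SOME z. z \<in> edge_lattice E' \<and> norm1 E' z = 2 * int q else (\<lambda>_. 0))"
    have y: "y \<in> edge_lattice E'"
      unfolding y_def using someI_ex[of "\<lambda>z. z \<in> edge_lattice E' \<and> norm1 E' z = 2 * int q"] by auto
    have "z = y \<or> (\<lambda>e. - z e) = y" if z: "z \<in> edge_lattice E'" "norm1 E' z = 2 * int q" for z
    proof -
      have yn: "norm1 E' y = 2 * int q"
        unfolding y_def using someI_ex[of "\<lambda>z. z \<in> edge_lattice E' \<and> norm1 E' z = 2 * int q"] z by auto
      then have "\<not> nonproportional y z" using none y z by blast
      then show ?thesis by (rule proportional_same_norm[of _ _ E']) (use yn z(2) q in simp_all)
    qed
    then have "\<exists>k. \<forall>e. z e = k * y e" if "z \<in> edge_lattice E'" for z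
      using toric_principal_cyclic[OF E' m, of b "\<lambda>j. R (F j)" y z] RF gen' y that by presburger
    then show False using y not_cyclic by blast
  qed
  then obtain x1 x2 where x: "x1 \<in> edge_lattice E'" "norm1 E' x1 = 2 * int q"
    "x2 \<in> edge_lattice E'" "norm1 E' x2 = 2 * int q" "nonproportional x1 x2" by blast
  show False
  proof (rule shortest_vectors_rank_two[OF E'(1) W(2)[folded E'_def] m x])
    fix z1 z2
    assume z1: "z1 \<in> edge_lattice E'" "norm1 E' z1 = 2 * int q"
      and z2: "z2 \<in> edge_lattice E'" "norm1 E' z2 = 2 * int q" and np: "nonproportional z1 z2"
      and span: "\<And>z. z \<in> edge_lattice E' \<Longrightarrow> \<exists>a b. \<forall>e. z e = a * z1 e + b * z2 e"
      and short: "\<And>z. z \<in> edge_lattice E' \<Longrightarrow> norm1 E' z = 2 * int q \<Longrightarrow> \<exists>\<sigma>. (\<sigma> = 1 \<or> \<sigma> = -1) \<and>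
         ((\<forall>e. z e = \<sigma> * z1 e) \<or> (\<forall>e. z e = \<sigma> * z2 e) \<or> (\<forall>e. z e = \<sigma> * (z1 e + z2 e)))"
    \<comment> \<open>The only possible third pair, with the sign that makes the three vectors add
      up to zero; it may be longer than the other two.\<close>
    define z3 where "z3 = (\<lambda>e. - (z1 e + z2 e))"
    have z3: "z3 \<in> edge_lattice E'"
      unfolding z3_def by (rule edge_lattice_uminus[OF edge_lattice_add[OF z1(1) z2(1)]])
    define B :: "('v set \<Rightarrow> int) \<Rightarrow> ('v set, 'k) mpoly" where "B = lattice_binomial"
    have BT: "B z1 \<in> toric E'" "B z2 \<in> toric E'" "B z3 \<in> toric E'"
      unfolding B_def using lattice_binomial_in_toric[OF E'] z1 z2 z3 by auto
    have Bh: "homogeneous (int q) (B z1)" "homogeneous (int q) (B z2)"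
      unfolding B_def using homogeneous_lattice_binomial[OF E'] z1 z2 by auto
    have ne12: "z1 \<noteq> z2" "z1 \<noteq> (\<lambda>e. - z2 e)" using np by (auto simp: nonproportional_def)
    obtain d1 where d1: "z1 d1 \<noteq> 0" using np unfolding nonproportional_def by (metis mult_zero_left)
    obtain d2 where d2: "z2 d2 \<noteq> 0" using np unfolding nonproportional_def by (metis mult_zero_right)
    have ind12: "a = 0 \<and> a' = 0" if "Const a * B z1 + Const a' * B z2 = 0" for a a'
      using lattice_binomials_independent[OF E'(1) z1(1) d1 z2(1) d2 ne12 that[unfolded B_def]] by blast
    \<comment> \<open>The binomial of \<open>z3\<close> may be too long or a combination of the
      others. If the first two span the degree \<open>q\<close> part, the coefficient at the third
      is fixed as zero; this makes coordinates unique in every case.\<close>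
    define dep where "dep \<longleftrightarrow> (\<forall>f\<in>toric E'. homogeneous (int q) f \<longrightarrow>
        (\<exists>a a'. f = Const a * B z1 + Const a' * B z2))"
    have span3: "\<exists>a a' a''. f = Const a * B z1 + Const a' * B z2 + Const a'' * B z3 \<and> (dep \<longrightarrow> a'' = 0)"
      if f: "f \<in> toric E'" "homogeneous (int q) f" for f
    proof (cases dep)
      case True
      then obtain a a' where "f = Const a * B z1 + Const a' * B z2" using f dep_def by blast
      then show ?thesis by (intro exI[of _ a] exI[of _ a'] exI[of _ 0]) (simp add: Const_simps)
    next
      case False
      have cover: "z \<in> {z1, z2, z3} \<or> (\<lambda>e. - z e) \<in> {z1, z2, z3}"
        if z: "z \<in> edge_lattice E'" "norm1 E' z = 2 * int q" for z
      proof -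
        obtain \<sigma> where \<sigma>: "\<sigma> = 1 \<or> \<sigma> = -1" "(\<forall>e. z e = \<sigma> * z1 e) \<or> (\<forall>e. z e = \<sigma> * z2 e) \<or>
            (\<forall>e. z e = \<sigma> * (z1 e + z2 e))" using short[OF z] by blast
        then have "(\<forall>e. z e = z1 e) \<or> (\<forall>e. - z e = z1 e) \<or> (\<forall>e. z e = z2 e) \<or> (\<forall>e. - z e = z2 e) \<or>
          (\<forall>e. z e = z3 e) \<or> (\<forall>e. - z e = z3 e)"
          unfolding z3_def by (elim disjE) simp_all
        then show ?thesis unfolding insert_iff fun_eq_iff by blast
      qed
      have "\<exists>p. f = (\<Sum>z\<in>{z1, z2, z3}. Const (p z) * lattice_binomial z)"
        by (rule toric_degree_span[OF E' m _ _ f]) (simp, rule cover, assumption+)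
      then obtain p where p: "f = (\<Sum>z\<in>{z1, z2, z3}. Const (p z) * lattice_binomial z)" by blast
      show ?thesis
      proof (cases "z3 \<in> {z1, z2}")
        case True
        then have "{z1, z2, z3} = {z1, z2}" by auto
        then have "f = Const (p z1) * B z1 + Const (p z2) * B z2" using p ne12 by (simp add: B_def)
        then show ?thesis using False
          by (intro exI[of _ "p z1"] exI[of _ "p z2"] exI[of _ 0]) (simp add: Const_simps)
      next
        case new: False
        then have "z1 \<noteq> z3" "z2 \<noteq> z3" by auto
        then have "f = Const (p z1) * B z1 + Const (p z2) * B z2 + Const (p z3) * B z3"
          using p ne12 by (simp add: B_def add.assoc)
        then show ?thesis using False by blast
      qed
    qed
    \<comment> \<open>A nonzero coefficient at \<open>B z3\<close> would express \<open>B z3\<close>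
      by the other two, so \<open>dep\<close> would hold and require that coefficient to be
      zero.\<close>
    have ind3: "a = 0 \<and> a' = 0 \<and> a'' = 0"
      if eq: "Const a * B z1 + Const a' * B z2 + Const a'' * B z3 = 0" and dp: "dep \<longrightarrow> a'' = 0" for a a' a''
    proof -
      have "a'' = 0"
      proof (rule ccontr)
        assume a'': "a'' \<noteq> 0"
        have "dep" unfolding dep_def
        proof (intro ballI impI)
          fix f :: "('v set, 'k) mpoly" assume f: "f \<in> toric E'" "homogeneous (int q) f"
          obtain c1 c2 c3 where c: "f = Const c1 * B z1 + Const c2 * B z2 + Const c3 * B z3"
            using span3[OF f] by blast
          define r where "r = c3 / a''"
          have "Const c3 * B z3 = Const r * (Const a'' * B z3)"
            using a'' by (simp add: r_def mult.assoc[symmetric] flip: Const_simps)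
          also have "Const a'' * B z3 = - (Const a * B z1 + Const a' * B z2)"
            using eq by (simp add: add_eq_0_iff add.commute)
          finally have c3: "Const c3 * B z3 = - (Const r * (Const a * B z1 + Const a' * B z2))"
            by (simp only: mult_minus_right)
          have "f = Const (c1 - r * a) * B z1 + Const (c2 - r * a') * B z2"
            unfolding c c3 by (simp add: Const_simps algebra_simps)
          then show "\<exists>a a'. f = Const a * B z1 + Const a' * B z2" by blast
        qed
        then show False using dp a'' by blast
      qed
      then show ?thesis using eq ind12 by (simp add: Const_simps)
    qed
    obtain P1 P2 P3 where P: "\<And>j. j < b \<Longrightarrow>
        R (F j) = Const (P1 j) * B z1 + Const (P2 j) * B z2 + Const (P3 j) * B z3"
        "\<And>j. j < b \<Longrightarrow> dep \<longrightarrow> P3 j = 0"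
    proof -
      have "\<exists>a a' a''. R (F j) = Const a * B z1 + Const a' * B z2 + Const a'' * B z3 \<and> (dep \<longrightarrow> a'' = 0)"
        if "j < b" for j using span3[OF RF[OF that]] .
      then show ?thesis using that by metis
    qed
    \<comment> \<open>The expansion uses the generators \<open>F\<close> of the large ideal, because
      the given syzygies are relations among these. Comparing degrees makes the coefficients
      constant.\<close>
    have Q: "\<exists>Q. f = (\<Sum>j<b. Const (Q j) * F j)" if f: "f \<in> toric E'" "homogeneous (int q) f" for f
    proof -
      obtain s where "f = (\<Sum>j<b. s j * F j)" using f toric_sub gen by blast
      with F(2) f(2) have "f = (\<Sum>j<b. Const (lookup (s j) 0) * F j)"
        by (intro homogeneous_combination_constant) auto
      then show ?thesis by (rule exI[of _ "\<lambda>j. lookup (s j) 0"])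
    qed
    obtain Q1 Q2 where Q1: "B z1 = (\<Sum>j<b. Const (Q1 j) * F j)" and Q2: "B z2 = (\<Sum>j<b. Const (Q2 j) * F j)"
      using Q[OF BT(1) Bh(1)] Q[OF BT(2) Bh(2)] by blast
    have R_Const: "R (Const a) = Const a" for a
      by (simp add: R_def restrict_vars_id Const_in_poly_ring)
    have PQ: "f = Const (\<Sum>j<b. P1 j * Q j) * B z1 + Const (\<Sum>j<b. P2 j * Q j) * B z2
        + Const (\<Sum>j<b. P3 j * Q j) * B z3"
      if "f \<in> toric E'" "f = (\<Sum>j<b. Const (Q j) * F j)" for f Q
    proof -
      have "f = R f" using R_id[OF that(1)] by simp
      also have "R f = (\<Sum>j<b. Const (Q j) * R (F j))" unfolding that(2) by (simp add: R R_Const)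
      also have "\<dots> = (\<Sum>j<b. Const (P1 j * Q j) * B z1 + Const (P2 j * Q j) * B z2 + Const (P3 j * Q j) * B z3)"
        by (intro sum.cong refl) (simp add: P Const_simps algebra_simps)
      also have "\<dots> = Const (\<Sum>j<b. P1 j * Q j) * B z1 + Const (\<Sum>j<b. P2 j * Q j) * B z2
        + Const (\<Sum>j<b. P3 j * Q j) * B z3"
        by (simp add: Const_sum sum_distrib_right sum.distrib)
      finally show ?thesis .
    qed
    \<comment> \<open>Expanding \<open>B z1\<close> in the generators and returning to coordinates
      must give the first unit vector.\<close>
    have PQ1: "(\<Sum>j<b. P1 j * Q1 j) = 1" "(\<Sum>j<b. P2 j * Q1 j) = 0" "(\<Sum>j<b. P3 j * Q1 j) = 0"
    proof -
      have "Const ((\<Sum>j<b. P1 j * Q1 j) - 1) * B z1 + Const (\<Sum>j<b. P2 j * Q1 j) * B z2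
        + Const (\<Sum>j<b. P3 j * Q1 j) * B z3 = 0"
        using PQ[OF BT(1) Q1] by (simp add: Const_simps algebra_simps)
      from ind3[OF this] P(2) show "(\<Sum>j<b. P1 j * Q1 j) = 1" "(\<Sum>j<b. P2 j * Q1 j) = 0" "(\<Sum>j<b. P3 j * Q1 j) = 0"
        by auto
    qed
    have PQ2: "(\<Sum>j<b. P1 j * Q2 j) = 0" "(\<Sum>j<b. P2 j * Q2 j) = 1" "(\<Sum>j<b. P3 j * Q2 j) = 0"
    proof -
      have "Const (\<Sum>j<b. P1 j * Q2 j) * B z1 + Const ((\<Sum>j<b. P2 j * Q2 j) - 1) * B z2
        + Const (\<Sum>j<b. P3 j * Q2 j) * B z3 = 0"
        using PQ[OF BT(2) Q2] by (simp add: Const_simps algebra_simps)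
      from ind3[OF this] P(2) show "(\<Sum>j<b. P1 j * Q2 j) = 0" "(\<Sum>j<b. P2 j * Q2 j) = 1" "(\<Sum>j<b. P3 j * Q2 j) = 0"
        by auto
    qed
    \<comment> \<open>The Koszul syzygy of \<open>B z1\<close> and \<open>B z2\<close>, written as a
      relation among the generators.\<close>
    define s where "s j = Const (Q1 j) * B z2 - Const (Q2 j) * B z1" for j
    have Bp: "B z1 \<in> poly_ring E'" "B z2 \<in> poly_ring E'" using BT by (auto simp: toric_def)
    have sp: "s j \<in> poly_ring E'" for j
      unfolding s_def by (intro poly_ring_simps Const_in_poly_ring Bp)
    have "(\<Sum>j<b. s j * F j) = B z2 * (\<Sum>j<b. Const (Q1 j) * F j) - B z1 * (\<Sum>j<b. Const (Q2 j) * F j)"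
      unfolding sum_distrib_left sum_subtractf[symmetric]
      by (intro sum.cong refl) (simp add: s_def algebra_simps)
    also have "\<dots> = 0" unfolding Q1[symmetric] Q2[symmetric] by simp
    finally have s0: "(\<Sum>j<b. s j * F j) = 0" .
    obtain w where w: "\<And>j. j < b \<Longrightarrow> s j = (\<Sum>k<c. w k * N k j)"
    proof -
      have "poly_ring E' \<subseteq> (poly_ring E :: ('v set, 'k) mpoly set)" using sub by (auto simp: poly_ring_def)
      then have "\<forall>j<b. s j \<in> poly_ring E" using sp by blast
      from syz[OF this s0] show ?thesis using that by blast
    qed
    \<comment> \<open>With \<open>P1\<close>, \<open>P2\<close>, \<open>P3\<close> for
      \<open>P\<close> these are the coefficients of syzygy \<open>k\<close>, restricted to the
      subgraph and rewritten in terms of the three binomials.\<close>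
    define l where "l P k = (\<Sum>j<b. Const (P j) * R (N k j))" for P k
    have l: "l P k \<in> poly_ring E'" "homogeneous 1 (l P k)" if "k < c" for P k
    proof -
      show "l P k \<in> poly_ring E'" unfolding l_def R_def
        by (intro poly_ring_sum poly_ring_simps Const_in_poly_ring restrict_vars_in_poly_ring)
      show "homogeneous 1 (l P k)" unfolding l_def R_def
        using homogeneous_mult[OF homogeneous_Const homogeneous_restrict_vars[OF N(1)[OF that]]]
        by (intro homogeneous_sum) simp
    qed
    have lsyz: "l P1 k * B z1 + l P2 k * B z2 + l P3 k * B z3 = 0" if "k < c" for k
    proof -
      have "0 = R (\<Sum>j<b. N k j * F j)" using N(2)[OF that] by (simp add: R_def restrict_vars_def eval_mpoly_def)
      also have "\<dots> = (\<Sum>j<b. R (N k j) * R (F j))" by (simp add: R)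
      also have "\<dots> = l P1 k * B z1 + l P2 k * B z2 + l P3 k * B z3"
        unfolding l_def sum_distrib_right sum.distrib[symmetric]
        by (intro sum.cong refl) (simp add: P algebra_simps)
      finally show ?thesis by simp
    qed
    \<comment> \<open>By \<open>PQ1\<close> and \<open>PQ2\<close> the Koszul syzygy has coordinates
      \<open>B z2\<close>, \<open>- B z1\<close> and 0.\<close>
    have koszul: "(\<Sum>k<c. R (w k) * l P k) = Const (\<Sum>j<b. P j * Q1 j) * B z2 - Const (\<Sum>j<b. P j * Q2 j) * B z1" for P
    proof -
      have "(\<Sum>k<c. R (w k) * l P k) = (\<Sum>k<c. \<Sum>j<b. Const (P j) * (R (w k) * R (N k j)))"
        by (simp add: l_def sum_distrib_left mult_ac)
      also have "\<dots> = (\<Sum>j<b. Const (P j) * R (\<Sum>k<c. w k * N k j))"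
        by (subst sum.swap) (simp add: R sum_distrib_left)
      also have "\<dots> = (\<Sum>j<b. Const (P j) * s j)"
        using sp w by (intro sum.cong refl) (simp add: R_def restrict_vars_id flip: w)
      also have "\<dots> = Const (\<Sum>j<b. P j * Q1 j) * B z2 - Const (\<Sum>j<b. P j * Q2 j) * B z1"
        unfolding Const_sum sum_distrib_right sum_subtractf[symmetric]
        by (intro sum.cong refl) (simp add: s_def Const_simps algebra_simps)
      finally show ?thesis .
    qed
    define C where "C l z = edge_map (l * single (pos_part z) 1)" for l :: "('v set, 'k) mpoly" and z
    have C: "C (l P1 k) z1 = C (l P3 k) z3" if "k < c" for k
      unfolding C_def
      by (rule linear_syzygy_on_triangle[OF E' m z1 z2(1) np _ z3_def lsyz[OF that, unfolded B_def]])
        (rule span)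
    have low: "f = 0" if "f \<in> poly_ring E'" "homogeneous 1 f" "edge_map f = 0" for f :: "('v set, 'k) mpoly"
      using toric_low_degree[OF E' m _ that(2)] that q by (simp add: toric_def)
    \<comment> \<open>By \<open>C\<close>, rows one and three have proportional images under
      \<open>edge_map\<close>, so their minors lie in the toric ideal. They have degree 2 < q and
      therefore vanish.\<close>
    have minor: "l P1 k * l P3 k' = l P3 k * l P1 k'" if kk: "k < c" "k' < c" for k k'
    proof -
      define D where "D = l P1 k * l P3 k' - l P3 k * l P1 k'"
      have "edge_map (D * single (pos_part z1) 1 * single (pos_part z3) 1)
          = C (l P1 k) z1 * C (l P3 k') z3 - C (l P3 k) z3 * C (l P1 k') z1"
        by (simp add: D_def C_def edge_map_mult edge_map_diff algebra_simps)
      also have "\<dots> = 0" using C[OF kk(1)] C[OF kk(2)] by simp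
      finally have "edge_map D = 0" by (rule edge_map_mult_single_eq_0[OF edge_map_mult_single_eq_0])
      moreover have "D \<in> poly_ring E'" unfolding D_def using l kk by (intro poly_ring_simps) auto
      moreover have "homogeneous (1 + 1) D" unfolding D_def
        by (intro homogeneous_simps homogeneous_mult l kk)
      ultimately have "D = 0" using toric_low_degree[OF E' m, of D 2] q by (simp add: toric_def)
      then show ?thesis by (simp add: D_def)
    qed
    \<comment> \<open>\<open>B z2\<close> is the first Koszul coordinate. The vanishing minors
      exchange it with the third coordinate, which is zero, and a binomial can be cancelled.\<close>
    have l3: "l P3 k = 0" if k: "k < c" for k
    proof -
      have "B z2 * l P3 k = (\<Sum>k'<c. R (w k') * l P1 k') * l P3 k" by (simp add: koszul PQ1 PQ2 Const_simps)
      also have "\<dots> = (\<Sum>k'<c. R (w k') * (l P1 k' * l P3 k))" by (simp add: sum_distrib_right mult.assoc)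
      also have "\<dots> = (\<Sum>k'<c. R (w k') * (l P3 k' * l P1 k))"
        using minor[OF _ k] by (intro sum.cong refl) simp
      also have "\<dots> = (\<Sum>k'<c. R (w k') * l P3 k') * l P1 k" by (simp add: sum_distrib_right mult.assoc)
      also have "\<dots> = 0" by (simp add: koszul PQ1 PQ2 Const_simps)
      finally have "l P3 k * (single (pos_part z2) 1 - single (neg_part z2) 1) = 0"
        by (simp add: B_def lattice_binomial_def mult.commute)
      then show ?thesis by (rule mult_binomial_eq_0) (rule pos_part_ne_neg_part[OF E'(1) z2(1) d2])
    qed
    \<comment> \<open>By \<open>C\<close> the image of the first entry also vanishes, and a linear
      form with image zero is zero because 1 < q.\<close>
    have l1: "l P1 k = 0" if k: "k < c" for k
    proof -
      have "C (l P1 k) z1 = 0" using C[OF k] l3[OF k] by (simp add: C_def edge_map_mult edge_map_eq)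
      then have "edge_map (l P1 k) = 0" unfolding C_def by (rule edge_map_mult_single_eq_0)
      then show ?thesis using low l[OF k] by blast
    qed
    \<comment> \<open>The nonzero first Koszul coordinate is now a combination of zeros.\<close>
    have "B z2 = (\<Sum>k<c. R (w k) * l P1 k)" by (simp add: koszul PQ1 PQ2 Const_simps)
    also have "\<dots> = 0" using l1 by simp
    finally have "Const 0 * B z1 + Const 1 * B z2 = 0" by (simp add: Const_simps)
    from ind12[OF this] show False by simp
  qed
qed

lemma linear_resolution_cyclic:
  assumes E: "finite E" "\<forall>e\<in>E. card e = 2" and q: "q \<ge> 3"
    and lin: "has_linear_resolution E (toric E :: ('v set, 'k::field) mpoly set) q"
    and no_C4: "\<And>a b c d. min_norm E (2 * int q) \<Longrightarrow> distinct [a, b, c, d] \<Longrightarrow>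
      {{a, b}, {b, c}, {c, d}, {d, a}} \<subseteq> E \<Longrightarrow> False"
  shows "\<exists>y\<in>edge_lattice E. norm1 E y = 2 * int q \<and> (\<forall>z\<in>edge_lattice E. \<exists>k. \<forall>e. z e = k * y e)"
proof -
  have "\<not> independent_pair E"
    by (rule linear_resolution_not_independent[OF E q lin]) (rule no_C4)
  then have prp: "\<not> nonproportional y z" if "y \<in> edge_lattice E" "z \<in> edge_lattice E" for y z
    using that unfolding independent_pair_def nonproportional_def by blast
  obtain b c F N where pres: "linear_presentation E (toric E :: ('v set, 'k) mpoly set) q b c F N"
    using linear_resolution_presentation[OF lin] by blast
  have F: "\<And>j. j < b \<Longrightarrow> F j \<in> poly_ring E" "\<And>j. j < b \<Longrightarrow> homogeneous (int q) (F j)"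
    and gen: "toric E = {\<Sum>j<b. s j * F j | s. \<forall>j<b. s j \<in> poly_ring E}"
    using pres unfolding linear_presentation_def by simp_all
  have gen': "\<exists>s. f = (\<Sum>j<b. s j * F j)" if "f \<in> toric E" for f
    using that unfolding gen by blast
  have FE: "F j \<in> toric E" if "j < b" for j
    by (rule linear_presentation_generator[OF pres that])
  have m: "min_norm E (2 * int q)"
    using gen' q by (intro min_norm_if_generated[OF E _ F(2)]) auto
  \<comment> \<open>Without vectors of norm 2q all generators vanish, but the notion of a linear
    resolution excludes the zero ideal.\<close>
  have "\<exists>y\<in>edge_lattice E. norm1 E y = 2 * int q"
  proof (rule ccontr)
    assume no: "\<not> ?thesis"
    have "F j = 0" if "j < b" for j
      using toric_degree_span[OF E m, of "{}" "F j"] no FE[OF that] F(2)[OF that] by auto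
    then have "toric E \<subseteq> {0 :: ('v set, 'k) mpoly}" using gen' by fastforce
    moreover have "0 \<in> toric E" by (simp add: toric_def poly_ring_simps edge_map_eq)
    ultimately show False using lin by (auto simp: has_linear_resolution_def)
  qed
  then obtain y where y: "y \<in> edge_lattice E" "norm1 E y = 2 * int q" by blast
  have short: "z = y \<or> (\<lambda>e. - z e) = y" if "z \<in> edge_lattice E" "norm1 E z = 2 * int q" for z
    by (rule proportional_same_norm[OF prp[OF y(1) that(1)], of E]) (use that(2) y(2) q in simp_all)
  have "\<exists>k. \<forall>e. z e = k * y e" if z: "z \<in> edge_lattice E" for z
    by (rule toric_principal_cyclic[OF E m FE F(2) gen' y(1) short z]) assumption+
  then show ?thesis using y by blast
qed

section \<open>The resolution of a principal toric ideal\<close>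

lemma monomial_difference_multiple:
  fixes y :: "'v set \<Rightarrow> int" and n :: nat
  assumes E: "finite E" "\<forall>e\<in>E. card e = 2" and y: "y \<in> edge_lattice E"
    and t: "keys t \<subseteq> E" "\<And>e. mon_diff t u e = int n * y e"
  shows "\<exists>s\<in>poly_ring E. single t 1 - single u 1 = (s * lattice_binomial y :: ('v set, 'k::field) mpoly)"
  using t
proof (induction n arbitrary: t)
  case 0
  then have "t = u" using mon_diff_self_eq_0_iff[of t u] by simp
  then show ?case by (intro bexI[of _ 0]) (auto simp: poly_ring_simps)
next
  case (Suc n)
  \<comment> \<open>Since the difference contains \<open>y\<close> at least once, the positive
    monomial of \<open>y\<close> divides \<open>t\<close>. Replacing it by the negative one uses up
    one copy of \<open>y\<close>, and the binomial differences telescope.\<close>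
  define r where "r = t - pos_part y"
  have ge: "lookup (pos_part y) e \<le> lookup t e" for e
  proof (cases "y e > 0")
    case True
    have "y e \<le> int (Suc n) * y e" using True by simp
    also have "\<dots> \<le> int (lookup t e)" using Suc.prems(2)[of e] by (simp add: mon_diff_def)
    finally show ?thesis using y by (simp add: lookup_pos_part[OF E(1)])
  qed (use y in \<open>simp add: lookup_pos_part[OF E(1)]\<close>)
  have t: "t = r + pos_part y"
    using ge by (intro poly_mapping_eqI) (simp add: r_def lookup_add lookup_minus)
  have rE: "keys r \<subseteq> E"
  proof
    fix e assume "e \<in> keys r"
    then have "e \<in> keys t" by (simp add: t in_keys_iff lookup_add)
    then show "e \<in> E" using Suc.prems(1) by blast
  qed
  define t' where "t' = r + neg_part y"
  have "keys t' \<subseteq> E"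
    using rE keys_pos_part(2)[OF E(1) y] Poly_Mapping.keys_add[of r "neg_part y"] by (auto simp: t'_def)
  moreover have "mon_diff t' u e = int n * y e" for e
  proof -
    have "mon_diff t u e = mon_diff t' u e + y e"
      using y by (simp add: t t'_def mon_diff_def lookup_add lookup_pos_part[OF E(1)])
    then show ?thesis using Suc.prems(2)[of e] by (simp add: algebra_simps)
  qed
  ultimately obtain s where s: "s \<in> poly_ring E"
    "single t' 1 - single u 1 = (s * lattice_binomial y :: ('v set, 'k) mpoly)"
    using Suc.IH by blast
  have "single r 1 * lattice_binomial y = (single t 1 - single t' 1 :: ('v set, 'k) mpoly)"
    by (simp add: lattice_binomial_def right_diff_distrib mult_single t t'_def)
  then have "single t 1 - single u 1 = (single r 1 + s) * (lattice_binomial y :: ('v set, 'k) mpoly)"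
    unfolding distrib_right s(2)[symmetric] by simp
  moreover have "single r 1 + s \<in> poly_ring E" using s(1) rE by (intro poly_ring_simps)
  ultimately show ?case by blast
qed

text \<open>Two terms of \<open>f\<close> in one fibre differ by a multiple of \<open>y\<close>, and
  by telescoping the difference of their monomials is a multiple of the binomial. Subtracting it
  shortens \<open>f\<close>.\<close>

lemma toric_principal:
  fixes f :: "('v set, 'k::field) mpoly"
  assumes E: "finite E" "\<forall>e\<in>E. card e = 2" and y: "y \<in> edge_lattice E"
    and cyc: "\<And>z. z \<in> edge_lattice E \<Longrightarrow> \<exists>k. \<forall>e. z e = k * y e"
    and f: "f \<in> toric E"
  shows "\<exists>s\<in>poly_ring E. f = s * lattice_binomial y"
  using f
proof (induction "card (keys f)" arbitrary: f rule: less_induct)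
  case less
  show ?case
  proof (cases "f = 0")
    case True
    then show ?thesis by (intro bexI[of _ 0]) (auto simp: poly_ring_simps)
  next
    case False
    then obtain t where t: "t \<in> keys f" by (metis keys_eq_empty ex_in_conv)
    obtain u where u: "u \<in> keys f" "u \<noteq> t" "vertex_degree u = vertex_degree t"
      by (rule toric_other_monomial[OF less.prems t])
    have tu: "keys t \<subseteq> E" "keys u \<subseteq> E" using less.prems t u(1) by (auto simp: toric_def poly_ring_def)
    have L: "mon_diff t u \<in> edge_lattice E"
      using u(3) vertex_degree_eq_iff[OF E, of t u] tu by simp
    obtain k where k: "\<And>e. mon_diff t u e = k * y e" using cyc[OF L] by blast
    have "\<exists>s\<in>poly_ring E. single t 1 - single u 1 = (s * lattice_binomial y :: ('v set, 'k) mpoly)"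
    proof (cases "k \<ge> 0")
      case True
      then show ?thesis
        using monomial_difference_multiple[OF E y tu(1), of u "nat k"] k by simp
    next
      case False
      have "mon_diff u t e = int (nat (- k)) * y e" for e
        using False k[of e] mon_diff_uminus[of u t e] by simp
      then obtain s where s: "s \<in> poly_ring E"
        "single u 1 - single t 1 = (s * lattice_binomial y :: ('v set, 'k) mpoly)"
        using monomial_difference_multiple[OF E y tu(2)] by blast
      have "single t 1 - single u 1 = - (single u 1 - single t 1 :: ('v set, 'k) mpoly)" by simp
      also have "\<dots> = (- s) * lattice_binomial y" by (simp only: s(2) mult_minus_left)
      finally show ?thesis using poly_ring_simps(5)[OF s(1)] by blast
    qed
    then obtain s where s: "s \<in> poly_ring E"
      "single t 1 - single u 1 = (s * lattice_binomial y :: ('v set, 'k) mpoly)" by blast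
    define c where "c = lookup f t"
    define g where "g = f - (single t c - single u c)"
    have "keys g \<subseteq> keys f - {t}"
    proof
      fix r assume "r \<in> keys g"
      then have "lookup f r - (lookup (single t c) r - lookup (single u c) r) \<noteq> 0"
        by (simp add: g_def in_keys_iff lookup_minus)
      then show "r \<in> keys f - {t}"
        using t u by (auto simp: lookup_single when_def c_def in_keys_iff split: if_splits)
    qed
    then have "card (keys g) < card (keys f)"
      using t by (metis card_Diff1_less card_mono finite_Diff finite_keys le_less_trans)
    moreover have "g \<in> toric E"
      using less.prems single_minus_single_in_toric[OF tu u(3)[symmetric], of c]
      by (auto simp: g_def toric_def edge_map_diff intro: poly_ring_simps)
    ultimately obtain s' where s': "s' \<in> poly_ring E" "g = s' * lattice_binomial y"
      using less.hyps by blast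
    have "single t c - single u c = Const c * (single t 1 - single u 1)"
      by (simp add: Const_def right_diff_distrib mult_single)
    then have "f = (s' + Const c * s) * lattice_binomial y"
      using s' s(2) by (simp add: g_def algebra_simps)
    moreover have "s' + Const c * s \<in> poly_ring E"
      using s s' by (intro poly_ring_simps Const_in_poly_ring)
    ultimately show ?thesis by blast
  qed
qed

text \<open>The resolution is 0 \<rightarrow> S(-q) \<rightarrow> S: cancellation of
  \<open>f\<close> gives exactness, and q > 0 gives minimality.\<close>

lemma principal_linear_resolution:
  fixes f :: "('x, 'k::field) mpoly"
  assumes q: "q > 0" and f: "f \<in> poly_ring X" "homogeneous (int q) f" "f \<noteq> 0"
    and inj: "\<And>g. g * f = 0 \<Longrightarrow> g = 0"
    and I: "I = (\<lambda>g. g * f) ` poly_ring X"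
  shows "has_linear_resolution X I q"
proof -
  define Fs where "Fs i = (if i = 0 then [0] else if i = Suc 0 then [int q] else [])" for i :: nat
  \<comment> \<open>All later differentials start from the zero module, so they are matrices without
    columns.\<close>
  define M where "M i = (if i = Suc 0 then mat 1 1 (\<lambda>_. f) else mat (length (Fs (i - 1))) 0 (\<lambda>_. 0))" for i :: nat
  have Mf: "mat 1 1 (\<lambda>_. f) *\<^sub>v v = vec 1 (\<lambda>_. v $ 0 * f)" if "dim_vec v = 1" for v
    using that by (intro eq_vecI) (auto simp: scalar_prod_def mult.commute)
  have M0: "mat n 0 (\<lambda>_. 0) *\<^sub>v v = 0\<^sub>v n" if "dim_vec v = 0" for v :: "('x, 'k) mpoly vec" and n
    using that by (intro eq_vecI) (auto simp: scalar_prod_def)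
  have free0: "free_module X [] = {vNil :: ('x, 'k) mpoly vec}"
    by (auto simp: free_module_def)
  have free1: "free_module X [int q] = (\<lambda>g :: ('x, 'k) mpoly. vec 1 (\<lambda>_. g)) ` poly_ring X"
  proof (intro equalityI subsetI)
    fix v :: "('x, 'k) mpoly vec" assume "v \<in> free_module X [int q]"
    then have "v = vec 1 (\<lambda>_. v $ 0)" "v $ 0 \<in> poly_ring X"
      by (auto simp: free_module_def intro!: eq_vecI)
    then show "v \<in> (\<lambda>g. vec 1 (\<lambda>_. g)) ` poly_ring X" by blast
  qed (auto simp: free_module_def)
  have hom: "M i \<in> graded_hom X (Fs i) (Fs (i - 1))" if "i \<ge> 1" for i
    using that f by (auto simp: graded_hom_def M_def Fs_def)
  have image0: "hom_image X (Fs i) (M i) = {0\<^sub>v (length (Fs (i - 1)))}" if "i \<ge> 2" for i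
    using that M0 by (simp add: hom_image_def Fs_def M_def free0)
  have ker: "hom_kernel X (Fs i) (M i) = hom_image X (Fs (i + 1)) (M (i + 1))" if "i \<ge> 1" for i
  proof (cases "i = 1")
    case True
    have "v = 0\<^sub>v 1" if v: "v \<in> hom_kernel X [int q] (mat 1 1 (\<lambda>_. f))" for v
    proof -
      obtain g where g: "v = vec 1 (\<lambda>_. g)" using v unfolding hom_kernel_def free1 by blast
      have "vec 1 (\<lambda>_. g * f) = 0\<^sub>v 1" using v Mf[of v] by (simp add: hom_kernel_def g)
      then have "vec 1 (\<lambda>_. g * f) $ 0 = 0\<^sub>v 1 $ 0" by simp
      then have "g = 0" using inj by simp
      then show ?thesis by (simp add: g zero_vec_def)
    qed
    moreover have "0\<^sub>v 1 \<in> hom_kernel X [int q] (mat 1 1 (\<lambda>_. f))"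
      by (auto simp: hom_kernel_def free_module_def poly_ring_simps intro!: eq_vecI)
    ultimately have "hom_kernel X [int q] (mat 1 1 (\<lambda>_. f)) = {0\<^sub>v 1}" by blast
    then show ?thesis using True image0[of 2] by (simp add: Fs_def M_def numeral_2_eq_2)
  next
    case False
    then have "i \<ge> 2" using that by simp
    then have "hom_kernel X (Fs i) (M i) = {vNil}"
      using M0 by (auto simp: hom_kernel_def Fs_def M_def free0)
    then show ?thesis using image0[of "i + 1"] \<open>i \<ge> 2\<close> by (simp add: Fs_def)
  qed
  have image: "(\<lambda>v. v $ 0) ` hom_image X (Fs 1) (M 1) = I"
  proof -
    have "hom_image X (Fs 1) (M 1) = (\<lambda>g. mat 1 1 (\<lambda>_. f) *\<^sub>v vec 1 (\<lambda>_. g)) ` poly_ring X"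
      unfolding hom_image_def by (simp add: Fs_def M_def free1[unfolded One_nat_def] image_image)
    also have "\<dots> = (\<lambda>g. vec 1 (\<lambda>_. g * f)) ` poly_ring X"
      by (intro image_cong refl) (simp only: Mf dim_vec, simp)
    finally show ?thesis by (simp add: I image_image)
  qed
  have "lookup f 0 = 0"
  proof (rule ccontr)
    assume "lookup f 0 \<noteq> 0"
    then have "0 \<in> keys f" by (simp add: in_keys_iff)
    then have "int (mon_degree (0 :: 'x \<Rightarrow>\<^sub>0 nat)) = int q" using f(2) by (simp add: homogeneous_def)
    then show False using q by (simp add: mon_degree_def)
  qed
  then have minimal: "lookup (M i $$ (k, l)) 0 = 0"
    if "i \<ge> 1" "k < length (Fs (i - 1))" "l < length (Fs i)" for i k l
    using that by (auto simp: M_def Fs_def split: if_splits)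
  have "graded_minimal_free_resolution X I 1 Fs M"
    unfolding graded_minimal_free_resolution_def using hom image ker minimal by (auto simp: Fs_def)
  moreover have "count_list (Fs i) j = 0" if "i \<in> {1..1}" "j \<noteq> int q + int i - 1" for i j
    using that by (auto simp: Fs_def)
  moreover have "I \<noteq> {0}"
  proof -
    have "1 * f \<in> I" unfolding I by (intro imageI) (simp add: poly_ring_def)
    then show ?thesis using f(3) by auto
  qed
  ultimately show ?thesis unfolding has_linear_resolution_def by blast
qed

lemma cyclic_linear_resolution:
  assumes E: "finite E" "\<forall>e\<in>E. card e = 2" and q: "q > 0"
    and y: "y \<in> edge_lattice E" "norm1 E y = 2 * int q"
    and cyc: "\<And>z. z \<in> edge_lattice E \<Longrightarrow> \<exists>k. \<forall>e. z e = k * y e"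
  shows "has_linear_resolution E (toric E :: ('v set, 'k::field) mpoly set) q"
proof -
  let ?f = "lattice_binomial y :: ('v set, 'k) mpoly"
  have "\<exists>d. y d \<noteq> 0"
  proof (rule ccontr)
    assume "\<nexists>d. y d \<noteq> 0"
    then show False using y(2) q by (simp add: norm1_def)
  qed
  then obtain d where "y d \<noteq> 0" by blast
  then have ne: "pos_part y \<noteq> neg_part y" by (rule pos_part_ne_neg_part[OF E(1) y(1)])
  have inj: "g = 0" if "g * ?f = 0" for g
    using mult_binomial_eq_0[OF that[unfolded lattice_binomial_def] ne] .
  have f: "?f \<in> toric E" by (rule lattice_binomial_in_toric[OF E y(1)])
  show ?thesis
  proof (rule principal_linear_resolution[OF q _ _ _ inj])
    show "?f \<in> poly_ring E" using f by (simp add: toric_def)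
    show "homogeneous (int q) ?f" by (rule homogeneous_lattice_binomial[OF E y])
    show "?f \<noteq> 0" using inj[of 1] by auto
    show "toric E = (\<lambda>g. g * ?f) ` poly_ring E"
    proof (intro equalityI subsetI)
      fix h assume "h \<in> (\<lambda>g. g * ?f) ` poly_ring E"
      then show "h \<in> toric E" using f by (auto simp: toric_def edge_map_mult intro: poly_ring_simps)
    qed (use toric_principal[OF E y(1) cyc] in blast)
  qed
qed

section \<open>Walks and cycles\<close>

fun walk_edges :: "'v list \<Rightarrow> 'v set list" where
  "walk_edges (x # y # w) = {x, y} # walk_edges (y # w)"
| "walk_edges _ = []"

text \<open>The signs alternate along the walk, starting with +1, and contributions of a repeated
  edge are added.\<close>

fun alternating :: "'v list \<Rightarrow> 'v set \<Rightarrow> int" where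
  "alternating (x # y # w) e = of_bool (e = {x, y}) - alternating (y # w) e"
| "alternating _ e = 0"

lemma length_walk_edges: "length (walk_edges w) = length w - 1"
  by (induction w rule: walk_edges.induct) auto

lemma walk_edges_Cons: "w \<noteq> [] \<Longrightarrow> walk_edges (x # w) = {x, hd w} # walk_edges w"
  by (cases w) auto

lemma walk_edges_append:
  "p \<noteq> [] \<Longrightarrow> q \<noteq> [] \<Longrightarrow> walk_edges (p @ q) = walk_edges p @ {last p, hd q} # walk_edges q"
proof (induction p rule: walk_edges.induct)
  case ("2_2" x)
  then show ?case by (simp add: walk_edges_Cons)
qed auto

lemma walk_edges_snoc: "w \<noteq> [] \<Longrightarrow> walk_edges (w @ [x]) = walk_edges w @ [{last w, x}]"
  by (simp add: walk_edges_append)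

lemma walk_edges_rev: "walk_edges (rev w) = rev (walk_edges w)"
proof (induction w)
  case (Cons x w)
  then show ?case
    by (cases "w = []") (auto simp: walk_edges_snoc walk_edges_Cons last_rev insert_commute)
qed simp

lemma walk_edges_subset: "e \<in> set (walk_edges w) \<Longrightarrow> e \<subseteq> set w"
  by (induction w rule: walk_edges.induct) auto

lemma walk_edges_split:
  assumes "e \<in> set (walk_edges w)"
  obtains xs ys where "w = xs @ ys" "xs \<noteq> []" "ys \<noteq> []" "e = {last xs, hd ys}"
  using assms
proof (induction w arbitrary: thesis rule: walk_edges.induct)
  case (1 x y w)
  show ?case
  proof (cases "e = {x, y}")
    case True
    then show ?thesis using "1.prems"(1)[of "[x]" "y # w"] by simp
  next
    case False
    then have "e \<in> set (walk_edges (y # w))" using "1.prems"(2) by simp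
    then obtain xs ys where "y # w = xs @ ys" "xs \<noteq> []" "ys \<noteq> []" "e = {last xs, hd ys}"
      using "1.IH" by blast
    then show ?thesis using "1.prems"(1)[of "x # xs" ys] by simp
  qed
qed auto

lemma distinct_walk_edges: "distinct w \<Longrightarrow> distinct (walk_edges w)"
proof (induction w rule: walk_edges.induct)
  case (1 x y w)
  then have "{x, y} \<notin> set (walk_edges (y # w))" using walk_edges_subset[of "{x, y}" "y # w"] by auto
  then show ?case using 1 by simp
qed auto

lemma path_edges_eq: "path_edges p = set (walk_edges p)"
proof (induction p rule: walk_edges.induct)
  case (1 x y w)
  have "path_edges (x # y # w) = insert {x, y} (path_edges (y # w))"
  proof (intro equalityI subsetI)
    fix e assume "e \<in> path_edges (x # y # w)"
    then obtain i where i: "i + 1 < length (x # y # w)" "e = {(x # y # w) ! i, (x # y # w) ! (i + 1)}"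
      by (auto simp: path_edges_def)
    then show "e \<in> insert {x, y} (path_edges (y # w))"
      by (cases i) (auto simp: path_edges_def)
  next
    fix e assume "e \<in> insert {x, y} (path_edges (y # w))"
    then consider "e = {x, y}" | i where "i + 1 < length (y # w)" "e = {(y # w) ! i, (y # w) ! (i + 1)}"
      by (auto simp: path_edges_def)
    then show "e \<in> path_edges (x # y # w)"
    proof cases
      case 1 then show ?thesis by (auto simp: path_edges_def intro!: exI[of _ 0])
    next
      case (2 i) then show ?thesis by (auto simp: path_edges_def intro!: exI[of _ "Suc i"])
    qed
  qed
  then show ?case using 1 by simp
qed (auto simp: path_edges_def)

text \<open>Successive edges have opposite signs, so the contributions at inner vertices of the walk
  cancel. A closed walk gives 0 if it has an even number of edges, and 2 at its base point
  otherwise.\<close>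

lemma alternating_boundary:
  assumes "finite E" "\<forall>e\<in>E. card e = 2" "set (walk_edges w) \<subseteq> E" "w \<noteq> []"
  shows "(\<Sum>e | e \<in> E \<and> v \<in> e. alternating w e)
    = of_bool (v = hd w) - (-1) ^ (length w - 1) * of_bool (v = last w)"
  using assms(3,4)
proof (induction w rule: walk_edges.induct)
  case (1 x y w)
  have xy: "{x, y} \<in> E" "x \<noteq> y" using 1 assms(2) by (auto dest: bspec[of _ _ "{x, y}"])
  have fin: "finite {e. e \<in> E \<and> v \<in> e}" using assms(1) by simp
  have "(\<Sum>e | e \<in> E \<and> v \<in> e. of_bool (e = {x, y}) :: int)
      = (\<Sum>e | e \<in> E \<and> v \<in> e. if e = {x, y} then 1 else 0)"
    by (intro sum.cong) auto
  also have "\<dots> = of_bool (v = x) + of_bool (v = y)"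
    using sum.delta[OF fin, of "{x, y}" "\<lambda>_. 1::int"] xy by auto
  finally show ?case using 1 by (simp add: sum_subtractf)
qed auto

lemma alternating_outside: "e \<notin> set (walk_edges w) \<Longrightarrow> alternating w e = 0"
  by (induction w rule: walk_edges.induct) auto

lemma abs_alternating:
  "distinct (walk_edges w) \<Longrightarrow> \<bar>alternating w e\<bar> = of_bool (e \<in> set (walk_edges w))"
  by (induction w rule: walk_edges.induct) (auto simp: alternating_outside)

section \<open>Cycles as vertex lists\<close>

definition cycle_edges :: "'v list \<Rightarrow> 'v set list" where
  "cycle_edges c = walk_edges (c @ [hd c])"

text \<open>The first vertex is not repeated at the end, so the length of the list is the length of
  the cycle; rotations of the list describe the same cycle.\<close>

definition is_cycle :: "'v set set \<Rightarrow> 'v list \<Rightarrow> bool" where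
  "is_cycle E c \<longleftrightarrow> length c \<ge> 3 \<and> distinct c \<and> set (cycle_edges c) \<subseteq> E"

lemma is_cycle_mono: "is_cycle E c \<Longrightarrow> E \<subseteq> E' \<Longrightarrow> is_cycle E' c"
  by (auto simp: is_cycle_def)

lemma cycle_edges_eq: "c \<noteq> [] \<Longrightarrow> cycle_edges c = walk_edges c @ [{last c, hd c}]"
  by (simp add: cycle_edges_def walk_edges_snoc)

lemma length_cycle_edges: "length (cycle_edges c) = length c"
  by (simp add: cycle_edges_def length_walk_edges)

lemma cycle_edges_subset: "e \<in> set (cycle_edges c) \<Longrightarrow> e \<subseteq> set c"
  using walk_edges_subset[of e c] by (cases "c = []") (auto simp: cycle_edges_eq, simp add: cycle_edges_def)

text \<open>For two vertices the closing edge would repeat the only edge of the path.\<close>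

lemma closing_edge_notin_walk_edges:
  assumes "distinct c" "length c \<ge> 3"
  shows "{last c, hd c} \<notin> set (walk_edges c)"
proof
  assume a: "{last c, hd c} \<in> set (walk_edges c)"
  obtain x y z w where c: "c = x # y # z # w" using assms(2)
    by (metis One_nat_def Suc_1 Suc_le_length_iff numeral_3_eq_3)
  have "{last c, x} \<noteq> {x, y}" using assms(1) c by (auto simp: doubleton_eq_iff split: if_splits)
  then have "{last c, x} \<in> set (walk_edges (y # z # w))" using a c by auto
  then have "x \<in> set (y # z # w)" using walk_edges_subset by fastforce
  then show False using assms(1) c by auto
qed

lemma distinct_cycle_edges: "distinct c \<Longrightarrow> length c \<ge> 3 \<Longrightarrow> distinct (cycle_edges c)"
  using closing_edge_notin_walk_edges[of c] distinct_walk_edges[of c]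
  by (subst cycle_edges_eq) auto

lemma cycle_edges_rotate:
  assumes "xs \<noteq> []" "ys \<noteq> []"
  shows "set (cycle_edges (xs @ ys)) = set (cycle_edges (ys @ xs))"
  using assms by (auto simp: cycle_edges_eq walk_edges_append)

lemma is_cycle_rotate:
  assumes "xs \<noteq> []" "ys \<noteq> []" "is_cycle E (xs @ ys)"
  shows "is_cycle E (ys @ xs)"
  using assms(3) cycle_edges_rotate[OF assms(1,2)] by (auto simp: is_cycle_def)

lemma rotate_cycle_vertex:
  assumes "is_cycle E c" "v \<in> set c"
  obtains c' where "is_cycle E c'" "hd c' = v" "set c' = set c" "length c' = length c"
    "set (cycle_edges c') = set (cycle_edges c)"
proof -
  obtain xs ys where c: "c = xs @ v # ys" using assms(2) by (meson split_list)
  show ?thesis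
  proof (cases "xs = []")
    case True
    then show ?thesis using that[of c] assms(1) c by simp
  next
    case False
    then show ?thesis
      using that[of "(v # ys) @ xs"] is_cycle_rotate[of xs "v # ys" E] cycle_edges_rotate[of xs "v # ys"]
        assms(1) c by auto
  qed
qed

lemma rotate_cycle_edge:
  assumes "is_cycle E c" "f \<in> set (cycle_edges c)"
  obtains c' where "is_cycle E c'" "{last c', hd c'} = f" "set c' = set c" "length c' = length c"
    "set (cycle_edges c') = set (cycle_edges c)"
proof -
  have "c \<noteq> []" using assms(1) by (auto simp: is_cycle_def)
  then consider "f = {last c, hd c}" | "f \<in> set (walk_edges c)" using assms(2) by (auto simp: cycle_edges_eq)
  then show ?thesis
  proof cases
    case 1
    then show ?thesis using that[of c] assms(1) by simp
  next
    case 2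
    obtain xs ys where s: "c = xs @ ys" "xs \<noteq> []" "ys \<noteq> []" "f = {last xs, hd ys}"
      by (rule walk_edges_split[OF 2])
    then show ?thesis
      using that[of "ys @ xs"] is_cycle_rotate[of xs ys E] cycle_edges_rotate[of xs ys] assms(1) by auto
  qed
qed

lemma cycle_of_length_iff:
  "cycle_of_length C r \<longleftrightarrow>
     (\<exists>c. distinct c \<and> length c = r \<and> r \<ge> 3 \<and> C = (set c, set (cycle_edges c)))"
proof -
  have eq: "{{c ! i, c ! ((i + 1) mod r)} | i. i < r} = set (cycle_edges c)"
    if c: "length c = r" "r \<ge> 3" for c :: "'a list"
  proof -
    have *: "{(c @ [hd c]) ! i, (c @ [hd c]) ! (i + 1)} = {c ! i, c ! ((i + 1) mod r)}" if "i < r" for i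
    proof (cases "i + 1 < r")
      case True
      then show ?thesis using c by (simp add: nth_append)
    next
      case False
      then have "i + 1 = r" using that by simp
      moreover have "hd c = c ! 0" using c by (intro hd_conv_nth) auto
      ultimately show ?thesis using c that by (auto simp: nth_append)
    qed
    have "set (cycle_edges c) = {{(c @ [hd c]) ! i, (c @ [hd c]) ! (i + 1)} | i. i < r}"
      using c by (simp add: cycle_edges_def path_edges_eq[symmetric] path_edges_def)
    also have "\<dots> = {{c ! i, c ! ((i + 1) mod r)} | i. i < r}"
      using * by (metis (no_types, lifting))
    finally show ?thesis by simp
  qed
  show ?thesis
  proof
    assume "cycle_of_length C r"
    then obtain c where c: "r \<ge> 3" "distinct c" "length c = r" "verts C = set c"
      "edges C = {{c ! i, c ! ((i + 1) mod r)} | i. i < r}" unfolding cycle_of_length_def by blast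
    then have "C = (set c, set (cycle_edges c))" using eq[OF c(3,1)] by (simp add: prod_eq_iff)
    then show "\<exists>c. distinct c \<and> length c = r \<and> r \<ge> 3 \<and> C = (set c, set (cycle_edges c))"
      using c(1-3) by blast
  next
    assume "\<exists>c. distinct c \<and> length c = r \<and> r \<ge> 3 \<and> C = (set c, set (cycle_edges c))"
    then obtain c where c: "distinct c" "length c = r" "r \<ge> 3" "C = (set c, set (cycle_edges c))" by blast
    then show "cycle_of_length C r"
      unfolding cycle_of_length_def using eq[OF c(2,3)] by (intro conjI exI[of _ c]) simp_all
  qed
qed

section \<open>Lattice vectors carried by cycles\<close>

lemma even_cycle_vector:
  assumes E: "finite E" "\<forall>e\<in>E. card e = 2" and c: "is_cycle E c" "even (length c)"
  shows "\<exists>z\<in>edge_lattice E. norm1 E z = int (length c) \<and> (\<forall>e. \<bar>z e\<bar> = of_bool (e \<in> set (cycle_edges c)))"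
proof -
  define w where "w = c @ [hd c]"
  have w: "set (walk_edges w) \<subseteq> E" "w \<noteq> []" "distinct (walk_edges w)" "hd w = last w" "length w = length c + 1"
    using c(1) distinct_cycle_edges[of c] by (auto simp: w_def is_cycle_def cycle_edges_def hd_append)
  have abs: "\<bar>alternating w e\<bar> = of_bool (e \<in> set (cycle_edges c))" for e
    using abs_alternating[OF w(3)] by (simp add: w_def cycle_edges_def)
  have "alternating w \<in> edge_lattice E"
    using w c(2) alternating_boundary[OF E w(1,2)] alternating_outside[of _ w]
    by (auto simp: edge_lattice_def)
  moreover have "norm1 E (alternating w) = int (length c)"
  proof -
    have "norm1 E (alternating w) = (\<Sum>e\<in>E. of_bool (e \<in> set (cycle_edges c)))"
      unfolding norm1_def abs by simp
    also have "\<dots> = int (card (E \<inter> set (cycle_edges c)))" using E(1) by (simp add: sum_of_bool_eq)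
    also have "E \<inter> set (cycle_edges c) = set (cycle_edges c)" using c(1) by (auto simp: is_cycle_def)
    also have "card \<dots> = length c"
      using distinct_card[OF distinct_cycle_edges[of c]] c(1) by (simp add: is_cycle_def length_cycle_edges)
    finally show ?thesis .
  qed
  ultimately show ?thesis using abs by blast
qed

text \<open>The alternating vector of a 4-cycle has norm only 4.\<close>

lemma no_four_cycle:
  assumes E: "finite E" "\<forall>e\<in>E. card e = 2" and m: "min_norm E m" "m > 4"
    and abcd: "distinct [a, b, c, d]" "{{a, b}, {b, c}, {c, d}, {d, a}} \<subseteq> E"
  shows False
proof -
  have "is_cycle E [a, b, c, d]" using abcd by (auto simp: is_cycle_def cycle_edges_def)
  then obtain z where z: "z \<in> edge_lattice E" "norm1 E z = int (length [a, b, c, d])"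
    "\<forall>e. \<bar>z e\<bar> = of_bool (e \<in> set (cycle_edges [a, b, c, d]))"
    using even_cycle_vector[OF E, of "[a, b, c, d]"] by auto
  have "z {a, b} \<noteq> 0" using z(3)[rule_format, of "{a, b}"] by (auto simp: cycle_edges_def)
  then show False using min_normD[OF m(1) z(1)] z(2) m(2) by fastforce
qed

text \<open>The closed walk around \<open>c\<close>, along \<open>p\<close>, around \<open>d\<close>
  and back along \<open>p\<close> has even length. Because the cycles are odd, both passages of a
  path edge get the same sign, hence the entries \<plusminus>2. A one-vertex path covers cycles that
  share a vertex.\<close>

lemma two_odd_cycles_vector:
  assumes E: "finite E" "\<forall>e\<in>E. card e = 2"
    and c: "is_cycle E c" "odd (length c)" and d: "is_cycle E d" "odd (length d)"
    and p: "p \<noteq> []" "distinct p" "set (walk_edges p) \<subseteq> E"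
    and meet: "set p \<inter> set c = {hd p}" "set p \<inter> set d = {last p}" "set c \<inter> set d \<subseteq> set p"
  shows "\<exists>z\<in>edge_lattice E. norm1 E z = int (length c + length d + 2 * (length p - 1)) \<and>
    (\<forall>e. \<bar>z e\<bar> = of_bool (e \<in> set (cycle_edges c)) + 2 * of_bool (e \<in> set (walk_edges p))
      + of_bool (e \<in> set (cycle_edges d))) \<and>
    (\<forall>e \<in> set (cycle_edges c). \<bar>z e\<bar> = 1)"
proof -
  have hl: "hd p \<in> set c" "last p \<in> set d" using meet by auto
  obtain c' where c': "is_cycle E c'" "hd c' = hd p" "length c' = length c"
    "set (cycle_edges c') = set (cycle_edges c)" by (rule rotate_cycle_vertex[OF c(1) hl(1)])
  obtain d' where d': "is_cycle E d'" "hd d' = last p" "length d' = length d"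
    "set (cycle_edges d') = set (cycle_edges d)" by (rule rotate_cycle_vertex[OF d(1) hl(2)])
  define u w where "u = c' @ [hd c']" and "w = d' @ [hd d']"
  have u: "set (walk_edges u) \<subseteq> E" "u \<noteq> []" "distinct (walk_edges u)" "hd u = hd p" "last u = hd p"
      "length u = length c + 1" "set (walk_edges u) = set (cycle_edges c)"
    using c' distinct_cycle_edges[of c']
    by (auto simp: u_def is_cycle_def cycle_edges_def hd_append)
  have w: "set (walk_edges w) \<subseteq> E" "w \<noteq> []" "distinct (walk_edges w)" "hd w = last p" "last w = last p"
      "length w = length d + 1" "set (walk_edges w) = set (cycle_edges d)"
    using d' distinct_cycle_edges[of d']
    by (auto simp: w_def is_cycle_def cycle_edges_def hd_append)
  define \<sigma> where "\<sigma> = (- 1 :: int) ^ (length p - 1)"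
  have \<sigma>: "\<sigma> = 1 \<or> \<sigma> = -1" by (auto simp: \<sigma>_def minus_one_power_iff)
  \<comment> \<open>Each odd closed walk has boundary 2 at its base point. The path term cancels
    this at \<open>hd p\<close> and moves it, with sign \<sigma>, to \<open>last p\<close>.\<close>
  define z where "z e = alternating u e - 2 * alternating p e - \<sigma> * alternating w e" for e
  have "(\<Sum>e | e \<in> E \<and> v \<in> e. z e) = 0" for v
  proof -
    have "(\<Sum>e | e \<in> E \<and> v \<in> e. z e) = (\<Sum>e | e \<in> E \<and> v \<in> e. alternating u e)
        - 2 * (\<Sum>e | e \<in> E \<and> v \<in> e. alternating p e) - \<sigma> * (\<Sum>e | e \<in> E \<and> v \<in> e. alternating w e)"
      by (simp add: z_def sum_subtractf sum_distrib_left)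
    also have "\<dots> = 0"
      unfolding alternating_boundary[OF E u(1,2)] alternating_boundary[OF E w(1,2)]
        alternating_boundary[OF E p(3,1)]
      using u w c(2) d(2) by (simp add: \<sigma>_def algebra_simps)
    finally show ?thesis .
  qed
  moreover have "z e = 0" if "e \<notin> E" for e
  proof -
    have "e \<notin> set (walk_edges u)" "e \<notin> set (walk_edges w)" "e \<notin> set (walk_edges p)"
      using that u(1) w(1) p(3) by blast+
    then show ?thesis by (simp add: z_def alternating_outside)
  qed
  ultimately have zL: "z \<in> edge_lattice E" by (simp add: edge_lattice_def)
  have two: "\<exists>x y. x \<in> e \<and> y \<in> e \<and> x \<noteq> y" if "e \<in> E" for e
    using E(2) that by (metis card_2_iff insertCI)
  \<comment> \<open>A common edge of two of the three parts would lie inside a single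
    vertex.\<close>
  have disj: "set (walk_edges u) \<inter> set (walk_edges p) = {}" "set (walk_edges u) \<inter> set (walk_edges w) = {}"
    "set (walk_edges p) \<inter> set (walk_edges w) = {}"
  proof -
    have uc: "e \<subseteq> set c" if "e \<in> set (walk_edges u)" for e using that u(7) cycle_edges_subset by blast
    have wd: "e \<subseteq> set d" if "e \<in> set (walk_edges w)" for e using that w(7) cycle_edges_subset by blast
    have pp: "e \<subseteq> set p" if "e \<in> set (walk_edges p)" for e using that walk_edges_subset by blast
    have no: False if "e \<in> E" "e \<subseteq> {v}" for e v using two[OF that(1)] that(2) by auto
    show "set (walk_edges u) \<inter> set (walk_edges p) = {}"
    proof (rule ccontr)
      assume "\<not> ?thesis"
      then obtain e where "e \<in> set (walk_edges u)" "e \<in> set (walk_edges p)" by blast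
      then have "e \<in> E" "e \<subseteq> {hd p}" using p(3) uc pp meet(1) by blast+
      then show False using no by blast
    qed
    show "set (walk_edges p) \<inter> set (walk_edges w) = {}"
    proof (rule ccontr)
      assume "\<not> ?thesis"
      then obtain e where "e \<in> set (walk_edges w)" "e \<in> set (walk_edges p)" by blast
      then have "e \<in> E" "e \<subseteq> {last p}" using p(3) wd pp meet(2) by blast+
      then show False using no by blast
    qed
    show "set (walk_edges u) \<inter> set (walk_edges w) = {}"
    proof (rule ccontr)
      assume "\<not> ?thesis"
      then obtain e where "e \<in> set (walk_edges u)" "e \<in> set (walk_edges w)" by blast
      then have "e \<in> E" "e \<subseteq> {hd p}" using u(1) uc wd meet by blast+
      then show False using no by blast
    qed
  qed
  have abs: "\<bar>z e\<bar> = of_bool (e \<in> set (cycle_edges c)) + 2 * of_bool (e \<in> set (walk_edges p))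
      + of_bool (e \<in> set (cycle_edges d))" for e
  proof -
    consider "e \<in> set (walk_edges u)" | "e \<in> set (walk_edges p)" | "e \<in> set (walk_edges w)"
      | "e \<notin> set (walk_edges u)" "e \<notin> set (walk_edges p)" "e \<notin> set (walk_edges w)" by blast
    then show ?thesis
    proof cases
      case 1
      then have "e \<notin> set (walk_edges p)" "e \<notin> set (walk_edges w)" using disj by auto
      then show ?thesis using 1 abs_alternating[OF u(3), of e]
        by (simp add: z_def alternating_outside flip: u(7) w(7))
    next
      case 2
      then have "e \<notin> set (walk_edges u)" "e \<notin> set (walk_edges w)" using disj by auto
      then show ?thesis using 2 abs_alternating[OF distinct_walk_edges[OF p(2)], of e]
        by (simp add: z_def alternating_outside abs_mult flip: u(7) w(7))
    next
      case 3
      then have "e \<notin> set (walk_edges u)" "e \<notin> set (walk_edges p)" using disj by auto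
      then show ?thesis using 3 abs_alternating[OF w(3), of e] \<sigma>
        by (auto simp add: z_def alternating_outside simp flip: u(7) w(7))
    next
      case 4
      then show ?thesis by (simp add: z_def alternating_outside flip: u(7) w(7))
    qed
  qed
  have sum_ind: "(\<Sum>e\<in>E. of_bool (e \<in> set xs) :: int) = int (length xs)"
    if "distinct xs" "set xs \<subseteq> E" for xs
    using that E(1) distinct_card[OF that(1)] by (simp add: sum_of_bool_eq Int_absorb1)
  have "norm1 E z = int (length c + length d + 2 * (length p - 1))"
  proof -
    have "norm1 E z = (\<Sum>e\<in>E. of_bool (e \<in> set (walk_edges u)))
        + 2 * (\<Sum>e\<in>E. of_bool (e \<in> set (walk_edges p))) + (\<Sum>e\<in>E. of_bool (e \<in> set (walk_edges w)))"
      unfolding norm1_def abs by (simp add: sum.distrib sum_distrib_left u(7) w(7))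
    then show ?thesis
      using sum_ind[OF u(3,1)] sum_ind[OF w(3,1)] sum_ind[OF distinct_walk_edges[OF p(2)] p(3)] u(6) w(6)
      by (simp add: length_walk_edges)
  qed
  moreover have "\<bar>z e\<bar> = 1" if "e \<in> set (cycle_edges c)" for e
  proof -
    have "e \<notin> set (walk_edges p)" "e \<notin> set (cycle_edges d)" using disj that u(7) w(7) by auto
    then show ?thesis unfolding abs using that by simp
  qed
  ultimately show ?thesis using zL abs by blast
qed

text \<open>Follow a longest path in the support: one of its ends differs from \<open>b\<close> and has a second
  incident edge, which closes a cycle.\<close>

lemma acyclic_vector_eq_0:
  fixes t :: "'v set \<Rightarrow> int"
  assumes E: "finite E" "\<forall>e\<in>E. card e = 2" and acyc: "\<And>c. \<not> is_cycle E c"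
    and out: "\<And>e. e \<notin> E \<Longrightarrow> t e = 0"
    and bd: "\<And>v. v \<noteq> b \<Longrightarrow> (\<Sum>e | e \<in> E \<and> v \<in> e. t e) = 0"
  shows "t e = 0"
proof (rule ccontr)
  assume te: "t e \<noteq> 0"
  define T where "T = {e. t e \<noteq> 0}"
  have TE: "T \<subseteq> E" using out by (auto simp: T_def)
  have finT: "finite (\<Union>T)"
  proof (intro finite_Union)
    show "finite T" using TE E(1) by (rule finite_subset)
    show "finite M" if "M \<in> T" for M using that TE E(2) by (metis card.infinite subsetD zero_neq_numeral)
  qed
  have second: "\<exists>f\<in>T. v \<in> f \<and> f \<noteq> e" if "e \<in> T" "v \<in> e" "v \<noteq> b" for v e
  proof (rule ccontr)
    assume no: "\<not> ?thesis"
    have "(\<Sum>f | f \<in> E \<and> v \<in> f. t f) = (\<Sum>f\<in>{e}. t f)"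
      using that no TE E(1) by (intro sum.mono_neutral_right) (auto simp: T_def)
    then show False using bd[OF that(3)] that(1) by (simp add: T_def)
  qed
  define P where "P p \<longleftrightarrow> distinct p \<and> length p \<ge> 2 \<and> set (walk_edges p) \<subseteq> T" for p
  have "card e = 2" using te out E(2) by metis
  then obtain x y where "e = {x, y}" "x \<noteq> y" by (auto simp: card_2_iff)
  then have P0: "P [x, y]" using te by (auto simp: P_def T_def)
  have bound: "length p < Suc (card (\<Union>T))" if "P p" for p
  proof -
    have "set p \<subseteq> \<Union>(set (walk_edges p))" if "length p \<ge> 2" for p :: "'v list"
      using that
    proof (induction p rule: walk_edges.induct)
      case (1 x y w)
      then show ?case by (cases w) auto
    qed auto
    then have "set p \<subseteq> \<Union>T" using that by (auto simp: P_def) blast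
    then have "card (set p) \<le> card (\<Union>T)" using finT by (rule card_mono[rotated])
    then show ?thesis using that by (simp add: P_def distinct_card)
  qed
  obtain p where p: "P p" and max: "\<And>p'. P p' \<Longrightarrow> length p' \<le> length p"
    using ex_has_greatest_nat[of P "[x, y]" length "Suc (card (\<Union>T))"] P0 bound by (metis less_imp_le)
  \<comment> \<open>The two ends are different, so the path or its reverse starts away from the
    exceptional vertex.\<close>
  have "\<exists>p. P p \<and> hd p \<noteq> b \<and> (\<forall>p'. P p' \<longrightarrow> length p' \<le> length p)"
  proof (cases "hd p = b")
    case False
    then show ?thesis using p max by blast
  next
    case True
    have "P (rev p)" using p by (simp add: P_def walk_edges_rev)
    moreover have "hd (rev p) \<noteq> b"
    proof -
      have "p \<noteq> []" "tl p \<noteq> []" using p by (cases p; auto simp: P_def Suc_le_length_iff)+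
      then have "last p \<in> set (tl p)" by (metis last_in_set last_tl)
      moreover have "hd p \<notin> set (tl p)" using p \<open>p \<noteq> []\<close> by (cases p) (auto simp: P_def)
      ultimately show ?thesis using True by (metis hd_rev)
    qed
    ultimately show ?thesis using max by (intro exI[of _ "rev p"]) simp
  qed
  then obtain p where p: "P p" "hd p \<noteq> b" and max: "\<And>p'. P p' \<Longrightarrow> length p' \<le> length p" by blast
  obtain x y w where pw: "p = x # y # w" using p(1) by (auto simp: P_def Suc_le_length_iff numeral_2_eq_2)
  have "{x, y} \<in> T" using p(1) pw by (auto simp: P_def)
  then obtain f where f: "f \<in> T" "x \<in> f" "f \<noteq> {x, y}" using second[of "{x, y}" x] p(2) pw by auto
  have "card f = 2" using f(1) TE E(2) by blast
  then obtain v where v: "v \<noteq> x" "f = {x, v}" using f(2) by (rule edge_other_end)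
  show False
  proof (cases "v \<in> set p")
    case False
    then have "P (v # p)" using p(1) f(1) v by (auto simp: P_def pw insert_commute)
    then show False using max[of "v # p"] by simp
  next
    case True
    then have "v \<in> set w" using v f(3) pw by auto
    then obtain ws ws' where ws: "w = ws @ v # ws'" by (meson split_list)
    let ?c = "x # y # ws @ [v]"
    have "walk_edges p = walk_edges (?c @ ws')" by (simp add: pw ws)
    then have "set (walk_edges ?c) \<subseteq> set (walk_edges p)"
      by (cases "ws' = []") (auto simp: walk_edges_append[of ?c ws'] simp del: append_Cons append_assoc)
    then have "set (cycle_edges ?c) \<subseteq> T"
      using p(1) f(1) v(2) by (subst cycle_edges_eq) (auto simp: P_def insert_commute)
    moreover have "distinct ?c" using p(1) by (auto simp: P_def pw ws)
    ultimately have "is_cycle E ?c" using TE by (auto simp: is_cycle_def)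
    then show False using acyc by blast
  qed
qed

lemma edge_lattice_forest:
  assumes "finite E" "\<forall>e\<in>E. card e = 2" "\<And>c. \<not> is_cycle E c" "z \<in> edge_lattice E"
  shows "z e = 0"
  \<comment> \<open>All boundaries vanish here, so an arbitrary vertex can stand in for the
    exceptional one.\<close>
  using acyclic_vector_eq_0[OF assms(1-3), of z undefined] assms(4) by (simp add: edge_lattice_def)

text \<open>Subtracting a multiple of the alternating vector of the path \<open>c\<close> leaves a vector on a forest whose
  boundary is concentrated at the last vertex of \<open>c\<close>.\<close>

lemma edge_lattice_odd_unicyclic:
  assumes E: "finite E" "\<forall>e\<in>E. card e = 2" and c: "is_cycle E c" "odd (length c)"
    and f: "f \<in> set (cycle_edges c)" and acyc: "\<And>c'. \<not> is_cycle (E - {f}) c'"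
    and z: "z \<in> edge_lattice E"
  shows "z e = 0"
proof -
  obtain c' where c': "is_cycle E c'" "{last c', hd c'} = f" "length c' = length c"
    by (rule rotate_cycle_edge[OF c(1) f]) blast
  have ne: "c' \<noteq> []" using c' by (auto simp: is_cycle_def)
  have fE: "f \<in> E" using c(1) f by (auto simp: is_cycle_def)
  have fw: "f \<notin> set (walk_edges c')"
    using closing_edge_notin_walk_edges[of c'] c'(1,2) by (simp add: is_cycle_def)
  have w: "set (walk_edges c') \<subseteq> E - {f}"
    using c'(1) ne fw by (auto simp: is_cycle_def cycle_edges_eq)
  have hl: "hd c' \<noteq> last c'" using fE E(2) c'(2) by (metis card_2_iff doubleton_eq_iff insert_absorb2 singleton_insert_inj_eq)
  \<comment> \<open>Dropping \<open>f\<close> leaves boundary \<open>- z f\<close> at both its ends.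
    The path \<open>c'\<close> has an even number of edges, so its alternating vector has boundary 1
    at one end and -1 at the other: it cancels the first and doubles the second.\<close>
  define t where "t e = (if e = f then 0 else z e) + z f * alternating c' e" for e
  have bd: "(\<Sum>e | e \<in> E - {f} \<and> v \<in> e. t e) = - 2 * z f * of_bool (v = last c')" for v
  proof -
    have z1: "(\<Sum>e | e \<in> E - {f} \<and> v \<in> e. if e = f then 0 else z e) = - z f * of_bool (v \<in> f)"
    proof -
      have "(\<Sum>e | e \<in> E - {f} \<and> v \<in> e. if e = f then 0 else z e) = (\<Sum>e \<in> {e. e \<in> E \<and> v \<in> e} - {f}. z e)"
        by (intro sum.cong) auto
      also have "\<dots> = (\<Sum>e | e \<in> E \<and> v \<in> e. z e) - (if v \<in> f then z f else 0)"
      proof -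
        have fin: "finite {e. e \<in> E \<and> v \<in> e}" using E(1) by simp
        show ?thesis unfolding sum_diff1[OF fin] using fE by simp
      qed
      finally show ?thesis
        unfolding edge_lattice_boundary[OF z]
        by (cases "v \<in> f")
          (simp_all only: if_True if_False of_bool_eq mult_1_right mult_zero_right diff_0 minus_zero simp_thms)
    qed
    have "(\<Sum>e | e \<in> E - {f} \<and> v \<in> e. t e)
        = - z f * of_bool (v \<in> f) + z f * (\<Sum>e | e \<in> E - {f} \<and> v \<in> e. alternating c' e)"
      unfolding t_def sum.distrib z1 sum_distrib_left[symmetric] by (rule refl)
    also have "(\<Sum>e | e \<in> E - {f} \<and> v \<in> e. alternating c' e) = of_bool (v = hd c') - of_bool (v = last c')"
    proof -
      have "even (length c' - 1)" using c(2) c'(3) ne by simp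
      then show ?thesis using alternating_boundary[of "E - {f}" c' v] E w ne by simp
    qed
    also have "- z f * of_bool (v \<in> f) + z f * (of_bool (v = hd c') - of_bool (v = last c'))
        = - 2 * z f * of_bool (v = last c')" using hl c'(2) by auto
    finally show ?thesis .
  qed
  have t0: "t e = 0" for e
  proof (rule acyclic_vector_eq_0[of "E - {f}" _ "last c'"])
    fix e assume e: "e \<notin> E - {f}"
    then have "e \<notin> set (walk_edges c')" using w by blast
    moreover have "e = f \<or> z e = 0" using e edge_lattice_outside[OF z] by blast
    ultimately show "t e = 0" by (auto simp: t_def alternating_outside)
  next
    fix v assume "v \<noteq> last c'"
    then show "(\<Sum>e | e \<in> E - {f} \<and> v \<in> e. t e) = 0" unfolding bd by simp
  qed (use E acyc in simp_all)
  \<comment> \<open>The boundary of the zero vector at the last vertex is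
    \<open>- 2 * z f\<close>.\<close>
  then have "z f = 0" using bd[of "last c'"] by simp
  then show ?thesis using t0[of e] by (auto simp: t_def split: if_splits)
qed

section \<open>Connectivity and blocks\<close>

text \<open>Connectivity is treated through the reflexive transitive closure of this relation;
  \<open>disconnected_iff\<close> translates to paths.\<close>

definition adjacency :: "'v set set \<Rightarrow> ('v \<times> 'v) set" where
  "adjacency E = {(x, y). {x, y} \<in> E}"

lemma adjacency_sym: "(x, y) \<in> (adjacency E)\<^sup>* \<Longrightarrow> (y, x) \<in> (adjacency E)\<^sup>*"
proof -
  have "sym (adjacency E)" by (auto simp: sym_def adjacency_def insert_commute)
  then have "sym ((adjacency E)\<^sup>*)" by (rule sym_rtrancl)
  then show "(x, y) \<in> (adjacency E)\<^sup>* \<Longrightarrow> (y, x) \<in> (adjacency E)\<^sup>*" by (auto dest: symD)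
qed

lemma adjacency_mono:
  assumes "E \<subseteq> E'" "(x, y) \<in> (adjacency E)\<^sup>*"
  shows "(x, y) \<in> (adjacency E')\<^sup>*"
proof -
  have "adjacency E \<subseteq> adjacency E'" using assms(1) by (auto simp: adjacency_def)
  then show ?thesis using assms(2) rtrancl_mono by blast
qed

lemma reach_along_walk:
  "x \<in> set w \<Longrightarrow> (hd w, x) \<in> (adjacency (set (walk_edges w)))\<^sup>*"
proof (induction w rule: walk_edges.induct)
  case (1 y y' w)
  show ?case
  proof (cases "x = y")
    case False
    then have "(y', x) \<in> (adjacency (set (walk_edges (y' # w))))\<^sup>*" using 1 by simp
    then have "(y', x) \<in> (adjacency (set (walk_edges (y # y' # w))))\<^sup>*"
      by (rule adjacency_mono[rotated]) auto
    moreover have "(y, y') \<in> adjacency (set (walk_edges (y # y' # w)))" by (simp add: adjacency_def)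
    ultimately show ?thesis by (simp add: converse_rtrancl_into_rtrancl)
  qed simp
qed auto

lemma simple_graphD: "simple_graph G \<Longrightarrow> e \<in> edges G \<Longrightarrow> e \<subseteq> verts G \<and> card e = 2"
  by (auto simp: simple_graph_def)

lemma reach_path:
  assumes G: "simple_graph G" and u: "u \<in> verts G"
    and r: "(u, v) \<in> (adjacency (edges G))\<^sup>*"
  shows "\<exists>p. path_in G p \<and> hd p = u \<and> last p = v"
  using r
proof (induction rule: rtrancl_induct)
  case base
  then show ?case using u by (intro exI[of _ "[u]"]) (simp add: path_in_def path_edges_eq)
next
  case (step y z)
  then obtain p where p: "path_in G p" "hd p = u" "last p = y" by blast
  have e: "{y, z} \<in> edges G" using step(2) by (simp add: adjacency_def)
  show ?case
  proof (cases "z \<in> set p")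
    case True
    then obtain xs ys where s: "p = xs @ z # ys" by (meson split_list)
    have "set (walk_edges (xs @ [z])) \<subseteq> set (walk_edges p)"
      by (cases "ys = []") (auto simp: s walk_edges_append[of "xs @ [z]" ys, simplified])
    then have "path_in G (xs @ [z])" using p(1) by (auto simp: path_in_def path_edges_eq s)
    moreover have "hd (xs @ [z]) = u" using p(2) s by (cases xs) auto
    ultimately show ?thesis by (intro exI[of _ "xs @ [z]"]) simp
  next
    case False
    have "z \<in> verts G" using simple_graphD[OF G e] by simp
    then have "path_in G (p @ [z])"
      using p e False by (auto simp: path_in_def path_edges_eq walk_edges_snoc)
    moreover have "hd (p @ [z]) = u" using p by (auto simp: path_in_def hd_append)
    ultimately show ?thesis by (intro exI[of _ "p @ [z]"]) simp
  qed
qed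

lemma path_reach:
  assumes "path_in G p"
  shows "(hd p, last p) \<in> (adjacency (edges G))\<^sup>*"
proof -
  have "(hd p, last p) \<in> (adjacency (set (walk_edges p)))\<^sup>*"
    using assms by (intro reach_along_walk) (auto simp: path_in_def)
  then show ?thesis using assms by (auto simp: path_in_def path_edges_eq intro: adjacency_mono)
qed

lemma disconnected_iff:
  assumes "simple_graph G"
  shows "disconnected G \<longleftrightarrow>
    (\<exists>u\<in>verts G. \<exists>v\<in>verts G. (u, v) \<notin> (adjacency (edges G))\<^sup>*)"
proof
  assume "disconnected G"
  then obtain u v where uv: "u \<in> verts G" "v \<in> verts G"
    "\<not> (\<exists>p. path_in G p \<and> hd p = u \<and> last p = v)" unfolding disconnected_def by blast
  then have "(u, v) \<notin> (adjacency (edges G))\<^sup>*" using reach_path[OF assms uv(1)] by blast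
  then show "\<exists>u\<in>verts G. \<exists>v\<in>verts G. (u, v) \<notin> (adjacency (edges G))\<^sup>*" using uv by blast
next
  assume "\<exists>u\<in>verts G. \<exists>v\<in>verts G. (u, v) \<notin> (adjacency (edges G))\<^sup>*"
  then obtain u v where uv: "u \<in> verts G" "v \<in> verts G" "(u, v) \<notin> (adjacency (edges G))\<^sup>*" by blast
  then have "\<not> (path_in G p \<and> hd p = u \<and> last p = v)" for p using path_reach[of G p] by auto
  then show "disconnected G" unfolding disconnected_def using uv(1,2) by blast
qed

section \<open>Nonseparable graphs and blocks\<close>

definition nonseparable :: "'v graph \<Rightarrow> bool" where
  "nonseparable H \<longleftrightarrow> simple_graph H \<and> verts H \<noteq> {} \<and>
     (\<forall>x\<in>verts H. \<forall>y\<in>verts H. (x, y) \<in> (adjacency (edges H))\<^sup>*) \<and>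
     (\<forall>v. \<forall>x\<in>verts H - {v}. \<forall>y\<in>verts H - {v}. (x, y) \<in> (adjacency {e \<in> edges H. v \<notin> e})\<^sup>*)"

lemma nonseparable_subgraph_iff:
  "nonseparable_subgraph H G \<longleftrightarrow> subgraph H G \<and> nonseparable H"
proof (cases "subgraph H G")
  case True
  then have s: "simple_graph H" by (simp add: subgraph_def)
  have rem: "simple_graph (remove_vertex H v)" for v
    using s by (auto simp: simple_graph_def remove_vertex_def)
  have conn: "connected_graph H \<longleftrightarrow> verts H \<noteq> {} \<and>
      (\<forall>x\<in>verts H. \<forall>y\<in>verts H. (x, y) \<in> (adjacency (edges H))\<^sup>*)"
    by (auto simp: connected_graph_def disconnected_iff[OF s])
  define avoid where "avoid v \<longleftrightarrow>
    (\<forall>x\<in>verts H - {v}. \<forall>y\<in>verts H - {v}. (x, y) \<in> (adjacency {e \<in> edges H. v \<notin> e})\<^sup>*)" for v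
  have cut: "cut_vertex H v \<longleftrightarrow> v \<in> verts H \<and> \<not> avoid v" for v
    unfolding cut_vertex_def disconnected_iff[OF rem] by (auto simp: remove_vertex_def avoid_def)
  have avoid: "avoid v" if "\<forall>x\<in>verts H. \<forall>y\<in>verts H. (x, y) \<in> (adjacency (edges H))\<^sup>*" "v \<notin> verts H" for v
  proof -
    have "edges H = {e \<in> edges H. v \<notin> e}" using that(2) simple_graphD[OF s] by blast
    then show ?thesis using that by (simp add: avoid_def)
  qed
  show ?thesis
    unfolding nonseparable_subgraph_def nonseparable_def conn cut avoid_def[symmetric]
    using True s avoid by (intro iffI conjI allI; elim conjE; auto)
next
  case False
  then show ?thesis by (simp add: nonseparable_subgraph_def)
qed

text \<open>Whichever vertex is removed, one of the two common vertices remains and links the two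
  parts.\<close>

lemma nonseparable_union:
  assumes H: "nonseparable H" and K: "nonseparable K"
    and xy: "x \<in> verts H \<inter> verts K" "y \<in> verts H \<inter> verts K" "x \<noteq> y"
  shows "nonseparable (verts H \<union> verts K, edges H \<union> edges K)"
proof -
  let ?E = "edges H \<union> edges K"
  have to_x: "(u, x) \<in> (adjacency ?E)\<^sup>*" if "u \<in> verts H \<union> verts K" for u
  proof (cases "u \<in> verts H")
    case True
    then have "(u, x) \<in> (adjacency (edges H))\<^sup>*" using H xy by (auto simp: nonseparable_def)
    then show ?thesis by (rule adjacency_mono[rotated]) auto
  next
    case False
    then have "(u, x) \<in> (adjacency (edges K))\<^sup>*" using K xy that by (auto simp: nonseparable_def)
    then show ?thesis by (rule adjacency_mono[rotated]) auto
  qed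
  have all: "(u, w) \<in> (adjacency ?E)\<^sup>*" if "u \<in> verts H \<union> verts K" "w \<in> verts H \<union> verts K" for u w
    using to_x[OF that(1)] adjacency_sym[OF to_x[OF that(2)]] by (rule rtrancl_trans)
  have avoid: "(u, w) \<in> (adjacency {e \<in> ?E. v \<notin> e})\<^sup>*"
    if uw: "u \<in> verts H \<union> verts K - {v}" "w \<in> verts H \<union> verts K - {v}" for u w v
  proof -
    obtain a where a: "a \<in> verts H \<inter> verts K" "a \<noteq> v" using xy by blast
    have to_a: "(u, a) \<in> (adjacency {e \<in> ?E. v \<notin> e})\<^sup>*" if "u \<in> verts H \<union> verts K - {v}" for u
    proof (cases "u \<in> verts H")
      case True
      then have "(u, a) \<in> (adjacency {e \<in> edges H. v \<notin> e})\<^sup>*"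
        using H a that by (auto simp: nonseparable_def)
      then show ?thesis by (rule adjacency_mono[rotated]) auto
    next
      case False
      then have "(u, a) \<in> (adjacency {e \<in> edges K. v \<notin> e})\<^sup>*"
        using K a that by (auto simp: nonseparable_def)
      then show ?thesis by (rule adjacency_mono[rotated]) auto
    qed
    show ?thesis using to_a[OF uw(1)] adjacency_sym[OF to_a[OF uw(2)]] by (rule rtrancl_trans)
  qed
  have "simple_graph (verts H \<union> verts K, ?E)"
    using H K by (auto simp: nonseparable_def simple_graph_def)
  moreover have "verts H \<union> verts K \<noteq> {}" using xy(1) by blast
  ultimately show ?thesis using all avoid unfolding nonseparable_def by (simp only: fst_conv snd_conv) blast
qed

lemma block_iff:
  "block G B \<longleftrightarrow> subgraph B G \<and> nonseparable B \<and>
     (\<forall>H. subgraph H G \<and> nonseparable H \<and> subgraph B H \<longrightarrow> H = B)"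
  by (auto simp: block_def nonseparable_subgraph_iff)

text \<open>Among the nonseparable subgraphs that contain \<open>H\<close>, one with the largest
  number of vertices and edges is maximal for inclusion.\<close>

lemma nonseparable_in_block:
  assumes G: "simple_graph G" "finite (verts G)" and H: "subgraph H G" "nonseparable H"
  shows "\<exists>B. block G B \<and> subgraph H B"
proof -
  have finE: "finite (edges G)"
    by (rule finite_subset[of _ "Pow (verts G)"]) (use G in \<open>auto simp: simple_graph_def\<close>)
  define f where "f K = card (verts K) + card (edges K)" for K :: "'a graph"
  define P where "P K \<longleftrightarrow> subgraph K G \<and> nonseparable K \<and> subgraph H K" for K
  have PH: "P H" using H by (auto simp: P_def subgraph_def)
  have bound: "f K \<le> card (verts G) + card (edges G)" if "P K" for K
    using that G(2) finE by (auto simp: P_def f_def subgraph_def intro!: add_mono card_mono)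
  have "\<exists>B. P B \<and> (\<forall>K. P K \<longrightarrow> f K \<le> f B)"
    by (rule ex_has_greatest_nat[of P H f "Suc (card (verts G) + card (edges G))", OF PH])
      (use bound less_Suc_eq_le in blast)
  then obtain B where B: "P B" and max: "\<And>K. P K \<Longrightarrow> f K \<le> f B" by auto
  have "K = B" if K: "subgraph K G" "nonseparable K" "subgraph B K" for K
  proof -
    have "P K" using K B by (auto simp: P_def subgraph_def)
    from max[OF this] have le: "f K \<le> f B" .
    have sub: "verts B \<subseteq> verts K" "edges B \<subseteq> edges K" using K(3) by (auto simp: subgraph_def)
    have fin: "finite (verts K)" "finite (edges K)"
      using K(1) G(2) finE by (auto simp: subgraph_def intro: finite_subset)
    have "card (verts B) \<le> card (verts K)" "card (edges B) \<le> card (edges K)"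
      using sub fin by (auto intro: card_mono)
    with le have "card (verts K) \<le> card (verts B)" "card (edges K) \<le> card (edges B)"
      by (simp_all add: f_def)
    then have "verts B = verts K" "edges B = edges K"
      using card_seteq[OF fin(1) sub(1)] card_seteq[OF fin(2) sub(2)] by auto
    then show ?thesis by (simp add: prod_eq_iff)
  qed
  then show ?thesis using B unfolding block_iff P_def by blast
qed

text \<open>Two common vertices would make the union nonseparable, against the maximality of both
  blocks.\<close>

lemma blocks_share_vertex:
  assumes G: "block G A" "block G B" "A \<noteq> B"
    and xy: "x \<in> verts A \<inter> verts B" "y \<in> verts A \<inter> verts B"
  shows "x = y"
proof (rule ccontr)
  assume "x \<noteq> y"
  let ?U = "(verts A \<union> verts B, edges A \<union> edges B)"
  have n: "nonseparable ?U"
    using nonseparable_union[of A B x y] G(1,2) xy \<open>x \<noteq> y\<close> by (simp add: block_iff)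
  have "subgraph A G" "subgraph B G" using G by (auto simp: block_iff)
  then have "subgraph ?U G" "subgraph A ?U" "subgraph B ?U"
    using n by (auto simp: subgraph_def nonseparable_def)
  moreover have "\<And>H. subgraph H G \<Longrightarrow> nonseparable H \<Longrightarrow> subgraph A H \<Longrightarrow> H = A"
    "\<And>H. subgraph H G \<Longrightarrow> nonseparable H \<Longrightarrow> subgraph B H \<Longrightarrow> H = B"
    using G(1,2) unfolding block_iff by blast+
  ultimately have "?U = A" "?U = B" using n by simp_all
  then show False using G(3) by simp
qed

lemma blocks_edge_disjoint:
  assumes G: "block G A" "block G B" "A \<noteq> B"
  shows "edges A \<inter> edges B = {}"
proof (rule ccontr)
  assume "\<not> ?thesis"
  then obtain e where e: "e \<in> edges A" "e \<in> edges B" by blast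
  have "simple_graph A" "simple_graph B" using G by (auto simp: block_iff nonseparable_def)
  then have "e \<subseteq> verts A \<inter> verts B" "card e = 2" using e simple_graphD by blast+
  moreover obtain x y where "e = {x, y}" "x \<noteq> y" using \<open>card e = 2\<close> by (auto simp: card_2_iff)
  ultimately show False using blocks_share_vertex[OF G, of x y] by auto
qed

text \<open>If the cycle is rotated so that the removed vertex comes first, the rest of the list is
  a path.\<close>

lemma cycle_nonseparable:
  assumes E: "\<forall>e\<in>E. card e = 2" and c: "is_cycle E c"
  shows "nonseparable (set c, set (cycle_edges c))"
proof -
  have ne: "c \<noteq> []" using c by (auto simp: is_cycle_def)
  have s: "simple_graph (set c, set (cycle_edges c))"
    using E c cycle_edges_subset[of _ c] by (auto simp: simple_graph_def is_cycle_def)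
  have from_hd: "(hd c, x) \<in> (adjacency (set (cycle_edges c)))\<^sup>*" if "x \<in> set c" for x
    using reach_along_walk[OF that] by (rule adjacency_mono[rotated]) (auto simp: cycle_edges_eq[OF ne])
  have all: "(x, y) \<in> (adjacency (set (cycle_edges c)))\<^sup>*" if "x \<in> set c" "y \<in> set c" for x y
    using adjacency_sym[OF from_hd[OF that(1)]] from_hd[OF that(2)] by (rule rtrancl_trans)
  have avoid: "(x, y) \<in> (adjacency {e \<in> set (cycle_edges c). v \<notin> e})\<^sup>*"
    if xy: "x \<in> set c - {v}" "y \<in> set c - {v}" for x y v
  proof (cases "v \<in> set c")
    case False
    then have "{e \<in> set (cycle_edges c). v \<notin> e} = set (cycle_edges c)" using cycle_edges_subset by fast
    then show ?thesis using all[of x y] xy by simp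
  next
    case True
    obtain d where d: "is_cycle E d" "hd d = v" "set d = set c"
      "set (cycle_edges d) = set (cycle_edges c)" by (rule rotate_cycle_vertex[OF c True]) blast
    then obtain w where w: "d = v # w" by (cases d) (auto simp: is_cycle_def)
    have v: "v \<notin> set w" using d(1) w by (simp add: is_cycle_def)
    have "w \<noteq> []" using d(1) w by (auto simp: is_cycle_def)
    then have sub: "set (walk_edges w) \<subseteq> {e \<in> set (cycle_edges c). v \<notin> e}"
      using v walk_edges_subset[of _ w] by (auto simp: cycle_edges_eq w walk_edges_Cons simp flip: d(4))
    have r: "(hd w, x) \<in> (adjacency {e \<in> set (cycle_edges c). v \<notin> e})\<^sup>*" if "x \<in> set c - {v}" for x
    proof -
      have "x \<in> set w" using that w by (auto simp flip: d(3))
      then show ?thesis using adjacency_mono[OF sub reach_along_walk] by blast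
    qed
    show ?thesis using adjacency_sym[OF r[OF xy(1)]] r[OF xy(2)] by (rule rtrancl_trans)
  qed
  show ?thesis using s all avoid ne unfolding nonseparable_def by simp
qed

lemma cycle_in_non_edge_block:
  assumes G: "simple_graph G" "finite (verts G)" and c: "is_cycle (edges G) c"
  shows "\<exists>B\<in>non_edge_blocks G. is_cycle (edges B) c \<and> set c \<subseteq> verts B"
proof -
  let ?C = "(set c, set (cycle_edges c))"
  have E: "\<forall>e\<in>edges G. card e = 2" using G(1) by (simp add: simple_graph_def)
  have n: "nonseparable ?C" by (rule cycle_nonseparable[OF E c])
  have ce: "set (cycle_edges c) \<subseteq> edges G" "length c \<ge> 3" "distinct c" using c by (auto simp: is_cycle_def)
  have "set c \<subseteq> verts G"
  proof
    fix v assume "v \<in> set c"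
    then obtain d where d: "hd d = v" "is_cycle (edges G) d" by (rule rotate_cycle_vertex[OF c]) blast
    then have "{last d, v} \<in> edges G" by (cases d) (auto simp: is_cycle_def cycle_edges_eq)
    then show "v \<in> verts G" using simple_graphD[OF G(1)] by blast
  qed
  then have "subgraph ?C G" using n ce by (auto simp: subgraph_def nonseparable_def)
  then obtain B where B: "block G B" "subgraph ?C B" using nonseparable_in_block[OF G _ n] by blast
  then have sub: "set c \<subseteq> verts B" "set (cycle_edges c) \<subseteq> edges B" by (auto simp: subgraph_def)
  have "B \<noteq> ({u, v}, {{u, v}})" for u v
  proof
    assume "B = ({u, v}, {{u, v}})"
    then have "card (set c) \<le> card {u, v}" using sub(1) by (intro card_mono) auto
    also have "\<dots> \<le> 2" by (simp add: card_insert_if)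
    finally show False using distinct_card[OF ce(3)] ce(2) by simp
  qed
  then have "B \<in> non_edge_blocks G" using B(1) unfolding non_edge_blocks_def by blast
  moreover have "is_cycle (edges B) c" using sub(2) ce by (simp add: is_cycle_def)
  ultimately show ?thesis using sub(1) by blast
qed

section \<open>Ears of nonseparable graphs\<close>

definition ear :: "'v graph \<Rightarrow> 'v list \<Rightarrow> bool" where
  "ear H p \<longleftrightarrow> distinct p \<and> length p \<ge> 2 \<and> hd p \<in> verts H \<and> last p \<in> verts H \<and>
     set (butlast (tl p)) \<inter> verts H = {} \<and> set (walk_edges p) \<inter> edges H = {}"

lemma rtrancl_crossing:
  assumes "(a, b) \<in> r\<^sup>*" "P a" "\<not> P b"
  shows "\<exists>x y. (x, y) \<in> r \<and> P x \<and> \<not> P y"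
  using assms by (induction rule: rtrancl_induct) auto

lemma walk_edges_meets_butlast:
  "e \<in> set (walk_edges (w @ [z])) \<Longrightarrow> e \<inter> set w \<noteq> {}"
  by (induction w) (auto simp: walk_edges_Cons)

text \<open>If \<open>H\<close> has all vertices of \<open>B\<close>, a missing edge is an ear.
  Otherwise some edge leaves \<open>H\<close> at a vertex \<open>u\<close>, and a path that avoids
  \<open>u\<close> returns to \<open>H\<close>.\<close>

lemma ear_exists:
  assumes B: "nonseparable B" and H: "subgraph H B" "H \<noteq> B"
    and ab: "a \<in> verts H" "b \<in> verts H" "a \<noteq> b"
  obtains p where "ear H p" "set (walk_edges p) \<subseteq> edges B"
proof -
  have sB: "simple_graph B" using B by (simp add: nonseparable_def)
  have HB: "verts H \<subseteq> verts B" "edges H \<subseteq> edges B" "\<And>e. e \<in> edges H \<Longrightarrow> e \<subseteq> verts H"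
    using H(1) by (auto simp: subgraph_def simple_graph_def)
  show thesis
  proof (cases "verts H = verts B")
    case True
    then obtain e where e: "e \<in> edges B" "e \<notin> edges H" using H(2) HB(2) by (auto simp: prod_eq_iff)
    then obtain x y where "e = {x, y}" "x \<noteq> y" using simple_graphD[OF sB e(1)] by (auto simp: card_2_iff)
    then show ?thesis using that[of "[x, y]"] e simple_graphD[OF sB e(1)] True by (auto simp: ear_def)
  next
    case False
    then obtain v where v: "v \<in> verts B" "v \<notin> verts H" using HB(1) by blast
    then have "(a, v) \<in> (adjacency (edges B))\<^sup>*" using B ab(1) HB(1) by (auto simp: nonseparable_def)
    from rtrancl_crossing[OF this, of "\<lambda>x. x \<in> verts H"] v ab(1)
    obtain u w where uw: "{u, w} \<in> edges B" "u \<in> verts H" "w \<notin> verts H"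
      by (auto simp: adjacency_def)
    obtain z where z: "z \<in> verts H" "z \<noteq> u" using ab by blast
    \<comment> \<open>Searching for the return path in \<open>B\<close> without \<open>u\<close>
      guarantees that the two ends of the ear differ.\<close>
    let ?R = "remove_vertex B u"
    have R1: "simple_graph ?R" using sB by (auto simp: simple_graph_def remove_vertex_def)
    have R2: "w \<in> verts ?R" using uw simple_graphD[OF sB uw(1)] by (auto simp: remove_vertex_def)
    have R3: "(w, z) \<in> (adjacency (edges ?R))\<^sup>*"
    proof -
      have "w \<in> verts B - {u}" "z \<in> verts B - {u}"
        using uw z HB(1) simple_graphD[OF sB uw(1)] by auto
      then have "(w, z) \<in> (adjacency {e \<in> edges B. u \<notin> e})\<^sup>*"
        using B unfolding nonseparable_def by blast
      then show ?thesis by (simp add: remove_vertex_def)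
    qed
    obtain r where r: "path_in ?R r" "hd r = w" "last r = z" using reach_path[OF R1 R2 R3] by blast
    have "last r \<in> set r" using r(1) by (simp add: path_in_def)
    then have "\<exists>y\<in>set r. y \<in> verts H" using z(1) r(3) by blast
    \<comment> \<open>Cutting the path at its first vertex in \<open>H\<close> keeps the interior of
      the ear outside \<open>H\<close>.\<close>
    then obtain xs y ys where s: "r = xs @ y # ys" "y \<in> verts H" "\<forall>x\<in>set xs. x \<notin> verts H"
      using split_list_first_prop[of r "\<lambda>y. y \<in> verts H"] by blast
    have xs: "xs \<noteq> []" using r(2) s uw(3) by auto
    then have hd: "hd xs = w" using r(2) s(1) by simp
    have rp: "distinct r" "u \<notin> set r" "set (walk_edges r) \<subseteq> edges B"
      using r(1) by (auto simp: path_in_def remove_vertex_def path_edges_eq)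
    let ?p = "u # xs @ [y]"
    have "set (walk_edges (xs @ [y])) \<subseteq> set (walk_edges r)"
      by (cases "ys = []") (auto simp: s walk_edges_append[of "xs @ [y]" ys, simplified])
    then have sub: "set (walk_edges ?p) \<subseteq> edges B"
      using rp(3) uw(1) xs hd by (auto simp: walk_edges_Cons)
    have "e \<inter> set xs \<noteq> {}" if "e \<in> set (walk_edges ?p)" for e
      using that walk_edges_meets_butlast[of e xs y] xs by (auto simp: walk_edges_Cons)
    then have "set (walk_edges ?p) \<inter> edges H = {}" using HB(3) s(3) by blast
    then have "ear H ?p" using uw(2) s rp(1,2) by (auto simp: ear_def)
    then show ?thesis using that sub by blast
  qed
qed

text \<open>Such a block properly contains one of its edges, and an ear on this edge closes a cycle.
  The graph must have edges because a one-vertex graph is itself a non-edge block.\<close>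

lemma non_edge_block_cycle:
  assumes G: "simple_graph G" "connected_graph G" "edges G \<noteq> {}" and B: "B \<in> non_edge_blocks G"
  shows "\<exists>c. is_cycle (edges B) c"
proof -
  have blk: "subgraph B G" "nonseparable B" and max: "\<And>H. subgraph H G \<Longrightarrow> nonseparable H \<Longrightarrow> subgraph B H \<Longrightarrow> H = B"
    and ne: "\<And>u v. u \<noteq> v \<Longrightarrow> B \<noteq> ({u, v}, {{u, v}})"
    using B by (auto simp: non_edge_blocks_def block_iff)
  have sB: "simple_graph B" using blk by (simp add: nonseparable_def)
  obtain a where a: "a \<in> verts B" using blk by (auto simp: nonseparable_def)
  have K2: "nonseparable ({a, y}, {{a, y}})" if "a \<noteq> y" for y
  proof -
    have "(a, y) \<in> (adjacency {{a, y}})\<^sup>*" by (intro r_into_rtrancl) (simp add: adjacency_def)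
    moreover from this have "(y, a) \<in> (adjacency {{a, y}})\<^sup>*" by (rule adjacency_sym)
    ultimately have all: "(x, x') \<in> (adjacency {{a, y}})\<^sup>*" if "x \<in> {a, y}" "x' \<in> {a, y}" for x x'
      using that by auto
    have "(x, x') \<in> (adjacency {e \<in> {{a, y}}. v \<notin> e})\<^sup>*"
      if "x \<in> {a, y} - {v}" "x' \<in> {a, y} - {v}" for x x' v
    proof (cases "x = x'")
      case False
      then have "{e \<in> {{a, y}}. v \<notin> e} = {{a, y}}" using that by auto
      then show ?thesis using all that by simp
    qed simp
    moreover have "simple_graph ({a, y}, {{a, y}})" using that by (simp add: simple_graph_def)
    ultimately show ?thesis using all unfolding nonseparable_def fst_conv snd_conv by blast
  qed
  \<comment> \<open>A one-vertex block would be contained in an edge at that vertex, which exists by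
    connectedness.\<close>
  have "\<exists>b\<in>verts B. b \<noteq> a"
  proof (rule ccontr)
    assume no: "\<not> ?thesis"
    obtain e where e: "e \<in> edges G" using G(3) by blast
    then obtain x y where xy: "e = {x, y}" "x \<noteq> y" using simple_graphD[OF G(1) e] by (auto simp: card_2_iff)
    have "x \<in> verts G" "y \<in> verts G" using xy simple_graphD[OF G(1) e] by auto
    then obtain b where b: "b \<in> verts G" "b \<noteq> a" using xy(2) by blast
    have aG: "a \<in> verts G" using a blk(1) by (auto simp: subgraph_def)
    then have "(a, b) \<in> (adjacency (edges G))\<^sup>*"
      using G(1,2) b(1) by (auto simp: connected_graph_def disconnected_iff)
    from rtrancl_crossing[OF this, of "\<lambda>x. x = a"] b(2) obtain y where y: "{a, y} \<in> edges G" "y \<noteq> a"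
      by (auto simp: adjacency_def)
    have "edges B = {}"
    proof (rule ccontr)
      assume "edges B \<noteq> {}"
      then obtain e where "e \<in> edges B" by blast
      then have "e \<subseteq> {a}" "card e = 2" using simple_graphD[OF sB] no by blast+
      then show False using card_mono[of "{a}" e] by simp
    qed
    then have "subgraph B ({a, y}, {{a, y}})" using no sB by (auto simp: subgraph_def)
    moreover have "subgraph ({a, y}, {{a, y}}) G"
      using K2[of y] y simple_graphD[OF G(1) y(1)] by (auto simp: subgraph_def nonseparable_def)
    ultimately have "({a, y}, {{a, y}}) = B" using max K2[of y] y(2) by simp
    then show False using y(2) ne[of a y] by simp
  qed
  then obtain b where b: "b \<in> verts B" "b \<noteq> a" by blast
  then have "(a, b) \<in> (adjacency (edges B))\<^sup>*" using a blk by (auto simp: nonseparable_def)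
  from rtrancl_crossing[OF this, of "\<lambda>x. x = a"] b(2) obtain y where y: "{a, y} \<in> edges B" "y \<noteq> a"
    by (auto simp: adjacency_def)
  let ?H = "({a, y}, {{a, y}})"
  have "subgraph ?H B" using K2[of y] y simple_graphD[OF sB y(1)] by (auto simp: subgraph_def nonseparable_def)
  moreover have "?H \<noteq> B" using ne[of a y] y(2) by simp
  ultimately obtain p where p: "ear ?H p" "set (walk_edges p) \<subseteq> edges B"
    using ear_exists[OF blk(2), of ?H a y] y(2) by auto
  have pp: "distinct p" "length p \<ge> 2" "hd p \<in> {a, y}" "last p \<in> {a, y}" "{a, y} \<notin> set (walk_edges p)"
    using p(1) by (auto simp: ear_def)
  obtain x x' w where pw: "p = x # x' # w" using pp(2) by (auto simp: Suc_le_length_iff numeral_2_eq_2)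
  have "hd p \<noteq> last p" using pp(1) pw by auto
  then have closing: "{last p, hd p} = {a, y}" using pp(3,4) by auto
  have "w \<noteq> []"
  proof
    assume "w = []"
    then have "{last p, hd p} \<in> set (walk_edges p)" using pw by (simp add: doubleton_eq_iff)
    then show False using closing pp(5) by simp
  qed
  then have "length p \<ge> 3" using pw by (cases w) auto
  moreover have "cycle_edges p = walk_edges p @ [{a, y}]"
    using closing pw by (simp add: cycle_edges_eq)
  ultimately have "is_cycle (edges B) p" using pp(1) p(2) y(1) by (simp add: is_cycle_def)
  then show ?thesis by blast
qed

section \<open>Theta graphs\<close>

lemma cycle_vertex_two_edges:
  assumes d: "is_cycle F d" and x: "x \<in> set d"
  obtains e f where "e \<in> F" "f \<in> F" "e \<noteq> f" "x \<in> e" "x \<in> f"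
proof -
  obtain d' where d': "is_cycle F d'" "hd d' = x" by (rule rotate_cycle_vertex[OF d x]) blast
  then have "length d' \<ge> 3" by (simp add: is_cycle_def)
  then obtain x' y z w where "d' = x' # y # z # w"
    by (auto simp: Suc_le_length_iff numeral_3_eq_3)
  then have w: "d' = x # y # z # w" using d'(2) by simp
  have "last d' \<noteq> y" using d'(1) w by (auto simp: is_cycle_def split: if_splits)
  then have "{x, y} \<noteq> {last d', x}" by (auto simp: doubleton_eq_iff)
  moreover have "{x, y} \<in> F" "{last d', x} \<in> F"
    using d'(1) w cycle_edges_eq[of d'] by (auto simp: is_cycle_def)
  ultimately show ?thesis using that[of "{x, y}" "{last d', x}"] by simp
qed

text \<open>The path can meet \<open>V\<close> only in its last vertex, so its first vertex has
  degree one and lies on no cycle. Peeling off vertices reduces the claim to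
  \<open>F\<close>.\<close>

lemma acyclic_pendant_path:
  assumes F: "\<And>d. \<not> is_cycle F d" "\<And>e. e \<in> F \<Longrightarrow> e \<subseteq> V"
    and w: "distinct w" "set (butlast w) \<inter> V = {}"
  shows "\<not> is_cycle (F \<union> set (walk_edges w)) d"
  using w
proof (induction w arbitrary: d rule: walk_edges.induct)
  case (1 x y w)
  let ?F = "F \<union> set (walk_edges (y # w))"
  show ?case
  proof
    assume d: "is_cycle (F \<union> set (walk_edges (x # y # w))) d"
    have at_x: "e = {x, y}" if "e \<in> F \<union> set (walk_edges (x # y # w))" "x \<in> e" for e
    proof (rule ccontr)
      assume "e \<noteq> {x, y}"
      then have "e \<in> F \<or> e \<in> set (walk_edges (y # w))" using that(1) by auto
      then show False
      proof
        assume "e \<in> F"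
        then show False using F(2)[of e] that(2) "1.prems"(2) by auto
      next
        assume "e \<in> set (walk_edges (y # w))"
        from walk_edges_subset[OF this] show False using that(2) "1.prems"(1) by auto
      qed
    qed
    have "x \<notin> set d"
    proof
      assume "x \<in> set d"
      then show False by (rule cycle_vertex_two_edges[OF d]) (use at_x in blast)
    qed
    then have "{x, y} \<notin> set (cycle_edges d)" using cycle_edges_subset by fastforce
    then have "is_cycle ?F d" using d by (auto simp: is_cycle_def)
    then show False using "1.IH" "1.prems" by auto
  qed
qed (use F in auto)

lemma acyclic_path:
  assumes "distinct w"
  shows "\<not> is_cycle (set (walk_edges w)) d"
proof -
  have "\<not> is_cycle {} d" for d :: "'a list"
  proof
    assume "is_cycle {} d"
    then have "cycle_edges d = []" "length d \<ge> 3" by (auto simp: is_cycle_def)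
    then show False using length_cycle_edges[of d] by simp
  qed
  then show ?thesis using acyclic_pendant_path[of "{}" "{}" w d] assms by simp
qed

lemma cycle_minus_edge_acyclic:
  assumes "is_cycle E c" "g \<in> set (cycle_edges c)"
  shows "\<not> is_cycle (set (cycle_edges c) - {g}) d"
proof
  assume d: "is_cycle (set (cycle_edges c) - {g}) d"
  obtain c' where c': "is_cycle E c'" "{last c', hd c'} = g"
    "set (cycle_edges c') = set (cycle_edges c)"
    by (rule rotate_cycle_edge[OF assms]) blast
  then have "set (cycle_edges c) - {g} \<subseteq> set (walk_edges c')"
    by (subst c'(3)[symmetric], subst cycle_edges_eq) (auto simp: is_cycle_def)
  then have "is_cycle (set (walk_edges c')) d" by (rule is_cycle_mono[OF d])
  then show False using acyclic_path c'(1) by (auto simp: is_cycle_def)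
qed

lemma path_colouring:
  fixes b :: bool
  assumes "distinct w"
  shows "\<exists>P. P (hd w) = b \<and> (\<forall>x y. {x, y} \<in> set (walk_edges w) \<longrightarrow> P x \<noteq> P y)"
  using assms
proof (induction w arbitrary: b rule: walk_edges.induct)
  case (1 x y w)
  then obtain P where P: "P y = (\<not> b)" "\<And>u v. {u, v} \<in> set (walk_edges (y # w)) \<Longrightarrow> P u \<noteq> P v"
    by (metis distinct.simps(2) list.sel(1))
  have "(P(x := b)) u \<noteq> (P(x := b)) v" if "{u, v} \<in> set (walk_edges (x # y # w))" for u v
  proof (cases "{u, v} = {x, y}")
    case True
    then show ?thesis using P(1) "1.prems" by (auto simp: doubleton_eq_iff)
  next
    case False
    then have uv: "{u, v} \<in> set (walk_edges (y # w))" using that by simp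
    then have "u \<noteq> x" "v \<noteq> x" using walk_edges_subset[OF uv] "1.prems" by auto
    then show ?thesis using P(2)[OF uv] by simp
  qed
  then show ?case by (intro exI[of _ "P(x := b)"]) simp
qed (auto intro: exI[of _ "\<lambda>_. b"])

text \<open>The colour flips along every edge, so only the parity of the length matters.\<close>

lemma walk_colour_last:
  assumes "\<And>x y. {x, y} \<in> set (walk_edges w) \<Longrightarrow> P x \<noteq> P y" "w \<noteq> []"
  shows "P (last w) = (P (hd w) = odd (length w))"
  using assms
proof (induction w rule: walk_edges.induct)
  case (1 x y w)
  have "P (last (y # w)) = (P y = odd (length (y # w)))" using 1 by simp
  moreover have "P x \<noteq> P y" using "1.prems"(1)[of x y] by simp
  ultimately show ?case by auto
qed auto

lemma bipartite_colouring:
  assumes "simple_graph G"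
  shows "bipartite G \<longleftrightarrow> (\<exists>P :: _ \<Rightarrow> bool. \<forall>x y. {x, y} \<in> edges G \<longrightarrow> P x \<noteq> P y)"
proof
  assume "bipartite G"
  then obtain U W where UW: "U \<inter> W = {}" "\<forall>e\<in>edges G. \<exists>u\<in>U. \<exists>w\<in>W. e = {u, w}"
    unfolding bipartite_def by blast
  have "(x \<in> U) \<noteq> (y \<in> U)" if xy: "{x, y} \<in> edges G" for x y
  proof -
    obtain u w where uw: "u \<in> U" "w \<in> W" "{x, y} = {u, w}"
      using bspec[OF UW(2) xy] by blast
    moreover have "w \<notin> U" using uw(2) UW(1) by blast
    ultimately show ?thesis by (auto simp: doubleton_eq_iff)
  qed
  then show "\<exists>P :: _ \<Rightarrow> bool. \<forall>x y. {x, y} \<in> edges G \<longrightarrow> P x \<noteq> P y" by (intro exI[of _ "\<lambda>x. x \<in> U"]) blast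
next
  assume "\<exists>P :: _ \<Rightarrow> bool. \<forall>x y. {x, y} \<in> edges G \<longrightarrow> P x \<noteq> P y"
  then obtain P :: "_ \<Rightarrow> bool" where P: "\<forall>x y. {x, y} \<in> edges G \<longrightarrow> P x \<noteq> P y" ..
  have "\<exists>u\<in>{v \<in> verts G. P v}. \<exists>w\<in>{v \<in> verts G. \<not> P v}. e = {u, w}" if e: "e \<in> edges G" for e
  proof -
    have ev: "e \<subseteq> verts G" "card e = 2" using simple_graphD[OF assms e] by auto
    obtain x y where xy: "e = {x, y}" using ev(2) by (auto simp: card_2_iff)
    have "P x \<noteq> P y" using P[rule_format, of x y] e xy by simp
    moreover have "x \<in> verts G" "y \<in> verts G" "{x, y} = {y, x}" using ev(1) xy by auto
    ultimately show ?thesis using xy by (cases "P x") blast+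
  qed
  then show "bipartite G" unfolding bipartite_def
    by (intro exI[of _ "{v \<in> verts G. P v}"] exI[of _ "{v \<in> verts G. \<not> P v}"]) auto
qed

lemma bipartite_even_cycle:
  assumes "simple_graph G" "bipartite G" "is_cycle (edges G) c"
  shows "even (length c)"
proof -
  from bipartite_colouring[OF assms(1)] assms(2)
  have "\<exists>P :: _ \<Rightarrow> bool. \<forall>x y. {x, y} \<in> edges G \<longrightarrow> P x \<noteq> P y" by (rule iffD1)
  then obtain P :: "_ \<Rightarrow> bool" where P: "\<forall>x y. {x, y} \<in> edges G \<longrightarrow> P x \<noteq> P y" ..
  have ne: "c \<noteq> []" using assms(3) by (auto simp: is_cycle_def)
  have "P x \<noteq> P y" if "{x, y} \<in> set (walk_edges (c @ [hd c]))" for x y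
    using P assms(3) that by (auto simp: is_cycle_def cycle_edges_def)
  then have "P (last (c @ [hd c])) = (P (hd (c @ [hd c])) = odd (length (c @ [hd c])))"
    by (rule walk_colour_last) simp_all
  then show ?thesis using ne by (cases "P (hd c)") simp_all
qed

text \<open>Normal form of a cycle with an ear: \<open>x\<close> and \<open>y\<close> are the ends
  of the ear, \<open>as\<close> and \<open>bs\<close> the interiors of the two arcs between them,
  and \<open>ps\<close> the interior of the ear.\<close>

lemma theta_arcs:
  assumes c: "is_cycle E c" and p: "ear (set c, set (cycle_edges c)) p"
  obtains x y as bs ps where "is_cycle E (x # as @ y # bs)" "set (x # as @ y # bs) = set c"
    "set (cycle_edges (x # as @ y # bs)) = set (cycle_edges c)" "length (x # as @ y # bs) = length c"
    "p = x # ps @ [y]" "set ps \<inter> set c = {}"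
proof -
  have pp: "distinct p" "length p \<ge> 2" "hd p \<in> set c" "last p \<in> set c" "set (butlast (tl p)) \<inter> set c = {}"
    using p by (auto simp: ear_def)
  obtain x x' q' where "p = x # x' # q'" using pp(2) by (auto simp: Suc_le_length_iff numeral_2_eq_2)
  then obtain q where xq: "p = x # q" "q \<noteq> []" by blast
  define y ps where "y = last q" and "ps = butlast q"
  have p': "p = x # ps @ [y]" using xq by (simp add: y_def ps_def)
  obtain c' where c': "is_cycle E c'" "hd c' = x" "set c' = set c" "length c' = length c"
    "set (cycle_edges c') = set (cycle_edges c)"
    using rotate_cycle_vertex[OF c, of x] pp(3) p' by auto
  obtain r where r: "c' = x # r" using c'(1,2) by (cases c') (auto simp: is_cycle_def)
  have "y \<in> set r" using pp(1,4) p' c'(3) r by auto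
  then obtain as bs where "r = as @ y # bs" by (meson split_list)
  then show ?thesis using that[of x as y bs ps] c' r p' pp(5) by simp
qed

lemma theta_cycle:
  assumes "distinct (x # as @ [y])" "distinct (x # ps @ [y])" "set as \<inter> set ps = {}"
    "as \<noteq> [] \<or> ps \<noteq> []" "set (walk_edges (x # as @ [y])) \<subseteq> E" "set (walk_edges (x # ps @ [y])) \<subseteq> E"
  shows "is_cycle E (x # as @ y # rev ps)"
    "set (cycle_edges (x # as @ y # rev ps)) = set (walk_edges (x # as @ [y])) \<union> set (walk_edges (x # ps @ [y]))"
proof -
  have "cycle_edges (x # as @ y # rev ps) = walk_edges ((x # as @ [y]) @ (rev ps @ [x]))"
    by (simp add: cycle_edges_def)
  also have "\<dots> = walk_edges (x # as @ [y]) @ walk_edges (y # rev ps @ [x])"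
    by (subst walk_edges_append) (auto simp: walk_edges_Cons)
  also have "y # rev ps @ [x] = rev (x # ps @ [y])" by simp
  finally show eq: "set (cycle_edges (x # as @ y # rev ps))
      = set (walk_edges (x # as @ [y])) \<union> set (walk_edges (x # ps @ [y]))"
    by (simp only: walk_edges_rev set_append set_rev)
  have "length (x # as @ y # rev ps) \<ge> 3" using assms(4) by (cases as; cases ps) auto
  then show "is_cycle E (x # as @ y # rev ps)"
    unfolding is_cycle_def eq using assms(1-3,5,6) by auto
qed

lemma cycle_arcs:
  "set (cycle_edges (x # as @ y # bs))
    = set (walk_edges (x # as @ [y])) \<union> set (walk_edges (x # rev bs @ [y]))"
proof -
  have "cycle_edges (x # as @ y # bs) = walk_edges ((x # as @ [y]) @ (bs @ [x]))"
    by (simp add: cycle_edges_def)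
  also have "\<dots> = walk_edges (x # as @ [y]) @ walk_edges (y # bs @ [x])"
    by (subst walk_edges_append) (auto simp: walk_edges_Cons)
  also have "y # bs @ [x] = rev (x # rev bs @ [y])" by simp
  finally show ?thesis by (simp only: walk_edges_rev set_append set_rev)
qed

text \<open>The ear closes up with each of the two arcs. Together the two cycles use every edge of
  \<open>c\<close> once and the ear twice.\<close>

lemma theta_cycles:
  assumes c: "is_cycle E c" and p: "ear (set c, set (cycle_edges c)) p" and pE: "set (walk_edges p) \<subseteq> E"
  obtains d d' where "is_cycle E d" "is_cycle E d'"
    "length d + length d' = length c + 2 * (length p - 1)"
    "set (walk_edges p) \<subseteq> set (cycle_edges d)" "set (walk_edges p) \<subseteq> set (cycle_edges d')"
proof -
  obtain x y as bs ps where c': "is_cycle E (x # as @ y # bs)" "set (x # as @ y # bs) = set c"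
    "set (cycle_edges (x # as @ y # bs)) = set (cycle_edges c)" "length (x # as @ y # bs) = length c"
    and p': "p = x # ps @ [y]" "set ps \<inter> set c = {}"
    by (rule theta_arcs[OF c p])
  have dist: "distinct (x # as @ y # bs)" "distinct p"
    using c'(1) p by (simp_all add: is_cycle_def ear_def)
  have dj: "set (walk_edges p) \<inter> set (cycle_edges (x # as @ y # bs)) = {}"
    using p c'(3) by (simp add: ear_def)
  have sub: "set (walk_edges (x # as @ [y])) \<subseteq> E" "set (walk_edges (x # rev bs @ [y])) \<subseteq> E"
    using c'(1) cycle_arcs[of x as y bs] by (auto simp: is_cycle_def)
  \<comment> \<open>An arc and the ear cannot both be the single edge between \<open>x\<close> and
    \<open>y\<close>, because the edges of an ear are new.\<close>
  have "as \<noteq> [] \<or> ps \<noteq> []" "rev bs \<noteq> [] \<or> ps \<noteq> []"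
    using dj unfolding cycle_arcs p'(1) by auto
  moreover have "set as \<inter> set ps = {}" "set (rev bs) \<inter> set ps = {}" using p'(2) c'(2) by auto
  moreover have "distinct (x # as @ [y])" "distinct (x # rev bs @ [y])" using dist(1) by auto
  ultimately show ?thesis
    using that[of "x # as @ y # rev ps" "x # rev bs @ y # rev ps"]
      theta_cycle[of x as y ps E] theta_cycle[of x "rev bs" y ps E] dist(2) sub pE c'(4) p'(1)
    by simp
qed

text \<open>If the cycle formed by the ear and one arc were even, alternating colourings of
  \<open>c\<close> and of the ear would agree at both ends of the ear and give a 2-colouring of the
  whole.\<close>

lemma bipartite_theta:
  assumes c: "is_cycle E c" "even (length c)" and p: "ear (set c, set (cycle_edges c)) p"
    and E: "\<forall>e\<in>E. card e = 2" and pE: "set (walk_edges p) \<subseteq> E"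
    and nb: "\<not> bipartite (set c \<union> set p, set (cycle_edges c) \<union> set (walk_edges p))"
  obtains d g where "is_cycle E d" "odd (length d)" "g \<in> set (cycle_edges c)" "g \<notin> set (cycle_edges d)"
    "set (walk_edges p) \<subseteq> set (cycle_edges d)"
proof -
  obtain x y as bs ps where c': "is_cycle E (x # as @ y # bs)" "set (x # as @ y # bs) = set c"
    "set (cycle_edges (x # as @ y # bs)) = set (cycle_edges c)" "length (x # as @ y # bs) = length c"
    and p': "p = x # ps @ [y]" "set ps \<inter> set c = {}"
    by (rule theta_arcs[OF c(1) p])
  have dist: "distinct (x # as @ y # bs)" "distinct p"
    using c'(1) p by (simp_all add: is_cycle_def ear_def)
  have dj: "set (walk_edges p) \<inter> set (cycle_edges (x # as @ y # bs)) = {}"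
    using p c'(3) by (simp add: ear_def)
  have sub: "set (walk_edges (x # as @ [y])) \<subseteq> E" "set (walk_edges (x # rev bs @ [y])) \<subseteq> E"
    using c'(1) cycle_arcs[of x as y bs] by (auto simp: is_cycle_def)
  have ne: "as \<noteq> [] \<or> ps \<noteq> []" using dj unfolding cycle_arcs p'(1) by auto
  have disj: "set as \<inter> set ps = {}" using p'(2) c'(2) by auto
  let ?d = "x # as @ y # rev ps"
  have d: "is_cycle E ?d" "set (cycle_edges ?d) = set (walk_edges (x # as @ [y])) \<union> set (walk_edges p)"
    using theta_cycle[of x as y ps E] dist sub(1) pE p'(1) ne disj by auto
  \<comment> \<open>The closing edge of the list lies on the arc with interior \<open>bs\<close>,
    hence not on the cycle through \<open>as\<close> and the ear.\<close>
  define g where "g = {last (x # as @ y # bs), x}"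
  have g: "g \<in> set (cycle_edges (x # as @ y # bs))" by (simp add: cycle_edges_eq g_def)
  have "g \<notin> set (walk_edges (x # as @ y # bs))"
    using closing_edge_notin_walk_edges[of "x # as @ y # bs"] c'(1) by (simp add: is_cycle_def g_def)
  moreover have "set (walk_edges (x # as @ [y])) \<subseteq> set (walk_edges (x # as @ y # bs))"
  proof (cases "bs = []")
    case False
    have "walk_edges (x # as @ y # bs) = walk_edges ((x # as @ [y]) @ bs)" by simp
    also have "\<dots> = walk_edges (x # as @ [y]) @ {last (x # as @ [y]), hd bs} # walk_edges bs"
      by (rule walk_edges_append) (use False in auto)
    finally show ?thesis by auto
  qed simp
  ultimately have gd: "g \<notin> set (cycle_edges ?d)" using g dj d(2) by blast
  have "odd (length ?d)"
  proof
    assume "even (length ?d)"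
    then have par: "even (length as + length ps)" by simp
    obtain P1 where P1: "P1 x" "\<And>u v. {u, v} \<in> set (walk_edges (x # as @ y # bs)) \<Longrightarrow> P1 u \<noteq> P1 v"
      using path_colouring[OF dist(1), of True] by auto
    obtain P2 where P2: "P2 x" "\<And>u v. {u, v} \<in> set (walk_edges p) \<Longrightarrow> P2 u \<noteq> P2 v"
      using path_colouring[OF dist(2), of True] p'(1) by auto
    \<comment> \<open>As \<open>c\<close> is even, the two ends of the list get different colours,
      so the colouring also respects the closing edge.\<close>
    have cl: "\<not> P1 (last (x # as @ y # bs))"
    proof -
      define L where "L = x # as @ y # bs"
      have L: "P1 (hd L)" "L \<noteq> []" "length L = length c" using P1(1) c'(4) by (simp_all add: L_def)
      have "P1 u \<noteq> P1 v" if "{u, v} \<in> set (walk_edges L)" for u v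
        using that unfolding L_def by (rule P1(2))
      then have "P1 (last L) = (P1 (hd L) = odd (length L))" by (rule walk_colour_last) (use L(2) in simp_all)
      then show ?thesis using L c(2) unfolding L_def[symmetric] by simp
    qed
    have P1c: "P1 u \<noteq> P1 v" if "{u, v} \<in> set (cycle_edges (x # as @ y # bs))" for u v
    proof (cases "{u, v} = g")
      case True
      then show ?thesis using cl P1(1) by (auto simp: g_def doubleton_eq_iff)
    next
      case False
      then have "{u, v} \<in> set (walk_edges (x # as @ y # bs))"
        using that by (simp add: cycle_edges_eq g_def)
      then show ?thesis by (rule P1(2))
    qed
    have "P1 y = odd (length as)"
    proof -
      have "P1 (last (x # as @ [y])) = (P1 (hd (x # as @ [y])) = odd (length (x # as @ [y])))"
        by (rule walk_colour_last) (use P1c cycle_arcs[of x as y bs] in auto)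
      then show ?thesis using P1(1) by simp
    qed
    moreover have "P2 y = odd (length ps)"
      using walk_colour_last[of p P2] P2 p'(1) by simp
    ultimately have Py: "P1 y = P2 y" using par by simp
    define P where "P v = (if v \<in> set c then P1 v else P2 v)" for v
    have colour: "P u \<noteq> P v" if uv: "{u, v} \<in> set (cycle_edges c) \<union> set (walk_edges p)" for u v
    proof (cases "{u, v} \<in> set (cycle_edges c)")
      case True
      then have "u \<in> set c" "v \<in> set c" using cycle_edges_subset[OF True] by auto
      then show ?thesis using P1c[of u v] True c'(3) by (simp add: P_def)
    next
      case False
      then have w: "{u, v} \<in> set (walk_edges p)" using uv by simp
      have "P z = P2 z" if "z \<in> set p" for z
        using that p' Py P1(1) P2(1) by (auto simp: P_def)
      then show ?thesis using P2(2)[OF w] walk_edges_subset[OF w] by auto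
    qed
    have sg: "simple_graph (set c \<union> set p, set (cycle_edges c) \<union> set (walk_edges p))"
      using E c(1) pE cycle_edges_subset walk_edges_subset
      unfolding simple_graph_def is_cycle_def fst_conv snd_conv by blast
    have "bipartite (set c \<union> set p, set (cycle_edges c) \<union> set (walk_edges p))"
      by (rule iffD2[OF bipartite_colouring[OF sg]]) (intro exI[of _ P] allI impI, rule colour, simp)
    then show False using nb by simp
  qed
  then show ?thesis using that[of ?d g] d g gd c'(3) by auto
qed

text \<open>Each ear raises the difference of the numbers of edges and vertices by one.\<close>

lemma two_ears_independent:
  assumes E: "finite E" and c: "is_cycle E c"
    and p: "ear (set c, set (cycle_edges c)) p" "set (walk_edges p) \<subseteq> E"
    and p': "ear (set c \<union> set p, set (cycle_edges c) \<union> set (walk_edges p)) p'" "set (walk_edges p') \<subseteq> E"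
  shows "independent_pair E"
proof -
  let ?F = "set (cycle_edges c) \<union> set (walk_edges p) \<union> set (walk_edges p')"
  let ?V = "set c \<union> set p \<union> set p'"
  have len: "length p \<ge> 2" "length p' \<ge> 2" using p(1) p'(1) by (simp_all add: ear_def)
  \<comment> \<open>Both ends of an ear are old vertices, so it adds only its interior, which has
    \<open>length r - 2\<close> vertices.\<close>
  have inner: "set r \<subseteq> V \<union> set (butlast (tl r))" if r: "length r \<ge> 2" "hd r \<in> V" "last r \<in> V" for r and V :: "'a set"
  proof
    fix v assume v: "v \<in> set r"
    obtain x x' q' where "r = x # x' # q'" using r(1) by (auto simp: Suc_le_length_iff numeral_2_eq_2)
    then obtain q where xq: "r = x # q" "q \<noteq> []" by blast
    have "set q = insert (last q) (set (butlast q))"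
      using arg_cong[OF append_butlast_last_id[OF xq(2)], of set] by simp
    moreover have "v = x \<or> v \<in> set q" using v xq(1) by simp
    moreover have "x \<in> V" "last q \<in> V" "butlast (tl r) = butlast q" using r xq by simp_all
    ultimately show "v \<in> V \<union> set (butlast (tl r))" by auto
  qed
  have "?V \<subseteq> set c \<union> set (butlast (tl p)) \<union> set (butlast (tl p'))"
  proof -
    have "set p \<subseteq> set c \<union> set (butlast (tl p))" using p(1) len by (intro inner) (simp_all add: ear_def)
    moreover have "set p' \<subseteq> (set c \<union> set p) \<union> set (butlast (tl p'))"
      using p'(1) len by (intro inner) (simp_all add: ear_def)
    ultimately show ?thesis by blast
  qed
  then have "card ?V \<le> card (set c \<union> set (butlast (tl p)) \<union> set (butlast (tl p')))" by (intro card_mono) auto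
  also have "\<dots> \<le> card (set c) + card (set (butlast (tl p))) + card (set (butlast (tl p')))"
    using card_Un_le[of "set c \<union> set (butlast (tl p))" "set (butlast (tl p'))"]
      card_Un_le[of "set c" "set (butlast (tl p))"] by linarith
  also have "\<dots> \<le> length c + (length p - 2) + (length p' - 2)"
    using card_length[of c] card_length[of "butlast (tl p)"] card_length[of "butlast (tl p')"] by simp
  finally have V: "card ?V \<le> length c + (length p - 2) + (length p' - 2)" .
  have dc: "card (set (cycle_edges c)) = length c"
    using distinct_card[OF distinct_cycle_edges[of c]] c by (simp add: is_cycle_def length_cycle_edges)
  have dp: "card (set (walk_edges p)) = length p - 1" "card (set (walk_edges p')) = length p' - 1"
  proof -
    have "distinct p" "distinct p'" using p(1) p'(1) by (simp_all add: ear_def)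
    then show "card (set (walk_edges p)) = length p - 1" "card (set (walk_edges p')) = length p' - 1"
      using distinct_card[OF distinct_walk_edges[of p]] distinct_card[OF distinct_walk_edges[of p']]
      by (simp_all add: length_walk_edges)
  qed
  \<comment> \<open>A cycle has as many edges as vertices, and each ear adds one more edge than
    vertices, so the surplus is two.\<close>
  have "card ?F = length c + (length p - 1) + (length p' - 1)"
  proof -
    have "card ?F = card (set (cycle_edges c) \<union> set (walk_edges p)) + card (set (walk_edges p'))"
      using p'(1) by (intro card_Un_disjoint) (auto simp: ear_def)
    also have "card (set (cycle_edges c) \<union> set (walk_edges p)) = length c + (length p - 1)"
      using p(1) dc dp by (subst card_Un_disjoint) (auto simp: ear_def)
    finally show ?thesis using dp by simp
  qed
  then have "card ?V + 2 \<le> card ?F" using V len by linarith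
  moreover have "\<Union>?F \<subseteq> ?V" using cycle_edges_subset walk_edges_subset by fastforce
  ultimately have "independent_pair ?F" by (intro independent_pair_if_many_edges[of _ ?V]) auto
  moreover have "?F \<subseteq> E" using c p(2) p'(2) by (auto simp: is_cycle_def)
  ultimately show ?thesis unfolding independent_pair_def using edge_lattice_mono[OF E] by meson
qed

section \<open>Graphs whose lattice is generated by one vector\<close>

definition generates :: "'v set set \<Rightarrow> ('v set \<Rightarrow> int) \<Rightarrow> bool" where
  "generates E y \<longleftrightarrow> y \<in> edge_lattice E \<and> (\<forall>z\<in>edge_lattice E. \<exists>k. \<forall>e. z e = k * y e)"

text \<open>Because \<open>y g\<close> is 1 or -1, a multiple of \<open>y\<close> can be subtracted
  so that the entry at \<open>g\<close> vanishes. The remainder lives on the other edges, where the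
  lattice is zero.\<close>

lemma generates_if_edge:
  assumes E: "finite E" and y: "y \<in> edge_lattice E" "\<bar>y g\<bar> = 1"
    and zero: "\<And>z e. z \<in> edge_lattice (E - {g}) \<Longrightarrow> z e = 0"
  shows "generates E y"
proof -
  have "\<exists>k. \<forall>e. z e = k * y e" if z: "z \<in> edge_lattice E" for z
  proof -
    define k where "k = z g * y g"
    define x where "x = (\<lambda>e. z e - k * y e)"
    have "y g * y g = 1" using y(2) by (metis abs_mult_self_eq mult_1)
    then have "x g = 0" by (simp add: x_def k_def mult.assoc)
    have xL: "x \<in> edge_lattice E"
      using edge_lattice_lincomb[OF z y(1), of 1 "- k"] by (simp add: x_def)
    have "x \<in> edge_lattice (E - {g})"
      by (rule edge_lattice_restrict[OF E _ xL]) (use \<open>x g = 0\<close> in auto)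
    from zero[OF this] have "z e = k * y e" for e by (simp add: x_def)
    then show ?thesis by blast
  qed
  then show ?thesis using y(1) by (simp add: generates_def)
qed

lemma generates_not_independent: "generates E y \<Longrightarrow> \<not> independent_pair E"
proof
  assume g: "generates E y" and "independent_pair E"
  then obtain z x e e' where zx: "z \<in> edge_lattice E" "x \<in> edge_lattice E" "z e * x e' \<noteq> z e' * x e"
    unfolding independent_pair_def by blast
  obtain k where "\<And>e. z e = k * y e" using g zx(1) unfolding generates_def by blast
  moreover obtain l where "\<And>e. x e = l * y e" using g zx(2) unfolding generates_def by blast
  ultimately show False using zx(3) by simp
qed

text \<open>A vector with an entry \<plusminus>1 is not a proper multiple. So any explicit vector of
  this kind determines the generator up to sign.\<close>

lemma generates_unit_vector:
  assumes "generates E y" "z \<in> edge_lattice E" "\<bar>z d\<bar> = 1"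
  shows "\<bar>y e\<bar> = \<bar>z e\<bar>"
proof -
  obtain k where k: "\<And>e. z e = k * y e" using assms(1,2) unfolding generates_def by blast
  have "k dvd 1" using assms(3) k[of d] by (metis abs_dvd_iff dvd_abs_iff dvd_triv_left)
  then have "\<bar>k\<bar> = 1" by simp
  then show ?thesis by (simp add: k abs_mult)
qed

section \<open>Shortest paths between vertex sets\<close>

lemma shortest_connection:
  assumes G: "simple_graph G" "connected_graph G"
    and A: "A \<subseteq> verts G" "A \<noteq> {}" and B: "B \<subseteq> verts G" "B \<noteq> {}"
  obtains p where "path_in G p" "length p = distance_between G A B + 1"
    "set p \<inter> A = {hd p}" "set p \<inter> B = {last p}"
proof -
  define Q where "Q p \<longleftrightarrow> path_in G p \<and> hd p \<in> A \<and> last p \<in> B" for p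
  define D where "D d \<longleftrightarrow> (\<exists>p. Q p \<and> length p = d + 1)" for d
  have dist: "distance_between G A B = (LEAST d. D d)"
    unfolding distance_between_def D_def Q_def by (simp only: conj_assoc)
  obtain a b where ab: "a \<in> A" "b \<in> B" using A(2) B(2) by blast
  have "\<not> disconnected G" using G(2) by (simp add: connected_graph_def)
  then obtain p0 where "path_in G p0" "hd p0 = a" "last p0 = b"
    unfolding disconnected_def using ab A(1) B(1) by blast
  then have "Q p0" "p0 \<noteq> []" using ab by (auto simp: Q_def path_in_def)
  then have "D (length p0 - 1)" unfolding D_def by (intro exI[of _ p0]) simp
  then have "D (distance_between G A B)" unfolding dist by (rule LeastI)
  then obtain p where p: "Q p" "length p = distance_between G A B + 1" unfolding D_def by blast
  have min: "length p \<le> length r" if "Q r" for r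
  proof -
    have "r \<noteq> []" using that by (auto simp: Q_def path_in_def)
    then have "D (length r - 1)" unfolding D_def using that by (intro exI[of _ r]) simp
    then have "distance_between G A B \<le> length r - 1" unfolding dist by (rule Least_le)
    then show ?thesis using p(2) \<open>r \<noteq> []\<close> by (cases r) auto
  qed
  have pp: "path_in G p" "hd p \<in> A" "last p \<in> B" "p \<noteq> []" using p(1) by (auto simp: Q_def path_in_def)
  have parts: "path_in G xs" "path_in G ys" if "p = xs @ ys" "xs \<noteq> []" "ys \<noteq> []" for xs ys
    using pp(1) that by (auto simp: path_in_def path_edges_eq walk_edges_append)
  \<comment> \<open>A later vertex in \<open>A\<close> would begin a shorter connecting path; the
    same holds for \<open>B\<close> at the other end.\<close>
  have "set p \<inter> A \<subseteq> {hd p}"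
  proof
    fix z assume z: "z \<in> set p \<inter> A"
    then obtain xs ys where s: "p = xs @ z # ys" by (meson IntD1 split_list)
    show "z \<in> {hd p}"
    proof (cases "xs = []")
      case False
      then have "Q (z # ys)" using parts(2)[of xs "z # ys"] s z pp(3) by (simp add: Q_def)
      from min[OF this] False s show ?thesis by simp
    qed (simp add: s)
  qed
  moreover have "set p \<inter> B \<subseteq> {last p}"
  proof
    fix z assume z: "z \<in> set p \<inter> B"
    then obtain xs ys where s: "p = xs @ z # ys" by (meson IntD1 split_list)
    show "z \<in> {last p}"
    proof (cases "ys = []")
      case False
      then have "path_in G (xs @ [z])" using parts(1)[of "xs @ [z]" ys] s by simp
      moreover have "hd (xs @ [z]) = hd p" using s by (cases xs) auto
      ultimately have "Q (xs @ [z])" using z pp(2) by (simp add: Q_def)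
      from min[OF this] False s show ?thesis by simp
    qed (simp add: s)
  qed
  moreover have "hd p \<in> set p" "last p \<in> set p" using pp(4) by simp_all
  ultimately have "set p \<inter> A = {hd p}" "set p \<inter> B = {last p}" using pp(2,3) by blast+
  then show ?thesis using that[of p] pp(1) p(2) by blast
qed

locale finite_connected_graph =
  fixes G :: "'v graph"
  assumes simple: "simple_graph G" and fin_verts: "finite (verts G)" and conn: "connected_graph G"
begin

abbreviation E where "E \<equiv> edges G"

lemma fin: "finite E"
  by (rule finite_subset[of _ "Pow (verts G)"]) (use simple fin_verts in \<open>auto simp: simple_graph_def\<close>)

lemma card2: "\<forall>e\<in>E. card e = 2"
  using simple by (simp add: simple_graph_def)

lemma block_simple: "B \<in> non_edge_blocks G \<Longrightarrow> simple_graph B"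
  by (simp add: non_edge_blocks_def block_iff nonseparable_def)

lemma block_nonseparable: "B \<in> non_edge_blocks G \<Longrightarrow> nonseparable B"
  by (simp add: non_edge_blocks_def block_iff)

lemma block_edges: "B \<in> non_edge_blocks G \<Longrightarrow> edges B \<subseteq> E"
  by (simp add: non_edge_blocks_def block_iff subgraph_def)

lemma block_disjoint:
  "B \<in> non_edge_blocks G \<Longrightarrow> B' \<in> non_edge_blocks G \<Longrightarrow> B \<noteq> B' \<Longrightarrow> edges B \<inter> edges B' = {}"
  unfolding non_edge_blocks_def mem_Collect_eq by (elim conjE) (rule blocks_edge_disjoint)

lemma block_cycle: "B \<in> non_edge_blocks G \<Longrightarrow> E \<noteq> {} \<Longrightarrow> \<exists>c. is_cycle (edges B) c"
  using non_edge_block_cycle[OF simple conn] .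

lemma cycle_block: "is_cycle E c \<Longrightarrow> \<exists>B\<in>non_edge_blocks G. is_cycle (edges B) c"
  using cycle_in_non_edge_block[OF simple fin_verts] by blast

lemma cycle_verts:
  assumes "simple_graph H" "is_cycle (edges H) c"
  shows "set c \<subseteq> verts H"
proof
  fix v assume "v \<in> set c"
  then obtain e where "e \<in> edges H" "v \<in> e" by (rule cycle_vertex_two_edges[OF assms(2)])
  then show "v \<in> verts H" using simple_graphD[OF assms(1)] by blast
qed

lemma cycle_edges_nonempty:
  assumes "is_cycle F c"
  obtains g where "g \<in> set (cycle_edges c)"
proof -
  have "length (cycle_edges c) \<ge> 3" using assms by (simp add: is_cycle_def length_cycle_edges)
  then show ?thesis using that by (cases "cycle_edges c") auto
qed

lemma block_cycle_meet:
  assumes "B \<in> non_edge_blocks G" "B' \<in> non_edge_blocks G" "B \<noteq> B'"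
    "is_cycle (edges B) c" "is_cycle (edges B') d" "x \<in> set c \<inter> set d" "y \<in> set c \<inter> set d"
  shows "x = y"
proof -
  have "set c \<subseteq> verts B" "set d \<subseteq> verts B'" using assms block_simple cycle_verts by blast+
  moreover have "block G B" "block G B'" using assms by (simp_all add: non_edge_blocks_def)
  ultimately show ?thesis using blocks_share_vertex[of G B B' x y] assms(3,6,7) by blast
qed

lemma block_ear:
  assumes B: "B \<in> non_edge_blocks G" and c: "is_cycle (edges B) c"
    and ne: "B \<noteq> (set c, set (cycle_edges c))"
  obtains p where "ear (set c, set (cycle_edges c)) p" "set (walk_edges p) \<subseteq> edges B"
proof -
  let ?C = "(set c, set (cycle_edges c))"
  have "\<forall>e\<in>edges B. card e = 2" using block_simple[OF B] by (simp add: simple_graph_def)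
  then have "nonseparable ?C" using c by (rule cycle_nonseparable)
  then have "subgraph ?C B"
    using c cycle_verts[OF block_simple[OF B] c] by (auto simp: subgraph_def nonseparable_def is_cycle_def)
  moreover obtain x y where "x \<in> set c" "y \<in> set c" "x \<noteq> y"
  proof -
    obtain x y w where "c = x # y # w" using c by (auto simp: is_cycle_def Suc_le_length_iff numeral_3_eq_3)
    then show ?thesis using that[of x y] c by (simp add: is_cycle_def)
  qed
  ultimately show ?thesis using ear_exists[OF block_nonseparable[OF B], of ?C x y] ne that by auto
qed

text \<open>\<open>W\<close> is the edge set of a shortest path between the cycles. If the cycles
  meet, the distance is 0 and the path consists of their common vertex.\<close>

lemma two_odd_cycles:
  assumes c: "is_cycle E c" "odd (length c)" and d: "is_cycle E d" "odd (length d)"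
    and meet: "\<And>x y. x \<in> set c \<inter> set d \<Longrightarrow> y \<in> set c \<inter> set d \<Longrightarrow> x = y"
  shows "\<exists>z\<in>edge_lattice E. \<exists>W.
    norm1 E z = int (length c + length d + 2 * distance_between G (set c) (set d)) \<and>
    (\<forall>e. \<bar>z e\<bar> = of_bool (e \<in> set (cycle_edges c)) + 2 * of_bool (e \<in> W)
      + of_bool (e \<in> set (cycle_edges d))) \<and>
    (\<forall>e \<in> set (cycle_edges c). \<bar>z e\<bar> = 1)"
proof -
  have cd: "set c \<subseteq> verts G" "set d \<subseteq> verts G" using cycle_verts[OF simple] c(1) d(1) by blast+
  have ne: "set c \<noteq> {}" "set d \<noteq> {}" using c d by (auto simp: is_cycle_def)
  obtain p where p: "path_in G p" "length p = distance_between G (set c) (set d) + 1"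
    "set p \<inter> set c = {hd p}" "set p \<inter> set d = {last p}"
    by (rule shortest_connection[OF simple conn cd(1) ne(1) cd(2) ne(2)])
  have "set c \<inter> set d \<subseteq> set p"
  proof
    fix v assume v: "v \<in> set c \<inter> set d"
    have "\<exists>r. path_in G r \<and> hd r \<in> set c \<and> last r \<in> set d \<and> length r = 0 + 1"
      using v cd by (intro exI[of _ "[v]"]) (auto simp: path_in_def path_edges_eq)
    then have "distance_between G (set c) (set d) \<le> 0" unfolding distance_between_def by (rule Least_le)
    then obtain u where u: "p = [u]" using p(2) by (auto simp: length_Suc_conv)
    then have "u \<in> set c \<inter> set d" using p(3,4) by auto
    then show "v \<in> set p" using meet[OF v] u by simp
  qed
  moreover have "p \<noteq> []" "distinct p" "set (walk_edges p) \<subseteq> E"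
    using p(1) by (simp_all add: path_in_def path_edges_eq)
  ultimately have "\<exists>z\<in>edge_lattice E. norm1 E z = int (length c + length d + 2 * (length p - 1)) \<and>
    (\<forall>e. \<bar>z e\<bar> = of_bool (e \<in> set (cycle_edges c)) + 2 * of_bool (e \<in> set (walk_edges p))
      + of_bool (e \<in> set (cycle_edges d))) \<and> (\<forall>e \<in> set (cycle_edges c). \<bar>z e\<bar> = 1)"
    using two_odd_cycles_vector[OF fin card2 c d, of p] p(3,4) by blast
  then obtain z where z: "z \<in> edge_lattice E"
    "norm1 E z = int (length c + length d + 2 * (length p - 1))"
    "\<forall>e. \<bar>z e\<bar> = of_bool (e \<in> set (cycle_edges c)) + 2 * of_bool (e \<in> set (walk_edges p))
      + of_bool (e \<in> set (cycle_edges d))" "\<forall>e \<in> set (cycle_edges c). \<bar>z e\<bar> = 1" by blast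
  show ?thesis
    by (intro bexI[of _ z] exI[of _ "set (walk_edges p)"] conjI) (use z p(2) in simp_all)
qed

text \<open>A cycle with one edge removed is a path, so an inner cycle cannot omit an edge.\<close>

lemma cycle_in_cycle:
  assumes "is_cycle F c" "is_cycle (set (cycle_edges c)) d"
  shows "set (cycle_edges d) = set (cycle_edges c)"
proof
  show "set (cycle_edges c) \<subseteq> set (cycle_edges d)"
  proof
    fix g assume g: "g \<in> set (cycle_edges c)"
    show "g \<in> set (cycle_edges d)"
    proof (rule ccontr)
      assume "g \<notin> set (cycle_edges d)"
      then have "is_cycle (set (cycle_edges c) - {g}) d" using assms(2) by (auto simp: is_cycle_def)
      then show False using cycle_minus_edge_acyclic[OF assms(1) g] by blast
    qed
  qed
qed (use assms(2) in \<open>simp add: is_cycle_def\<close>)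

section \<open>From the shape of the blocks to a generator\<close>

lemma generates_unicyclic:
  assumes N: "non_edge_blocks G = {(set c, set (cycle_edges c))}"
    and c: "is_cycle E c" "length c = 2 * q"
  shows "\<exists>y. generates E y \<and> norm1 E y = 2 * int q"
proof -
  obtain z where z: "z \<in> edge_lattice E" "norm1 E z = int (length c)"
    "\<And>e. \<bar>z e\<bar> = of_bool (e \<in> set (cycle_edges c))"
    using even_cycle_vector[OF fin card2 c(1)] c(2) by auto
  obtain g where g: "g \<in> set (cycle_edges c)" by (rule cycle_edges_nonempty[OF c(1)])
  \<comment> \<open>Every cycle lies in a non-edge block, here the cycle \<open>c\<close> itself, so
    it contains \<open>g\<close>.\<close>
  have acyc: "\<not> is_cycle (E - {g}) d" for d
  proof
    assume d: "is_cycle (E - {g}) d"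
    then have "is_cycle E d" by (rule is_cycle_mono) auto
    then obtain B where "B \<in> non_edge_blocks G" "is_cycle (edges B) d" using cycle_block by blast
    then have "is_cycle (set (cycle_edges c)) d" using N by simp
    then have "g \<in> set (cycle_edges d)" using cycle_in_cycle[OF c(1)] g by blast
    then show False using d by (auto simp: is_cycle_def)
  qed
  have "generates E z"
  proof (rule generates_if_edge[OF fin z(1)])
    show "\<bar>z g\<bar> = 1" using z(3) g by simp
    show "x e = 0" if "x \<in> edge_lattice (E - {g})" for x e
      using edge_lattice_forest[of "E - {g}" x] fin card2 acyc that by auto
  qed
  then show ?thesis using z(2) c(2) by auto
qed

text \<open>Deleting \<open>g\<close> breaks the first cycle and leaves only the odd cycle
  \<open>d\<close>, which carries no nonzero vector.\<close>

lemma edge_lattice_two_blocks: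
  assumes N: "non_edge_blocks G = {(set c, set (cycle_edges c)), (set d, set (cycle_edges d))}"
    and c: "is_cycle E c" and d: "is_cycle E d" "odd (length d)"
    and disj: "set (cycle_edges c) \<inter> set (cycle_edges d) = {}"
    and g: "g \<in> set (cycle_edges c)" and x: "x \<in> edge_lattice (E - {g})"
  shows "x e = 0"
proof -
  obtain f where f: "f \<in> set (cycle_edges d)" by (rule cycle_edges_nonempty[OF d(1)])
  have acyc: "\<not> is_cycle (E - {g} - {f}) r" for r
  proof
    assume r: "is_cycle (E - {g} - {f}) r"
    then have "is_cycle E r" by (rule is_cycle_mono) auto
    then have "is_cycle (set (cycle_edges c)) r \<or> is_cycle (set (cycle_edges d)) r"
      using cycle_block[of r] N by auto
    then have "g \<in> set (cycle_edges r) \<or> f \<in> set (cycle_edges r)"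
      using cycle_in_cycle[OF c] cycle_in_cycle[OF d(1)] f g by blast
    then show False using r by (auto simp: is_cycle_def)
  qed
  have "is_cycle (E - {g}) d" using d(1) g disj by (auto simp: is_cycle_def)
  then show ?thesis
    using edge_lattice_odd_unicyclic[of "E - {g}" d f x e] fin card2 d(2) f acyc x by auto
qed

lemma generates_even_odd:
  assumes N: "non_edge_blocks G = {(set c, set (cycle_edges c)), (set d, set (cycle_edges d))}"
    and c: "is_cycle E c" "length c = 2 * q" and d: "is_cycle E d" "odd (length d)"
    and disj: "set (cycle_edges c) \<inter> set (cycle_edges d) = {}"
  shows "\<exists>y. generates E y \<and> norm1 E y = 2 * int q"
proof -
  obtain z where z: "z \<in> edge_lattice E" "norm1 E z = int (length c)"
    "\<And>e. \<bar>z e\<bar> = of_bool (e \<in> set (cycle_edges c))"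
    using even_cycle_vector[OF fin card2 c(1)] c(2) by auto
  obtain g where g: "g \<in> set (cycle_edges c)" by (rule cycle_edges_nonempty[OF c(1)])
  have "generates E z"
  proof (rule generates_if_edge[OF fin z(1)])
    show "\<bar>z g\<bar> = 1" using z(3) g by simp
    show "x e = 0" if "x \<in> edge_lattice (E - {g})" for x e
      by (rule edge_lattice_two_blocks[OF N c(1) d disj g that])
  qed
  then show ?thesis using z(2) c(2) by auto
qed

lemma generates_odd_odd:
  assumes N: "non_edge_blocks G = {(set c, set (cycle_edges c)), (set d, set (cycle_edges d))}"
    and c: "is_cycle E c" "odd (length c)" and d: "is_cycle E d" "odd (length d)"
    and disj: "set (cycle_edges c) \<inter> set (cycle_edges d) = {}"
    and meet: "\<And>x y. x \<in> set c \<inter> set d \<Longrightarrow> y \<in> set c \<inter> set d \<Longrightarrow> x = y"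
    and len: "length c + length d + 2 * distance_between G (set c) (set d) = 2 * q"
  shows "\<exists>y. generates E y \<and> norm1 E y = 2 * int q"
proof -
  obtain z W where z: "z \<in> edge_lattice E"
    "norm1 E z = int (length c + length d + 2 * distance_between G (set c) (set d))"
    "\<And>e. e \<in> set (cycle_edges c) \<Longrightarrow> \<bar>z e\<bar> = 1"
    using two_odd_cycles[OF c d meet] by blast
  obtain g where g: "g \<in> set (cycle_edges c)" by (rule cycle_edges_nonempty[OF c(1)])
  have "generates E z"
  proof (rule generates_if_edge[OF fin z(1)])
    show "\<bar>z g\<bar> = 1" using z(3) g by simp
    show "x e = 0" if "x \<in> edge_lattice (E - {g})" for x e
      by (rule edge_lattice_two_blocks[OF N c(1) d disj g that])
  qed
  moreover have "norm1 E z = 2 * int q" using z(2) len by linarith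
  ultimately show ?thesis by blast
qed

text \<open>The even cycle carries the vector. The deleted edge \<open>g\<close> is chosen on it but
  off an odd cycle \<open>d\<close> through the ear; without \<open>g\<close> the cycles are
  controlled by an edge \<open>f\<close> of \<open>d\<close>.\<close>

lemma generates_theta:
  assumes N: "non_edge_blocks G = {B}" and c: "is_cycle (edges B) c" "length c = 2 * q"
    and p: "ear (set c, set (cycle_edges c)) p" "set (walk_edges p) \<subseteq> edges B"
    and B: "B = (set c \<union> set p, set (cycle_edges c) \<union> set (walk_edges p))"
    and nb: "\<not> bipartite B"
  shows "\<exists>y. generates E y \<and> norm1 E y = 2 * int q"
proof -
  have BE: "edges B \<subseteq> E" using block_edges[of B] N by simp
  have cE: "is_cycle E c" using c(1) BE by (rule is_cycle_mono)
  obtain z where z: "z \<in> edge_lattice E" "norm1 E z = int (length c)"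
    "\<And>e. \<bar>z e\<bar> = of_bool (e \<in> set (cycle_edges c))"
    using even_cycle_vector[OF fin card2 cE] c(2) by auto
  have B2: "\<forall>e\<in>edges B. card e = 2" using card2 BE by blast
  have "even (length c)" using c(2) by simp
  then obtain d g where d: "is_cycle (edges B) d" "odd (length d)"
    and g: "g \<in> set (cycle_edges c)" "g \<notin> set (cycle_edges d)"
    and pd: "set (walk_edges p) \<subseteq> set (cycle_edges d)"
    using bipartite_theta[OF c(1) _ p(1) B2 p(2)] nb B by metis
  have pp: "distinct p" "length p \<ge> 2" "set (butlast (tl p)) \<inter> set c = {}"
    using p(1) by (simp_all add: ear_def)
  obtain a a' w where pw: "p = a # a' # w" using pp(2) by (auto simp: Suc_le_length_iff numeral_2_eq_2)
  define f where "f = {a, a'}"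
  have f: "f \<in> set (cycle_edges d)" using pd pw by (simp add: f_def)
  obtain c' where c': "is_cycle (edges B) c'" "{last c', hd c'} = g" "set c' = set c"
    "set (cycle_edges c') = set (cycle_edges c)"
    by (rule rotate_cycle_edge[OF c(1) g(1)]) blast
  have c'_path: "set (cycle_edges c) - {g} \<subseteq> set (walk_edges c')"
    using c'(1,2) by (subst c'(4)[symmetric], subst cycle_edges_eq) (auto simp: is_cycle_def)
  \<comment> \<open>Without \<open>g\<close> and the first ear edge \<open>f\<close>, the block is a
    path with the rest of the ear hanging from one of its vertices.\<close>
  have no: "\<not> is_cycle (set (walk_edges c') \<union> set (walk_edges (a' # w))) r" for r
  proof (rule acyclic_pendant_path[of _ "set c"])
    have "distinct c'" using c'(1) by (simp add: is_cycle_def)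
    then show "\<not> is_cycle (set (walk_edges c')) d" for d by (rule acyclic_path)
    show "e \<subseteq> set c" if "e \<in> set (walk_edges c')" for e
      using walk_edges_subset[OF that] c'(3) by simp
  qed (use pp pw in auto)
  have acyc: "\<not> is_cycle (E - {g} - {f}) r" for r
  proof
    assume r: "is_cycle (E - {g} - {f}) r"
    then have "is_cycle E r" by (rule is_cycle_mono) auto
    then have "is_cycle (edges B) r" using cycle_block[of r] N by auto
    then have "set (cycle_edges r) \<subseteq> set (cycle_edges c) \<union> set (walk_edges p)"
      by (simp add: B is_cycle_def)
    then have "set (cycle_edges r) \<subseteq> set (walk_edges c') \<union> set (walk_edges (a' # w))"
      using r c'_path unfolding is_cycle_def pw f_def by auto
    then have "is_cycle (set (walk_edges c') \<union> set (walk_edges (a' # w))) r"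
      using r by (simp add: is_cycle_def)
    then show False using no by blast
  qed
  have "is_cycle (E - {g}) d" using d(1) g(2) BE by (auto simp: is_cycle_def)
  then have zero: "x e = 0" if "x \<in> edge_lattice (E - {g})" for x e
    using edge_lattice_odd_unicyclic[of "E - {g}" d f x e] fin card2 d(2) f acyc that by auto
  have "generates E z"
    by (rule generates_if_edge[OF fin z(1), of g]) (use z(3) g(1) zero in auto)
  then show ?thesis using z(2) c(2) by auto
qed

end

section \<open>From a generator to the shape of the blocks\<close>

context finite_connected_graph
begin

text \<open>A cycle and an ear form three cycles whose lengths have an even sum, so they are not all
  odd.\<close>

lemma odd_block_is_cycle:
  assumes B: "B \<in> non_edge_blocks G" and c: "is_cycle (edges B) c"
    and odd: "\<And>d. is_cycle (edges B) d \<Longrightarrow> odd (length d)"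
  shows "B = (set c, set (cycle_edges c))"
proof (rule ccontr)
  assume "B \<noteq> (set c, set (cycle_edges c))"
  then obtain p where p: "ear (set c, set (cycle_edges c)) p" "set (walk_edges p) \<subseteq> edges B"
    by (rule block_ear[OF B c])
  obtain d d' where d: "is_cycle (edges B) d" "is_cycle (edges B) d'"
    "length d + length d' = length c + 2 * (length p - 1)"
    by (rule theta_cycles[OF c p]) blast
  then have "even (length c + length d + length d')"
    by (metis add.commute add.left_commute even_add even_mult_iff even_numeral)
  then show False using odd[OF c] odd[OF d(1)] odd[OF d(2)] by simp
qed

context
  fixes y :: "'v set \<Rightarrow> int" and q :: nat
  assumes gen: "generates E y" and norm: "norm1 E y = 2 * int q" and q: "q > 0"
begin

lemma edges_nonempty: "E \<noteq> {}"
  using norm q by (auto simp: norm1_def)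

lemma y_nonzero: "\<exists>e. y e \<noteq> 0"
proof (rule ccontr)
  assume "\<nexists>e. y e \<noteq> 0"
  then show False using norm q by (simp add: norm1_def)
qed

lemma unit_vector:
  assumes "z \<in> edge_lattice E" "\<bar>z d\<bar> = 1"
  shows "\<bar>y e\<bar> = \<bar>z e\<bar>" "norm1 E z = 2 * int q"
proof -
  show abs: "\<bar>y e\<bar> = \<bar>z e\<bar>" for e using generates_unit_vector[OF gen assms] .
  show "norm1 E z = 2 * int q" using norm by (simp add: norm1_def abs)
qed

text \<open>The vector of an even cycle has entries \<plusminus>1, so it agrees with
  \<open>y\<close> up to sign. Hence all even cycles have the same edges.\<close>

lemma even_cycle:
  assumes c: "is_cycle E c" "even (length c)"
  shows "length c = 2 * q" "\<bar>y e\<bar> = of_bool (e \<in> set (cycle_edges c))"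
proof -
  obtain z where z: "z \<in> edge_lattice E" "norm1 E z = int (length c)"
    "\<And>e. \<bar>z e\<bar> = of_bool (e \<in> set (cycle_edges c))"
    using even_cycle_vector[OF fin card2 c] by auto
  obtain g where "g \<in> set (cycle_edges c)" by (rule cycle_edges_nonempty[OF c(1)])
  then have "\<bar>z g\<bar> = 1" using z(3) by simp
  from unit_vector[OF z(1) this] z(2,3)
  show "length c = 2 * q" "\<bar>y e\<bar> = of_bool (e \<in> set (cycle_edges c))" by simp_all
qed

lemma odd_pair:
  assumes c: "is_cycle E c" "odd (length c)" and d: "is_cycle E d" "odd (length d)"
    and meet: "\<And>x y. x \<in> set c \<inter> set d \<Longrightarrow> y \<in> set c \<inter> set d \<Longrightarrow> x = y"
  shows "length c + length d + 2 * distance_between G (set c) (set d) = 2 * q"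
    "\<exists>W. \<forall>e. \<bar>y e\<bar> = of_bool (e \<in> set (cycle_edges c)) + 2 * of_bool (e \<in> W)
       + of_bool (e \<in> set (cycle_edges d))"
proof -
  obtain z W where z: "z \<in> edge_lattice E"
    "norm1 E z = int (length c + length d + 2 * distance_between G (set c) (set d))"
    "\<And>e. \<bar>z e\<bar> = of_bool (e \<in> set (cycle_edges c)) + 2 * of_bool (e \<in> W) + of_bool (e \<in> set (cycle_edges d))"
    "\<And>e. e \<in> set (cycle_edges c) \<Longrightarrow> \<bar>z e\<bar> = 1"
    using two_odd_cycles[OF c d meet] by blast
  obtain g where "g \<in> set (cycle_edges c)" by (rule cycle_edges_nonempty[OF c(1)])
  then have g: "\<bar>z g\<bar> = 1" using z(4) by simp
  have "int (length c + length d + 2 * distance_between G (set c) (set d)) = 2 * int q"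
    using unit_vector(2)[OF z(1) g] z(2) by simp
  then show "length c + length d + 2 * distance_between G (set c) (set d) = 2 * q" by linarith
  show "\<exists>W. \<forall>e. \<bar>y e\<bar> = of_bool (e \<in> set (cycle_edges c)) + 2 * of_bool (e \<in> W)
       + of_bool (e \<in> set (cycle_edges d))"
    using unit_vector(1)[OF z(1) g] z(3) by auto
qed

text \<open>The support of \<open>y\<close> is the even cycle \<open>c\<close> inside
  \<open>B\<close>. An even cycle elsewhere, or two odd cycles in different blocks, would put an
  edge outside \<open>B\<close> into the support.\<close>

lemma even_block:
  assumes B: "B \<in> non_edge_blocks G" and c: "is_cycle (edges B) c" "even (length c)"
  shows "\<And>B'. B' \<in> non_edge_blocks G \<Longrightarrow> B' \<noteq> B \<Longrightarrow>
      \<exists>d. is_cycle E d \<and> odd (length d) \<and> B' = (set d, set (cycle_edges d))"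
    "\<And>B' B''. B' \<in> non_edge_blocks G \<Longrightarrow> B'' \<in> non_edge_blocks G \<Longrightarrow> B' \<noteq> B \<Longrightarrow> B'' \<noteq> B \<Longrightarrow> B' = B''"
    "B \<noteq> (set c, set (cycle_edges c)) \<Longrightarrow> non_edge_blocks G = {B} \<and> \<not> bipartite B \<and>
       (\<exists>p. add_path_to_cycle (set c, set (cycle_edges c)) p B)"
    "length c = 2 * q"
proof -
  have cE: "is_cycle E c" by (rule is_cycle_mono[OF c(1) block_edges[OF B]])
  note ev = even_cycle[OF cE c(2)]
  show "length c = 2 * q" by (rule ev(1))
  have y_zero: "y e = 0" if "e \<notin> edges B" for e
  proof -
    have "e \<notin> set (cycle_edges c)" using that c(1) by (auto simp: is_cycle_def)
    then show ?thesis using ev(2)[of e] by simp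
  qed
  have other_odd: "odd (length d)"
    if B': "B' \<in> non_edge_blocks G" "B' \<noteq> B" and d: "is_cycle (edges B') d" for B' d
  proof
    assume "even (length d)"
    obtain g where g: "g \<in> set (cycle_edges d)" by (rule cycle_edges_nonempty[OF d])
    have "is_cycle E d" by (rule is_cycle_mono[OF d block_edges[OF B'(1)]])
    from even_cycle(2)[OF this \<open>even (length d)\<close>, of g] g have "y g \<noteq> 0" by auto
    moreover have "g \<notin> edges B" using block_disjoint[OF B'(1) B B'(2)] g d by (auto simp: is_cycle_def)
    ultimately show False using y_zero by blast
  qed
  \<comment> \<open>The case \<open>B'' = B\<close> is allowed: it rules out a second block once
    \<open>B\<close> contains an odd cycle.\<close>
  have odd_pair_absurd: False
    if B': "B' \<in> non_edge_blocks G" "B'' \<in> non_edge_blocks G" "B' \<noteq> B" "B' \<noteq> B''"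
      and d: "is_cycle (edges B') d" and d': "is_cycle (edges B'') d'" "odd (length d')" for B' B'' d d'
  proof -
    have "is_cycle E d" "is_cycle E d'"
      using is_cycle_mono[OF d block_edges[OF B'(1)]] is_cycle_mono[OF d'(1) block_edges[OF B'(2)]] .
    from odd_pair(2)[OF this(1) other_odd[OF B'(1,3) d] this(2) d'(2)]
    obtain W where W: "\<And>e. \<bar>y e\<bar> = of_bool (e \<in> set (cycle_edges d)) + 2 * of_bool (e \<in> W)
       + of_bool (e \<in> set (cycle_edges d'))"
      using block_cycle_meet[OF B'(1,2,4) d d'(1)] by blast
    obtain g where g: "g \<in> set (cycle_edges d)" by (rule cycle_edges_nonempty[OF d])
    then have "\<bar>y g\<bar> \<ge> 1" unfolding W by (simp add: of_bool_def)
    then have "y g \<noteq> 0" by auto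
    moreover have "g \<notin> edges B" using block_disjoint[OF B'(1) B B'(3)] g d by (auto simp: is_cycle_def)
    ultimately show False using y_zero by blast
  qed
  show others: "\<exists>d. is_cycle E d \<and> odd (length d) \<and> B' = (set d, set (cycle_edges d))"
    if B': "B' \<in> non_edge_blocks G" "B' \<noteq> B" for B'
  proof -
    obtain d where d: "is_cycle (edges B') d" using block_cycle[OF B'(1) edges_nonempty] by blast
    have "is_cycle E d" by (rule is_cycle_mono[OF d block_edges[OF B'(1)]])
    moreover have "B' = (set d, set (cycle_edges d))"
      by (rule odd_block_is_cycle[OF B'(1) d]) (rule other_odd[OF B'])
    ultimately show ?thesis using other_odd[OF B' d] by blast
  qed
  show "B' = B''" if BB: "B' \<in> non_edge_blocks G" "B'' \<in> non_edge_blocks G" "B' \<noteq> B" "B'' \<noteq> B" for B' B''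
  proof (rule ccontr)
    assume "B' \<noteq> B''"
    obtain d where d: "is_cycle (edges B') d" using block_cycle[OF BB(1) edges_nonempty] by blast
    obtain d' where d': "is_cycle (edges B'') d'" using block_cycle[OF BB(2) edges_nonempty] by blast
    show False
      by (rule odd_pair_absurd[OF BB(1,2,3) \<open>B' \<noteq> B''\<close> d d' other_odd[OF BB(2,4) d']])
  qed
  assume "B \<noteq> (set c, set (cycle_edges c))"
  then obtain p where p: "ear (set c, set (cycle_edges c)) p" "set (walk_edges p) \<subseteq> edges B"
    by (rule block_ear[OF B c(1)])
  obtain d where d: "is_cycle (edges B) d" "set (walk_edges p) \<subseteq> set (cycle_edges d)"
    by (rule theta_cycles[OF c(1) p]) blast
  have dE: "is_cycle E d" by (rule is_cycle_mono[OF d(1) block_edges[OF B]])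
  \<comment> \<open>If \<open>d\<close> were even, the ear edges on it would be in the support of
    \<open>y\<close>, which is \<open>c\<close>.\<close>
  have d_odd: "odd (length d)"
  proof
    assume "even (length d)"
    obtain a a' w where "p = a # a' # w"
      using p(1) by (auto simp: ear_def Suc_le_length_iff numeral_2_eq_2)
    then have g: "{a, a'} \<in> set (walk_edges p)" by simp
    then have "y {a, a'} \<noteq> 0" using even_cycle(2)[OF dE \<open>even (length d)\<close>, of "{a, a'}"] d(2) by auto
    moreover have "{a, a'} \<notin> set (cycle_edges c)" using g p(1) by (auto simp: ear_def)
    ultimately show False using ev(2)[of "{a, a'}"] by simp
  qed
  have single: "B' = B" if B': "B' \<in> non_edge_blocks G" for B'
  proof (rule ccontr)
    assume ne: "B' \<noteq> B"
    obtain d' where d': "is_cycle (edges B') d'" using block_cycle[OF B' edges_nonempty] by blast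
    show False by (rule odd_pair_absurd[OF B' B ne ne d' d(1) d_odd])
  qed
  have "\<not> bipartite B" using bipartite_even_cycle[OF block_simple[OF B] _ d(1)] d_odd by blast
  moreover have "add_path_to_cycle (set c, set (cycle_edges c)) p B"
  proof -
    let ?H = "(set c \<union> set p, set (cycle_edges c) \<union> set (walk_edges p))"
    \<comment> \<open>A block larger than the cycle with one ear has a second ear, which gives an
      independent pair.\<close>
    have eq: "B = ?H"
    proof (rule ccontr)
      assume ne: "B \<noteq> ?H"
      have simpleB: "simple_graph B" by (rule block_simple[OF B])
      have "e \<subseteq> set c \<union> set p \<and> card e = 2" if "e \<in> set (cycle_edges c) \<union> set (walk_edges p)" for e
        using that cycle_edges_subset[of e c] walk_edges_subset[of e p] simple_graphD[OF simpleB, of e] c(1) p(2)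
        by (auto simp: is_cycle_def)
      then have "simple_graph ?H" by (simp add: simple_graph_def)
      moreover have "set p \<subseteq> verts B"
      proof
        fix v assume "v \<in> set p"
        have incident: "v \<in> \<Union>(set (walk_edges r))" if "v \<in> set r" "length r \<ge> 2" for r
          using that
        proof (induction r rule: walk_edges.induct)
          case (1 x y w)
          then show ?case by (cases w) auto
        qed auto
        have "length p \<ge> 2" using p(1) by (simp add: ear_def)
        then obtain e where "e \<in> set (walk_edges p)" "v \<in> e" using incident[OF \<open>v \<in> set p\<close>] by blast
        then show "v \<in> verts B" using p(2) simple_graphD[OF simpleB, of e] by blast
      qed
      ultimately have "subgraph ?H B"
        using cycle_verts[OF simpleB c(1)] c(1) p(2) by (auto simp: subgraph_def is_cycle_def)
      moreover obtain u v where "u \<in> verts ?H" "v \<in> verts ?H" "u \<noteq> v"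
      proof -
        obtain x y w where "c = x # y # w" using c(1) by (auto simp: is_cycle_def Suc_le_length_iff numeral_3_eq_3)
        then show ?thesis using that[of x y] c(1) by (simp add: is_cycle_def)
      qed
      ultimately obtain p' where p': "ear ?H p'" "set (walk_edges p') \<subseteq> edges B"
        using ear_exists[OF block_nonseparable[OF B], of ?H u v] ne by metis
      have "independent_pair E"
        by (rule two_ears_independent[OF fin cE p(1) _ p'(1)]) (use p(2) p'(2) block_edges[OF B] in auto)
      then show False using generates_not_independent[OF gen] by blast
    qed
    show ?thesis unfolding add_path_to_cycle_def path_edges_eq
      using p(1) eq by (simp add: ear_def)
  qed
  ultimately show "non_edge_blocks G = {B} \<and> \<not> bipartite B \<and>
      (\<exists>p. add_path_to_cycle (set c, set (cycle_edges c)) p B)"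
    using single B by blast
qed

text \<open>With no cycle, or with a single odd cycle, the lattice is zero, so there are at least
  two blocks. A third block would give contradictory entries of \<open>y\<close>.\<close>

lemma odd_blocks:
  assumes odd: "\<And>B c. B \<in> non_edge_blocks G \<Longrightarrow> is_cycle (edges B) c \<Longrightarrow> odd (length c)"
  obtains c d where "is_cycle E c" "odd (length c)" "is_cycle E d" "odd (length d)"
    "non_edge_blocks G = {(set c, set (cycle_edges c)), (set d, set (cycle_edges d))}"
    "(set c, set (cycle_edges c)) \<noteq> (set d, set (cycle_edges d))"
    "length c + length d + 2 * distance_between G (set c) (set d) = 2 * q"
    "\<And>x y. x \<in> set c \<inter> set d \<Longrightarrow> y \<in> set c \<inter> set d \<Longrightarrow> x = y"
proof -
  have cyc: "\<exists>c. is_cycle (edges B) c \<and> is_cycle E c \<and> odd (length c) \<and> B = (set c, set (cycle_edges c))"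
    if B: "B \<in> non_edge_blocks G" for B
  proof -
    obtain c where c: "is_cycle (edges B) c" using block_cycle[OF B edges_nonempty] by blast
    have "B = (set c, set (cycle_edges c))" by (rule odd_block_is_cycle[OF B c]) (rule odd[OF B])
    then show ?thesis using c is_cycle_mono[OF c block_edges[OF B]] odd[OF B c] by blast
  qed
  obtain e0 where e0: "y e0 \<noteq> 0" using y_nonzero by blast
  have yL: "y \<in> edge_lattice E" using gen by (simp add: generates_def)
  have "non_edge_blocks G \<noteq> {}"
  proof
    assume "non_edge_blocks G = {}"
    then have "\<not> is_cycle E c" for c using cycle_block[of c] by auto
    then show False using edge_lattice_forest[OF fin card2 _ yL, of e0] e0 by simp
  qed
  then obtain B where B: "B \<in> non_edge_blocks G" by blast
  obtain c where c: "is_cycle (edges B) c" "is_cycle E c" "odd (length c)" "B = (set c, set (cycle_edges c))"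
    using cyc[OF B] by blast
  have "\<exists>B'\<in>non_edge_blocks G. B' \<noteq> B"
  proof (rule ccontr)
    assume only: "\<not> ?thesis"
    obtain f where f: "f \<in> set (cycle_edges c)" by (rule cycle_edges_nonempty[OF c(2)])
    have "\<not> is_cycle (E - {f}) d" for d
    proof
      assume d: "is_cycle (E - {f}) d"
      then have "is_cycle E d" by (rule is_cycle_mono) auto
      then obtain B' where "B' \<in> non_edge_blocks G" "is_cycle (edges B') d" using cycle_block by blast
      then have "is_cycle (set (cycle_edges c)) d" using only c(4) by (metis snd_conv)
      then have "f \<in> set (cycle_edges d)" using cycle_in_cycle[OF c(2)] f by blast
      then show False using d by (auto simp: is_cycle_def)
    qed
    then have "y e0 = 0" by (rule edge_lattice_odd_unicyclic[OF fin card2 c(2,3) f _ yL])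
    then show False using e0 by simp
  qed
  then obtain B' where B': "B' \<in> non_edge_blocks G" "B' \<noteq> B" by blast
  obtain d where d: "is_cycle (edges B') d" "is_cycle E d" "odd (length d)" "B' = (set d, set (cycle_edges d))"
    using cyc[OF B'(1)] by blast
  have meet: "x = z" if "x \<in> set c \<inter> set d" "z \<in> set c \<inter> set d" for x z
    by (rule block_cycle_meet[OF B B'(1) B'(2)[symmetric] c(1) d(1) that])
  obtain W where W: "\<And>e. \<bar>y e\<bar> = of_bool (e \<in> set (cycle_edges c)) + 2 * of_bool (e \<in> W)
       + of_bool (e \<in> set (cycle_edges d))"
    using odd_pair(2)[OF c(2,3) d(2,3)] meet by blast
  have "B'' \<in> {B, B'}" if B'': "B'' \<in> non_edge_blocks G" for B''
  proof (rule ccontr)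
    assume ne: "B'' \<notin> {B, B'}"
    then have ne': "B'' \<noteq> B" "B'' \<noteq> B'" "B \<noteq> B''" by auto
    obtain r where r: "is_cycle (edges B'') r" "is_cycle E r" "odd (length r)"
      using cyc[OF B''] by blast
    have meet': "x = z" if "x \<in> set c \<inter> set r" "z \<in> set c \<inter> set r" for x z
      by (rule block_cycle_meet[OF B B'' ne'(3) c(1) r(1) that])
    obtain W' where W': "\<And>e. \<bar>y e\<bar> = of_bool (e \<in> set (cycle_edges c)) + 2 * of_bool (e \<in> W')
       + of_bool (e \<in> set (cycle_edges r))"
      using odd_pair(2)[OF c(2,3) r(2,3)] meet' by blast
    obtain g where g: "g \<in> set (cycle_edges r)" by (rule cycle_edges_nonempty[OF r(2)])
    have "g \<in> edges B''" using g r(1) by (auto simp: is_cycle_def)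
    then have "g \<notin> set (cycle_edges c)" "g \<notin> set (cycle_edges d)"
      using block_disjoint[OF B'' B ne'(1)] block_disjoint[OF B'' B'(1) ne'(2)] c(4) d(4) by auto
    \<comment> \<open>On an edge of the third block, the pair \<open>c\<close>, \<open>d\<close>
      makes \<bar>y g\<bar> even, while the pair \<open>c\<close>, \<open>r\<close> makes it
      odd.\<close>
    then show False using W[of g] W'[of g] g by (auto simp: of_bool_def split: if_splits)
  qed
  then have N: "non_edge_blocks G = {B, B'}" using B B'(1) by blast
  show ?thesis
  proof (rule that[OF c(2,3) d(2,3)])
    show "non_edge_blocks G = {(set c, set (cycle_edges c)), (set d, set (cycle_edges d))}"
      using N c(4) d(4) by simp
    show "(set c, set (cycle_edges c)) \<noteq> (set d, set (cycle_edges d))"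
      using B'(2)[symmetric] unfolding c(4) d(4) .
    show "length c + length d + 2 * distance_between G (set c) (set d) = 2 * q"
      using odd_pair(1)[OF c(2,3) d(2,3)] meet by blast
  qed (rule meet)
qed

end

end

section \<open>The equivalence for edge rings\<close>

lemma linear_resolution_iff_generates:
  fixes E :: "'v set set"
  assumes E: "finite E" "\<forall>e\<in>E. card e = 2" and q: "q \<ge> 3"
  shows "has_linear_resolution E (toric E :: ('v set, 'k::field) mpoly set) q
    \<longleftrightarrow> (\<exists>y. generates E y \<and> norm1 E y = 2 * int q)"
proof
  assume lin: "has_linear_resolution E (toric E :: ('v set, 'k) mpoly set) q"
  have "\<exists>y\<in>edge_lattice E. norm1 E y = 2 * int q \<and> (\<forall>z\<in>edge_lattice E. \<exists>k. \<forall>e. z e = k * y e)"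
  proof (rule linear_resolution_cyclic[OF E q lin])
    fix a b c d :: 'v
    assume m: "min_norm E (2 * int q)" and "distinct [a, b, c, d]" "{{a, b}, {b, c}, {c, d}, {d, a}} \<subseteq> E"
    then show False using no_four_cycle[OF E m] q by simp
  qed
  then show "\<exists>y. generates E y \<and> norm1 E y = 2 * int q" unfolding generates_def by blast
next
  assume "\<exists>y. generates E y \<and> norm1 E y = 2 * int q"
  then obtain y where "y \<in> edge_lattice E" "norm1 E y = 2 * int q"
    "\<And>z. z \<in> edge_lattice E \<Longrightarrow> \<exists>k. \<forall>e. z e = k * y e" unfolding generates_def by blast
  then show "has_linear_resolution E (toric E :: ('v set, 'k) mpoly set) q"
    using q by (intro cyclic_linear_resolution[OF E]) auto
qed

lemma cycle_of_lengthE: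
  assumes "cycle_of_length C r"
  obtains c where "is_cycle (edges C) c" "length c = r" "C = (set c, set (cycle_edges c))"
proof -
  obtain c where "distinct c" "length c = r" "r \<ge> 3" "C = (set c, set (cycle_edges c))"
    using assms unfolding cycle_of_length_iff by blast
  then show ?thesis using that[of c] by (simp add: is_cycle_def)
qed

lemma cycle_of_lengthI: "is_cycle F c \<Longrightarrow> cycle_of_length (set c, set (cycle_edges c)) (length c)"
  unfolding cycle_of_length_iff is_cycle_def by (intro exI[of _ c]) simp

theorem theorem1p5:
  fixes G :: "'v graph" and B :: "nat \<Rightarrow> 'v graph" and q s :: nat
  assumes "q \<ge> 3"
    and "simple_graph G" and "finite (verts G)" and "connected_graph G"
    and "bij_betw B {1..s} (non_edge_blocks G)"
  shows "edge_ring_has_linear_resolution TYPE('k::field) G q \<longleftrightarrow>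
      (s = 1 \<and> cycle_of_length (B 1) (2 * q))
    \<or> (s = 1 \<and> \<not> bipartite (B 1) \<and>
        (\<exists>C p. cycle_of_length C (2 * q) \<and> add_path_to_cycle C p (B 1)))
    \<or> (s = 2 \<and> ((cycle_of_length (B 1) (2 * q) \<and> odd_cycle (B 2)) \<or>
                (cycle_of_length (B 2) (2 * q) \<and> odd_cycle (B 1))))
    \<or> (s = 2 \<and> (\<exists>r1 r2. odd r1 \<and> odd r2 \<and> cycle_of_length (B 1) r1 \<and> cycle_of_length (B 2) r2 \<and>
                card (verts (B 1) \<inter> verts (B 2)) = 1 \<and> r1 + r2 = 2 * q))
    \<or> (s = 2 \<and> (\<exists>r1 r2. odd r1 \<and> odd r2 \<and> cycle_of_length (B 1) r1 \<and> cycle_of_length (B 2) r2 \<and>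
                verts (B 1) \<inter> verts (B 2) = {} \<and>
                real (distance_between G (verts (B 1)) (verts (B 2))) = real q - real (r1 + r2) / 2))"
    (is "?L \<longleftrightarrow> ?i \<or> ?ii \<or> ?iii \<or> ?iv \<or> ?v")
proof -
  interpret finite_connected_graph G using assms(2-4) by unfold_locales
  let ?N = "non_edge_blocks G"
  have q: "q > 0" using assms(1) by simp
  have L: "?L \<longleftrightarrow> (\<exists>y. generates E y \<and> norm1 E y = 2 * int q)"
    unfolding edge_ring_has_linear_resolution_def toric_ideal_eq
    by (rule linear_resolution_iff_generates[OF fin card2 assms(1)])
  have card_N: "card ?N = s" using bij_betw_same_card[OF assms(5)] by simp
  have img: "?N = B ` {1..s}" using assms(5) by (simp add: bij_betw_def)
  have N1: "?N = {B 1}" if "s = 1" using img that by simp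
  have N2: "?N = {B 1, B 2}" "B 1 \<noteq> B 2" if "s = 2"
  proof -
    have "{1..2::nat} = {1, 2}" by auto
    then show eq: "?N = {B 1, B 2}" using img that by simp
    show "B 1 \<noteq> B 2" using card_N that unfolding eq by auto
  qed
  have s1: "s = 1" "B 1 = X" if X: "?N = {X}" for X
  proof -
    show s: "s = 1" using card_N X by simp
    show "B 1 = X" using N1[OF s] X by simp
  qed
  \<comment> \<open>The enumeration \<open>B\<close> may list the two blocks in either
    order.\<close>
  have s2: "s = 2" "(B 1 = X \<and> B 2 = Y) \<or> (B 1 = Y \<and> B 2 = X)" if XY: "?N = {X, Y}" "X \<noteq> Y" for X Y
  proof -
    show s: "s = 2" using card_N XY by simp
    show "(B 1 = X \<and> B 2 = Y) \<or> (B 1 = Y \<and> B 2 = X)" using N2[OF s] XY by (auto simp: doubleton_eq_iff)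
  qed
  \<comment> \<open>Intersecting cycles have distance 0, so (iv) and (v) become the same equation
    between lengths and distance.\<close>
  have dist0: "distance_between G U V = 0" if "v \<in> U \<inter> V" "U \<subseteq> verts G" for v U V
  proof -
    have "\<exists>r. path_in G r \<and> hd r \<in> U \<and> last r \<in> V \<and> length r = 0 + 1"
      using that by (intro exI[of _ "[v]"]) (auto simp: path_in_def path_edges_eq)
    then have "distance_between G U V \<le> 0" unfolding distance_between_def by (rule Least_le)
    then show ?thesis by simp
  qed
  have odd_cycleI: "odd_cycle (set d, set (cycle_edges d))" if "is_cycle E d" "odd (length d)" for d
    using cycle_of_lengthI[OF that(1)] that(2) by (auto simp: odd_cycle_def)
  have "?i \<or> ?ii \<or> ?iii \<or> ?iv \<or> ?v" if ?L
  proof -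
    obtain y where y: "generates E y" "norm1 E y = 2 * int q" using \<open>?L\<close> L by blast
    \<comment> \<open>An even cycle in some block leads to (i), (ii) or (iii); otherwise all cycles
      are odd and (iv) or (v) holds.\<close>
    show ?thesis
    proof (cases "\<exists>X\<in>?N. \<exists>c. is_cycle (edges X) c \<and> even (length c)")
      case True
      then obtain X c where X: "X \<in> ?N" and c: "is_cycle (edges X) c" "even (length c)" by blast
      note eb = even_block[OF y q X c]
      have len: "length c = 2 * q" by (rule eb(4))
      have cl: "cycle_of_length (set c, set (cycle_edges c)) (2 * q)"
        using cycle_of_lengthI[OF c(1)] len by simp
      show ?thesis
      proof (cases "X = (set c, set (cycle_edges c))")
        case False
        then obtain p where p: "?N = {X}" "\<not> bipartite X" "add_path_to_cycle (set c, set (cycle_edges c)) p X"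
          using eb(3) by blast
        then have ?ii using s1[OF p(1)] cl by blast
        then show ?thesis by blast
      next
        case eq: True
        show ?thesis
        proof (cases "?N = {X}")
          case True
          then have ?i using s1[OF True] eq cl by simp
          then show ?thesis by blast
        next
          case False
          then obtain Y where Y: "Y \<in> ?N" "Y \<noteq> X" using X by blast
          obtain d where d: "is_cycle E d" "odd (length d)" "Y = (set d, set (cycle_edges d))"
            using eb(1)[OF Y] by blast
          have "?N = {X, Y}" using eb(2)[OF _ Y(1) _ Y(2)] X Y(1) by blast
          from s2[OF this Y(2)[symmetric]] have ?iii using cl odd_cycleI[OF d(1,2)] eq d(3) by auto
          then show ?thesis by blast
        qed
      qed
    next
      case False
      then have odd: "odd (length c)" if "X \<in> ?N" "is_cycle (edges X) c" for X c using that by blast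
      show ?thesis
      proof (rule odd_blocks[OF y q odd])
        fix c d
        assume c: "is_cycle E c" "odd (length c)" and d: "is_cycle E d" "odd (length d)"
          and N: "?N = {(set c, set (cycle_edges c)), (set d, set (cycle_edges d))}"
          and ne: "(set c, set (cycle_edges c)) \<noteq> (set d, set (cycle_edges d))"
          and meet: "\<And>x y. x \<in> set c \<inter> set d \<Longrightarrow> y \<in> set c \<inter> set d \<Longrightarrow> x = y"
        \<comment> \<open>This is proved for an arbitrary naming of the cycles, so that it applies
          to both orders of the blocks.\<close>
        have res: "?iv \<or> ?v"
          if B12: "B 1 = (set c, set (cycle_edges c))" "B 2 = (set d, set (cycle_edges d))"
            and c: "is_cycle E c" "odd (length c)" and d: "is_cycle E d" "odd (length d)"
            and meet: "\<And>x y. x \<in> set c \<inter> set d \<Longrightarrow> y \<in> set c \<inter> set d \<Longrightarrow> x = y" for c d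
        proof -
          have len: "length c + length d + 2 * distance_between G (set c) (set d) = 2 * q"
            using odd_pair(1)[OF y q c d] meet by blast
          have cl: "cycle_of_length (B 1) (length c)" "cycle_of_length (B 2) (length d)"
            using cycle_of_lengthI[OF c(1)] cycle_of_lengthI[OF d(1)] B12 by simp_all
          show ?thesis
          proof (cases "set c \<inter> set d = {}")
            case True
            have "real (length c + length d + 2 * distance_between G (set c) (set d)) = real (2 * q)"
              by (simp only: len)
            then have "real (distance_between G (set c) (set d)) = real q - real (length c + length d) / 2"
              by (simp add: field_simps)
            then have ?v using s2(1)[OF N ne] c(2) d(2) cl True B12 by auto
            then show ?thesis by blast
          next
            case False
            then obtain v where v: "v \<in> set c \<inter> set d" by blast
            then have "set c \<inter> set d = {v}" using meet[OF v] by blast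
            then have "card (verts (B 1) \<inter> verts (B 2)) = 1" using B12 by simp
            moreover have "length c + length d = 2 * q"
              using len dist0[OF v cycle_verts[OF simple c(1)]] by simp
            ultimately have ?iv using s2(1)[OF N ne] c(2) d(2) cl by blast
            then show ?thesis by blast
          qed
        qed
        from s2(2)[OF N ne] have "?iv \<or> ?v"
        proof
          assume "B 1 = (set c, set (cycle_edges c)) \<and> B 2 = (set d, set (cycle_edges d))"
          then show ?thesis using res[of c d] c d meet by blast
        next
          assume "B 1 = (set d, set (cycle_edges d)) \<and> B 2 = (set c, set (cycle_edges c))"
          then show ?thesis using res[of d c] c d meet by blast
        qed
        then show ?thesis by blast
      qed
    qed
  qed
  moreover have ?L if ?i
  proof -
    have N: "?N = {B 1}" using that N1 by blast
    have "cycle_of_length (B 1) (2 * q)" using that by blast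
    then obtain c where c: "is_cycle (edges (B 1)) c" "length c = 2 * q" "B 1 = (set c, set (cycle_edges c))"
      by (rule cycle_of_lengthE)
    have "is_cycle E c" using is_cycle_mono[OF c(1) block_edges] N by simp
    then show ?L unfolding L using generates_unicyclic[of c q] N c(2,3) by simp
  qed
  moreover have ?L if ii: ?ii
  proof -
    have N: "?N = {B 1}" using that N1 by blast
    obtain C p where Cp: "cycle_of_length C (2 * q)" "add_path_to_cycle C p (B 1)" using ii by blast
    obtain c where c: "is_cycle (edges C) c" "length c = 2 * q" "C = (set c, set (cycle_edges c))"
      using Cp(1) by (rule cycle_of_lengthE)
    have p: "ear (set c, set (cycle_edges c)) p"
      "B 1 = (set c \<union> set p, set (cycle_edges c) \<union> set (walk_edges p))"
      using Cp(2) unfolding add_path_to_cycle_def path_edges_eq c(3) ear_def by simp_all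
    have "is_cycle (edges (B 1)) c" using c(1) p(2) by (auto simp: is_cycle_def)
    then show ?L unfolding L using generates_theta[OF N _ c(2) p(1) _ p(2)] that p(2) by auto
  qed
  moreover have ?L if ?iii
  proof -
    have eo: "\<exists>y. generates E y \<and> norm1 E y = 2 * int q"
      if XY: "?N = {X, Y}" "X \<noteq> Y" and X: "cycle_of_length X (2 * q)" and Y: "odd_cycle Y" for X Y
    proof -
      obtain c where c: "is_cycle (edges X) c" "length c = 2 * q" "X = (set c, set (cycle_edges c))"
        using X by (rule cycle_of_lengthE)
      obtain r where r: "odd r" "cycle_of_length Y r" using Y by (auto simp: odd_cycle_def)
      obtain d where d: "is_cycle (edges Y) d" "length d = r" "Y = (set d, set (cycle_edges d))"
        using r(2) by (rule cycle_of_lengthE)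
      have "is_cycle E c" "is_cycle E d"
        using is_cycle_mono[OF c(1) block_edges] is_cycle_mono[OF d(1) block_edges] XY(1) by auto
      moreover have "set (cycle_edges c) \<inter> set (cycle_edges d) = {}"
        using block_disjoint[of X Y] XY c(3) d(3) by simp
      ultimately show ?thesis
        using generates_even_odd[of c d q] XY(1) c(2,3) d(2,3) r(1) by simp
    qed
    have N: "?N = {B 1, B 2}" "B 1 \<noteq> B 2" using that N2 by blast+
    then have N': "?N = {B 2, B 1}" by (simp add: insert_commute)
    show ?L unfolding L using that eo[OF N] eo[OF N' N(2)[symmetric]] by blast
  qed
  moreover have ?L if two: "s = 2" "odd r1" "odd r2" "cycle_of_length (B 1) r1" "cycle_of_length (B 2) r2"
    and len: "r1 + r2 + 2 * distance_between G (verts (B 1)) (verts (B 2)) = 2 * q" for r1 r2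
  proof -
    have N: "?N = {B 1, B 2}" "B 1 \<noteq> B 2" using two(1) N2 by blast+
    obtain c where c: "is_cycle (edges (B 1)) c" "length c = r1" "B 1 = (set c, set (cycle_edges c))"
      using two(4) by (rule cycle_of_lengthE)
    obtain d where d: "is_cycle (edges (B 2)) d" "length d = r2" "B 2 = (set d, set (cycle_edges d))"
      using two(5) by (rule cycle_of_lengthE)
    have B: "B 1 \<in> ?N" "B 2 \<in> ?N" using N(1) by simp_all
    have cd: "is_cycle E c" "is_cycle E d"
      using is_cycle_mono[OF c(1) block_edges[OF B(1)]] is_cycle_mono[OF d(1) block_edges[OF B(2)]] by auto
    have disj: "set (cycle_edges c) \<inter> set (cycle_edges d) = {}"
      using block_disjoint[OF B N(2)] c(3) d(3) by simp
    have len': "length c + length d + 2 * distance_between G (set c) (set d) = 2 * q"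
      using len c(2,3) d(2,3) by simp
    have "\<exists>y. generates E y \<and> norm1 E y = 2 * int q"
    proof (rule generates_odd_odd[OF _ cd(1) _ cd(2) _ disj _ len'])
      show "?N = {(set c, set (cycle_edges c)), (set d, set (cycle_edges d))}" using N(1) c(3) d(3) by simp
      show "odd (length c)" "odd (length d)" using two c(2) d(2) by simp_all
    qed (rule block_cycle_meet[OF B N(2) c(1) d(1)])
    then show ?L unfolding L .
  qed note two_odd = this
  moreover have ?L if iv: ?iv
  proof -
    obtain r1 r2 where r: "s = 2" "odd r1" "odd r2" "cycle_of_length (B 1) r1" "cycle_of_length (B 2) r2"
      "card (verts (B 1) \<inter> verts (B 2)) = 1" "r1 + r2 = 2 * q" using iv by blast
    obtain v where v: "verts (B 1) \<inter> verts (B 2) = {v}" using r(6) by (auto simp: card_1_singleton_iff)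
    have "verts (B 1) \<subseteq> verts G"
      using N2(1)[OF r(1)] by (auto simp: non_edge_blocks_def block_iff subgraph_def)
    then have "distance_between G (verts (B 1)) (verts (B 2)) = 0" using dist0[of v] v by blast
    then show ?L using two_odd[OF r(1-5)] r(7) by simp
  qed
  moreover have ?L if v: ?v
  proof -
    obtain r1 r2 where r: "s = 2" "odd r1" "odd r2" "cycle_of_length (B 1) r1" "cycle_of_length (B 2) r2"
      "real (distance_between G (verts (B 1)) (verts (B 2))) = real q - real (r1 + r2) / 2" using v by blast
    have "real (r1 + r2 + 2 * distance_between G (verts (B 1)) (verts (B 2))) = real (2 * q)"
      using r(6) by (simp add: field_simps)
    then have "r1 + r2 + 2 * distance_between G (verts (B 1)) (verts (B 2)) = 2 * q" by (simp only: of_nat_eq_iff)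
    then show ?L by (rule two_odd[OF r(1-5)])
  qed
  ultimately show ?thesis by blast
qed



end
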